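(* Let $\Lambda,\Lambda'\subset\mathbb{R}^d$ be Delone sets of finite local complexity and let $\phi:\Omega_\Lambda\to\Omega_{\Lambda'}$ be a topological conjugacy. Then $\phi$ is the composition of a shape conjugacy with a mutual local derivation, i.e. $\phi=s\circ\psi$ where $\psi$ is a mutual local derivation from $\Omega_\Lambda$ onto the hull of some FLC Delone set and $s$ is a shape conjugacy from that hull onto $\Omega_{\Lambda'}$. Furthermore, for every $\epsilon>0$ the decomposition can be chosen so that $s$ moves each point of each pattern by less than $\epsilon$.
   Context: A Delone set is a uniformly discrete, relatively dense subset of $\mathbb{R}^d$; it has finite local complexity (FLC) if for each $R>0$ it has only finitely many patches of radius $R$ up to translation. The hull $\Omega_\Lambda$ is the closure of $\{\Lambda-x:x\in\mathbb{R}^d\}$ in the usual tiling metric (two point sets are at distance at most $\delta$ if they agree on the ball of radius $1/\delta$ about $0$ up to a translation of size at most $\delta$), with $\mathbb{R}^d$ acting by translation; hulls of tilings are defined likewise. A topological conjugacy is an $\mathbb{R}^d$-equivariant homeomorphism of hulls. A point set $\Lambda_1$ is locally derivable from $\Lambda$ if there is $R>0$ such that whether $x\in\Lambda_1$ is determined by $B_R(0)\cap(\Lambda-x)$ alone; this induces a factor map $\Omega_\Lambda\to\Omega_{\Lambda_1}$ called a local derivation. The same definition applies to tilings (identified with the boundary sets of their tiles). A mutual local derivation is a bijective local derivation whose inverse is also a local derivation. Cochains: a polyhedral tiling $\mathbf{T}$ is viewed as a cell decomposition of $\mathbb{R}^d$; a (vector-valued) $k$-cochain assigns a (vector) value to each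 $k$-cell. It is strongly pattern equivariant if for some $R$ the value on a cell depends only on the pattern of the tiling within distance $R$ of that cell (up to translation), and weakly pattern equivariant if it is a limit, in the sup-norm, of strongly pattern equivariant cochains. Shape deformation and shape conjugacy: let $\mathbf{T},\mathbf{T}'$ be FLC polyhedral tilings. $\mathbf{T}'$ is a shape deformation of $\mathbf{T}$ if the two tilings have the same combinatorics and the $1$-cochain $\alpha$ on $\mathbf{T}$ assigning to an edge $e$ the displacement vector along the corresponding edge $e'$ of $\mathbf{T}'$ is strongly pattern equivariant. Let $F$ be the vector-valued $0$-cochain on $\mathbf{T}$ given by $F(x)=x'-x$, where $x'$ is the vertex of $\mathbf{T}'$ corresponding to the vertex $x$ of $\mathbf{T}$. If $F$ is weakly pattern equivariant, then the map $\mathbf{T}-x\mapsto\mathbf{T}'-x$ ($x\in\mathbb{R}^d$) is uniformly continuous and extends to a continuous $\mathbb{R}^d$-equivariant surjection $\Omega_{\mathbf{T}}\to\Omega_{\mathbf{T}'}$ (in each tiling $\mathbf{T}_1\in\Omega_{\mathbf{T}}$, it moves each vertex $x$ by $F(x)$, with $F$ extended by continuity to the hull); this map is called a shape semi-conjugacy, and a shape conjugacy if it is invertible. For Delone sets, shape conjugacies are understood via FLC polyhedral tilings that are mutually locally derivable with them and have them as vertex sets, such as the Delone tiling (the dual of the Voronoi tiling). *)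

theory Defs
  imports "HOL-Analysis.Analysis"
begin

section \<open>Point sets, patches and hulls\<close>

text \<open>\<open>translate P x\<close> is the set usually written \<open>P - x\<close>.\<close>

definition translate :: "'a::real_vector set \<Rightarrow> 'a \<Rightarrow> 'a set" where
  "translate P x = (\<lambda>p. p - x) ` P"

lemma mem_translate_iff: "p \<in> translate P x \<longleftrightarrow> p + x \<in> P"
proof
  assume "p + x \<in> P"
  then show "p \<in> translate P x"
    unfolding translate_def by (rule rev_image_eqI) simp
qed (auto simp: translate_def)

lemma translate_translate: "translate (translate P x) y = translate P (x + y)"
  by (rule set_eqI) (simp add: mem_translate_iff add.assoc add.commute[of y x])

lemma translate_0 [simp]: "translate P 0 = P"
  by (simp add: translate_def)

definition patch :: "real \<Rightarrow> 'a::real_normed_vector set \<Rightarrow> 'a \<Rightarrow> 'a set" where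
  "patch R P x = cball 0 R \<inter> translate P x"

definition delone :: "'a::euclidean_space set \<Rightarrow> bool" where
  "delone P \<longleftrightarrow>
     uniform_discrete P \<and> (\<exists>R>0. \<forall>x. \<exists>y\<in>P. dist x y \<le> R)"

definition finite_local_complexity :: "'a::euclidean_space set \<Rightarrow> bool" where
  "finite_local_complexity P \<longleftrightarrow> (\<forall>R>0. finite (patch R P ` P))"

text \<open>
  \<open>tiling_close \<delta> A B\<close> says that \<open>A\<close> and \<open>B\<close> are at distance at most \<open>\<delta>\<close> in the tiling metric.
  Only the topology of this metric is used below. It is defined on all subsets of the space, so
  that the same notion applies to point sets and to the boundary sets of tilings; hulls of FLC
  patterns consist of sets that look locally like translates of the original one.
\<close>

definition tiling_close :: "real \<Rightarrow> 'a::real_normed_vector set \<Rightarrow> 'a set \<Rightarrow> bool" where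
  "tiling_close \<delta> A B \<longleftrightarrow>
     (\<exists>t. norm t \<le> \<delta> \<and> A \<inter> cball 0 (1/\<delta>) = translate B t \<inter> cball 0 (1/\<delta>))"

definition tiling_topology :: "'a::real_normed_vector set topology" where
  "tiling_topology = topology (\<lambda>U. \<forall>A\<in>U. \<exists>\<delta>>0. \<forall>B. tiling_close \<delta> A B \<longrightarrow> B \<in> U)"

lemma tiling_close_mono:
  assumes "tiling_close \<delta> A B" "0 < \<delta>" "\<delta> \<le> \<epsilon>"
  shows "tiling_close \<epsilon> A B"
proof -
  obtain t where t: "norm t \<le> \<delta>" "A \<inter> cball 0 (1/\<delta>) = translate B t \<inter> cball 0 (1/\<delta>)"
    using assms(1) by (auto simp: tiling_close_def)
  have "1/\<epsilon> \<le> 1/\<delta>"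
    using assms(2,3) by (intro divide_left_mono) auto
  then have "cball 0 (1/\<epsilon>) \<subseteq> cball (0::'a) (1/\<delta>)"
    by (simp add: subset_cball)
  then have "A \<inter> cball 0 (1/\<epsilon>) = translate B t \<inter> cball 0 (1/\<epsilon>)"
    using t(2) by blast
  moreover have "norm t \<le> \<epsilon>"
    using t(1) assms(3) by simp
  ultimately show ?thesis
    unfolding tiling_close_def by blast
qed

lemma openin_tiling_topology:
  "openin tiling_topology U \<longleftrightarrow> (\<forall>A\<in>U. \<exists>\<delta>>0. \<forall>B. tiling_close \<delta> A B \<longrightarrow> B \<in> U)"
proof -
  have "istopology (\<lambda>U::'a set set. \<forall>A\<in>U. \<exists>\<delta>>0. \<forall>B. tiling_close \<delta> A B \<longrightarrow> B \<in> U)"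
    unfolding istopology_def
  proof (intro conjI allI impI ballI)
    fix S T :: "'a set set" and A
    assume S: "\<forall>A\<in>S. \<exists>\<delta>>0. \<forall>B. tiling_close \<delta> A B \<longrightarrow> B \<in> S"
      and T: "\<forall>A\<in>T. \<exists>\<delta>>0. \<forall>B. tiling_close \<delta> A B \<longrightarrow> B \<in> T"
      and A: "A \<in> S \<inter> T"
    obtain d where d: "d > 0" "\<And>B. tiling_close d A B \<Longrightarrow> B \<in> S"
      using S A by blast
    obtain e where e: "e > 0" "\<And>B. tiling_close e A B \<Longrightarrow> B \<in> T"
      using T A by blast
    show "\<exists>\<delta>>0. \<forall>B. tiling_close \<delta> A B \<longrightarrow> B \<in> S \<inter> T"
    proof (intro exI[of _ "min d e"] conjI allI impI)
      show "min d e > 0"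
        using d(1) e(1) by simp
      fix B assume "tiling_close (min d e) A B"
      then have "tiling_close d A B" "tiling_close e A B"
        using d(1) e(1) by (auto elim: tiling_close_mono)
      then show "B \<in> S \<inter> T"
        using d(2) e(2) by blast
    qed
  next
    fix K :: "'a set set set" and A
    assume K: "\<forall>S\<in>K. \<forall>A\<in>S. \<exists>\<delta>>0. \<forall>B. tiling_close \<delta> A B \<longrightarrow> B \<in> S"
      and A: "A \<in> \<Union>K"
    then show "\<exists>\<delta>>0. \<forall>B. tiling_close \<delta> A B \<longrightarrow> B \<in> \<Union>K"
      by (meson UnionE UnionI)
  qed
  then show ?thesis
    by (simp add: tiling_topology_def topology_inverse')
qed

definition tiling_hull :: "'a::real_normed_vector set \<Rightarrow> 'a set set" where
  "tiling_hull P = tiling_topology closure_of (range (translate P))"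

text \<open>The closure is the one given by the balls of the metric:\<close>

lemma tiling_close_trans:
  assumes "tiling_close (\<delta>/2) A B" "tiling_close (\<delta>/2) B C" "0 < \<delta>" "\<delta> \<le> 1"
  shows "tiling_close \<delta> A C"
proof -
  obtain t where t: "norm t \<le> \<delta>/2"
    "A \<inter> cball 0 (1/(\<delta>/2)) = translate B t \<inter> cball 0 (1/(\<delta>/2))"
    using assms(1) unfolding tiling_close_def by blast
  obtain u where u: "norm u \<le> \<delta>/2"
    "B \<inter> cball 0 (1/(\<delta>/2)) = translate C u \<inter> cball 0 (1/(\<delta>/2))"
    using assms(2) unfolding tiling_close_def by blast
  have d: "1/\<delta> \<ge> 1"
    using assms(3,4) by simp
  have "p \<in> A \<longleftrightarrow> p \<in> translate C (u + t)" if p: "norm p \<le> 1/\<delta>" for p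
  proof -
    have "norm (p + t) \<le> 1/\<delta> + \<delta>/2"
      using norm_triangle_ineq[of p t] p t(1) by linarith
    also have "\<dots> \<le> 1/(\<delta>/2)"
      using d assms(4) by simp
    finally have 1: "p + t \<in> cball 0 (1/(\<delta>/2))"
      unfolding mem_cball_0 .
    have "1/\<delta> \<le> 1/(\<delta>/2)"
      using d by simp
    then have 2: "p \<in> cball 0 (1/(\<delta>/2))"
      using p unfolding mem_cball_0 by (rule order_trans[rotated])
    have "p \<in> A \<longleftrightarrow> p \<in> translate B t"
      using t(2) 2 by blast
    also have "\<dots> \<longleftrightarrow> p + t \<in> B"
      by (rule mem_translate_iff)
    also have "\<dots> \<longleftrightarrow> p + t \<in> translate C u"
      using u(2) 1 by blast
    also have "\<dots> \<longleftrightarrow> p + t + u \<in> C"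
      by (rule mem_translate_iff)
    finally show ?thesis
      by (simp add: mem_translate_iff ac_simps)
  qed
  then have "A \<inter> cball 0 (1/\<delta>) = translate C (u + t) \<inter> cball 0 (1/\<delta>)"
    unfolding set_eq_iff Int_iff mem_cball_0 by blast
  moreover have "norm (u + t) \<le> \<delta>"
    using norm_triangle_ineq[of u t] t(1) u(1) by linarith
  ultimately show ?thesis
    unfolding tiling_close_def by blast
qed

lemma mem_tiling_hull_iff:
  "A \<in> tiling_hull P \<longleftrightarrow> (\<forall>\<delta>>0. \<exists>x. tiling_close \<delta> A (translate P x))"
proof
  assume A: "A \<in> tiling_hull P"
  show "\<forall>\<delta>>0. \<exists>x. tiling_close \<delta> A (translate P x)"
  proof (intro allI impI)
    fix \<delta> :: real assume \<delta>: "\<delta> > 0"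
    define U where "U = {B. \<exists>\<eta>>0. \<forall>C. tiling_close \<eta> B C \<longrightarrow> tiling_close \<delta> A C}"
    have "openin tiling_topology U"
      unfolding openin_tiling_topology
    proof
      fix B assume "B \<in> U"
      then obtain \<eta> where \<eta>: "\<eta> > 0" "\<And>C. tiling_close \<eta> B C \<Longrightarrow> tiling_close \<delta> A C"
        by (auto simp: U_def)
      define \<theta> where "\<theta> = min \<eta> 1"
      have \<theta>: "\<theta> > 0" "\<theta> \<le> 1" "\<theta> \<le> \<eta>"
        using \<eta>(1) by (auto simp: \<theta>_def)
      have "C \<in> U" if C: "tiling_close (\<theta>/2) B C" for C
      proof -
        have "tiling_close \<delta> A D" if "tiling_close (\<theta>/2) C D" for D
          using \<eta>(2) tiling_close_mono[OF tiling_close_trans[OF C that \<theta>(1,2)] \<theta>(1,3)] .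
        then show ?thesis
          using \<theta>(1) by (auto simp: U_def intro!: exI[of _ "\<theta>/2"])
      qed
      then show "\<exists>\<delta>>0. \<forall>C. tiling_close \<delta> B C \<longrightarrow> C \<in> U"
        using \<theta>(1) by (intro exI[of _ "\<theta>/2"]) auto
    qed
    moreover have "A \<in> U"
      using \<delta> by (auto simp: U_def)
    ultimately obtain x where "translate P x \<in> U"
      using A unfolding tiling_hull_def in_closure_of by blast
    then obtain \<eta> where "\<eta> > 0" "\<And>C. tiling_close \<eta> (translate P x) C \<Longrightarrow> tiling_close \<delta> A C"
      by (auto simp: U_def)
    moreover have "tiling_close \<eta> (translate P x) (translate P x)" if "\<eta> > 0" for \<eta>
      using that by (auto simp: tiling_close_def intro!: exI[of _ 0])
    ultimately show "\<exists>x. tiling_close \<delta> A (translate P x)"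
      by blast
  qed
next
  assume close: "\<forall>\<delta>>0. \<exists>x. tiling_close \<delta> A (translate P x)"
  have "topspace tiling_topology = (UNIV :: 'a set set)"
  proof -
    have "openin tiling_topology (UNIV :: 'a set set)"
      unfolding openin_tiling_topology by (intro ballI exI[of _ "1::real"]) simp
    then show ?thesis
      using openin_subset[of tiling_topology "UNIV :: 'a set set"] by blast
  qed
  moreover have "\<exists>B\<in>range (translate P). B \<in> U"
    if U: "A \<in> U" "openin tiling_topology U" for U
  proof -
    obtain \<delta> where "\<delta> > 0" "\<And>B. tiling_close \<delta> A B \<Longrightarrow> B \<in> U"
      using U unfolding openin_tiling_topology by blast
    then show ?thesis
      using close by blast
  qed
  ultimately show "A \<in> tiling_hull P"
    unfolding tiling_hull_def in_closure_of by blast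
qed

abbreviation hull_topology :: "'a::real_normed_vector set set \<Rightarrow> 'a set topology" where
  "hull_topology \<Omega> \<equiv> subtopology tiling_topology \<Omega>"

definition topological_conjugacy ::
  "'a::real_normed_vector set set \<Rightarrow> 'a set set \<Rightarrow> ('a set \<Rightarrow> 'a set) \<Rightarrow> bool" where
  "topological_conjugacy \<Omega> \<Omega>' \<phi> \<longleftrightarrow>
     homeomorphic_map (hull_topology \<Omega>) (hull_topology \<Omega>') \<phi> \<and>
     (\<forall>P\<in>\<Omega>. \<forall>x. \<phi> (translate P x) = translate (\<phi> P) x)"


section \<open>Local derivations\<close>

definition locally_derivable_within :: "real \<Rightarrow> 'a::real_normed_vector set \<Rightarrow> 'a set \<Rightarrow> bool" where
  "locally_derivable_within R P Q \<longleftrightarrow>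
     (\<forall>x y. patch R P x = patch R P y \<longrightarrow> (x \<in> Q \<longleftrightarrow> y \<in> Q))"

text \<open>
  The map induced on the hull of \<open>P\<close>: a point \<open>x\<close> belongs to the image of \<open>P\<^sub>1\<close> if the patch of
  \<open>P\<^sub>1\<close> at \<open>x\<close> is one of those that, in \<open>P\<close>, produce a point of \<open>Q\<close>.
\<close>

definition local_derivation ::
  "'a::real_normed_vector set \<Rightarrow> 'a set \<Rightarrow> ('a set \<Rightarrow> 'a set) \<Rightarrow> bool" where
  "local_derivation P Q \<psi> \<longleftrightarrow>
     (\<exists>R>0. locally_derivable_within R P Q \<and>
        (\<forall>P\<^sub>1\<in>tiling_hull P. \<psi> P\<^sub>1 = {x. \<exists>y\<in>Q. patch R P\<^sub>1 x = patch R P y}))"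

definition mutual_local_derivation ::
  "'a::real_normed_vector set \<Rightarrow> 'a set \<Rightarrow> ('a set \<Rightarrow> 'a set) \<Rightarrow> bool" where
  "mutual_local_derivation P Q \<psi> \<longleftrightarrow>
     local_derivation P Q \<psi> \<and>
     bij_betw \<psi> (tiling_hull P) (tiling_hull Q) \<and>
     local_derivation Q P (inv_into (tiling_hull P) \<psi>)"


section \<open>Polyhedral tilings and pattern equivariant cochains\<close>

text \<open>Tilings by convex polytopes that meet full face to full face.\<close>

definition polyhedral_tiling :: "'a::euclidean_space set set \<Rightarrow> bool" where
  "polyhedral_tiling T \<longleftrightarrow>
     (\<forall>t\<in>T. polytope t \<and> interior t \<noteq> {}) \<and>
     \<Union>T = UNIV \<and>
     (\<forall>t\<in>T. \<forall>u\<in>T. (t \<inter> u) face_of t \<and> (t \<inter> u) face_of u) \<and>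
     (\<forall>R. finite {t \<in> T. t \<inter> cball 0 R \<noteq> {}})"

definition tiling_boundary :: "'a::euclidean_space set set \<Rightarrow> 'a set" where
  "tiling_boundary T = (\<Union>t\<in>T. frontier t)"

definition tiling_cells :: "'a::euclidean_space set set \<Rightarrow> 'a set set" where
  "tiling_cells T = {c. c \<noteq> {} \<and> (\<exists>t\<in>T. c face_of t)}"

definition tiling_vertices :: "'a::euclidean_space set set \<Rightarrow> 'a set" where
  "tiling_vertices T = {x. {x} \<in> tiling_cells T}"

definition oriented_edges :: "'a::euclidean_space set set \<Rightarrow> ('a \<times> 'a) set" where
  "oriented_edges T = {(x, y). x \<noteq> y \<and> closed_segment x y \<in> tiling_cells T}"

definition tiles_within :: "real \<Rightarrow> 'a::euclidean_space set set \<Rightarrow> 'a set \<Rightarrow> 'a set set" where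
  "tiles_within R T c = {t \<in> T. \<exists>x\<in>c. \<exists>y\<in>t. dist x y \<le> R}"

definition translate_tiles :: "'a::euclidean_space set set \<Rightarrow> 'a \<Rightarrow> 'a set set" where
  "translate_tiles S x = (\<lambda>t. translate t x) ` S"

definition flc_tiling :: "'a::euclidean_space set set \<Rightarrow> bool" where
  "flc_tiling T \<longleftrightarrow>
     (\<forall>R>0. \<exists>\<Q>. finite \<Q> \<and> (\<forall>x. \<exists>S\<in>\<Q>. \<exists>v. tiles_within R T {x} = translate_tiles S v))"

text \<open>A 0-cochain is a function on vertices, a 1-cochain a function on oriented edges.\<close>

definition strongly_PE_0 :: "'a::euclidean_space set set \<Rightarrow> ('a \<Rightarrow> 'b) \<Rightarrow> bool" where
  "strongly_PE_0 T F \<longleftrightarrow>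
     (\<exists>R. \<forall>x\<in>tiling_vertices T. \<forall>y\<in>tiling_vertices T.
        translate_tiles (tiles_within R T {x}) x = translate_tiles (tiles_within R T {y}) y \<longrightarrow>
        F x = F y)"

definition strongly_PE_1 :: "'a::euclidean_space set set \<Rightarrow> ('a \<times> 'a \<Rightarrow> 'b) \<Rightarrow> bool" where
  "strongly_PE_1 T \<alpha> \<longleftrightarrow>
     (\<exists>R. \<forall>(x, y)\<in>oriented_edges T. \<forall>(u, v)\<in>oriented_edges T.
        y - x = v - u \<and>
        translate_tiles (tiles_within R T (closed_segment x y)) x =
          translate_tiles (tiles_within R T (closed_segment u v)) u \<longrightarrow>
        \<alpha> (x, y) = \<alpha> (u, v))"

definition weakly_PE_0 ::
  "'a::euclidean_space set set \<Rightarrow> ('a \<Rightarrow> 'b::real_normed_vector) \<Rightarrow> bool" where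
  "weakly_PE_0 T F \<longleftrightarrow>
     (\<forall>\<epsilon>>0. \<exists>G. strongly_PE_0 T G \<and> (\<forall>x\<in>tiling_vertices T. norm (F x - G x) \<le> \<epsilon>))"


section \<open>Shape deformations and shape conjugacies\<close>

definition combinatorial_isomorphism ::
  "'a::euclidean_space set set \<Rightarrow> 'a set set \<Rightarrow> ('a set \<Rightarrow> 'a set) \<Rightarrow> bool" where
  "combinatorial_isomorphism T T' \<Phi> \<longleftrightarrow>
     bij_betw \<Phi> (tiling_cells T) (tiling_cells T') \<and>
     (\<forall>c\<in>tiling_cells T. aff_dim (\<Phi> c) = aff_dim c) \<and>
     (\<forall>c\<in>tiling_cells T. \<forall>c'\<in>tiling_cells T. \<Phi> c \<subseteq> \<Phi> c' \<longleftrightarrow> c \<subseteq> c')"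

definition corresponding_vertex :: "('a set \<Rightarrow> 'a set) \<Rightarrow> 'a \<Rightarrow> 'a" where
  "corresponding_vertex \<Phi> x = the_elem (\<Phi> {x})"

definition shape_deformation ::
  "'a::euclidean_space set set \<Rightarrow> 'a set set \<Rightarrow> ('a set \<Rightarrow> 'a set) \<Rightarrow> bool" where
  "shape_deformation T T' \<Phi> \<longleftrightarrow>
     polyhedral_tiling T \<and> flc_tiling T \<and> polyhedral_tiling T' \<and> flc_tiling T' \<and>
     combinatorial_isomorphism T T' \<Phi> \<and>
     strongly_PE_1 T (\<lambda>(x, y). corresponding_vertex \<Phi> y - corresponding_vertex \<Phi> x)"

definition vertex_displacement :: "('a set \<Rightarrow> 'a set) \<Rightarrow> 'a \<Rightarrow> 'a::euclidean_space" where
  "vertex_displacement \<Phi> x = corresponding_vertex \<Phi> x - x"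

definition tiling_shape_semi_conjugacy ::
  "'a::euclidean_space set set \<Rightarrow> 'a set set \<Rightarrow> ('a set \<Rightarrow> 'a set) \<Rightarrow> ('a set \<Rightarrow> 'a set) \<Rightarrow> bool" where
  "tiling_shape_semi_conjugacy T T' \<Phi> S \<longleftrightarrow>
     shape_deformation T T' \<Phi> \<and>
     weakly_PE_0 T (vertex_displacement \<Phi>) \<and>
     continuous_map (hull_topology (tiling_hull (tiling_boundary T)))
       (hull_topology (tiling_hull (tiling_boundary T'))) S \<and>
     (\<forall>x. S (translate (tiling_boundary T) x) = translate (tiling_boundary T') x)"

definition tiling_shape_conjugacy ::
  "'a::euclidean_space set set \<Rightarrow> 'a set set \<Rightarrow> ('a set \<Rightarrow> 'a set) \<Rightarrow> ('a set \<Rightarrow> 'a set) \<Rightarrow> bool" where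
  "tiling_shape_conjugacy T T' \<Phi> S \<longleftrightarrow>
     tiling_shape_semi_conjugacy T T' \<Phi> S \<and>
     topological_conjugacy (tiling_hull (tiling_boundary T)) (tiling_hull (tiling_boundary T')) S"

text \<open>
  Shape conjugacies between hulls of Delone sets. The point sets \<open>P\<close> and \<open>Q\<close> are base points of
  the two hulls; they need not be the ones from which the hulls were originally formed.
  The function \<open>f\<close> encodes the extension by continuity of the displacement cochain
  to the hull: it lives on the patterns of the hull that contain the origin, and the point \<open>x\<close> of
  a pattern \<open>P\<^sub>1\<close> is moved by \<open>f (translate P\<^sub>1 x)\<close>.
\<close>

definition shape_conjugacy_with_displacement ::
  "'a::euclidean_space set set \<Rightarrow> 'a set set \<Rightarrow> ('a set \<Rightarrow> 'a set) \<Rightarrow> ('a set \<Rightarrow> 'a) \<Rightarrow> bool" where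
  "shape_conjugacy_with_displacement \<Omega> \<Omega>' s f \<longleftrightarrow>
     (\<exists>P Q T T' \<Phi> S m m'.
        delone P \<and> finite_local_complexity P \<and> tiling_hull P = \<Omega> \<and>
        delone Q \<and> finite_local_complexity Q \<and> tiling_hull Q = \<Omega>' \<and>
        tiling_shape_conjugacy T T' \<Phi> S \<and>
        tiling_vertices T = P \<and> mutual_local_derivation P (tiling_boundary T) m \<and>
        tiling_vertices T' = Q \<and> mutual_local_derivation Q (tiling_boundary T') m' \<and>
        (\<forall>P\<^sub>1\<in>\<Omega>. s P\<^sub>1 \<in> \<Omega>' \<and> m' (s P\<^sub>1) = S (m P\<^sub>1)) \<and>
        continuous_map (hull_topology {P\<^sub>1 \<in> \<Omega>. 0 \<in> P\<^sub>1}) euclidean f \<and>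
        (\<forall>x\<in>P. f (translate P x) = vertex_displacement \<Phi> x) \<and>
        (\<forall>P\<^sub>1\<in>\<Omega>. s P\<^sub>1 = {x + f (translate P\<^sub>1 x) | x. x \<in> P\<^sub>1}))"

definition shape_conjugacy ::
  "'a::euclidean_space set set \<Rightarrow> 'a set set \<Rightarrow> ('a set \<Rightarrow> 'a set) \<Rightarrow> bool" where
  "shape_conjugacy \<Omega> \<Omega>' s \<longleftrightarrow> (\<exists>f. shape_conjugacy_with_displacement \<Omega> \<Omega>' s f)"

end

theory Submission
  imports Defs "HOL-Library.Diagonal_Subsequence"
begin

text \<open>
  Replace \<open>\<Lambda>'\<close> by the point \<open>Q = \<phi> \<Lambda>\<close> of its hull. By uniform continuity of \<open>\<phi>\<close> and of its inverse, a
  large patch of \<open>Q\<close> around a point \<open>x\<close> determines the pattern of \<open>\<Lambda>\<close> near \<open>x\<close> up to a small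
  translation; moving each \<open>x\<close> by this translation gives a point set \<open>P\<close> that is mutually locally derivable
  with \<open>\<Lambda>\<close> and differs from \<open>Q\<close> by a small, weakly pattern equivariant displacement with
  strongly pattern equivariant differences.

  Tilings with vertex sets \<open>P\<close> and \<open>Q\<close> have to be locally derivable from these sets and
  combinatorially equal. Both are Delaunay tilings with respect to one inner product, chosen generic for
  \<open>Q\<close>: then all Delaunay cells of \<open>Q\<close> are simplices and, by finite local complexity, the
  Delaunay triangulation does not change under uniformly small perturbations of the points.
\<close>

section \<open>Patches, hulls and local derivations\<close>

text \<open>The obstacle is the order of the choices. The tilings of the moved set and of
  \<open>Q\<close> must agree combinatorially, although nothing is known about the moved set in
  advance; so the admissible displacement is extracted from \<open>Q\<close> alone, by compactness
  for one patch and by finiteness for all of them, before that set exists. Likewise the radius of a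
  determining patch depends on the displacement, so no discreteness constant may depend on that
  radius; differences of points are therefore compared over bounded distances only and added up
  along chains. Estimates become equalities in two ways. Differences of bounded length form a finite
  set, so two of them that are close are equal; hence edge vectors are strongly pattern equivariant
  although a finite patch gives the displacement only up to an error. And contact sets of empty
  spheres of the generic set \<open>Q\<close> have at most d + 1 points, while those of the moved
  set are contained in them, so a contact set with d + 1 points is the same before and
  after.\<close>

lemma mem_patch_iff: "z \<in> patch R P x \<longleftrightarrow> norm z \<le> R \<and> z + x \<in> P"
  by (simp add: patch_def mem_translate_iff)

lemma patch_eq_iff:
  "patch R P x = patch R Q y \<longleftrightarrow> (\<forall>z. norm z \<le> R \<longrightarrow> (z + x \<in> P \<longleftrightarrow> z + y \<in> Q))"
  by (auto simp: set_eq_iff mem_patch_iff)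

lemma patch_eqD: "patch R P x = patch R Q y \<Longrightarrow> norm z \<le> R \<Longrightarrow> z + x \<in> P \<longleftrightarrow> z + y \<in> Q"
  by (simp add: patch_eq_iff)

lemma patch_eq_mono: "patch R P x = patch R Q y \<Longrightarrow> R' \<le> R \<Longrightarrow> patch R' P x = patch R' Q y"
  by (auto simp: patch_eq_iff)

lemma patch_eq_shift:
  fixes P Q :: "'a::real_normed_vector set"
  assumes "patch R P x = patch R Q y" "norm v + R' \<le> R"
  shows "patch R' P (x + v) = patch R' Q (y + v)"
  unfolding patch_eq_iff
proof (intro allI impI)
  fix z :: 'a assume "norm z \<le> R'"
  then have "norm (z + v) \<le> R" using norm_triangle_ineq[of z v] assms(2) by linarith
  from patch_eqD[OF assms(1) this] show "z + (x + v) \<in> P \<longleftrightarrow> z + (y + v) \<in> Q"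
    by (simp add: ac_simps)
qed

lemma patch_translate: "patch R (translate P x) y = patch R P (x + y)"
  by (simp add: patch_def translate_translate)

lemma tiling_close_iff_patch:
  "tiling_close \<delta> A B \<longleftrightarrow> (\<exists>t. norm t \<le> \<delta> \<and> patch (1/\<delta>) A 0 = patch (1/\<delta>) B t)"
  by (auto simp: tiling_close_def patch_def Int_commute)

lemma tiling_close_refl_patch:
  "patch (1/\<delta>) A 0 = patch (1/\<delta>) B 0 \<Longrightarrow> 0 < \<delta> \<Longrightarrow> tiling_close \<delta> A B"
  by (auto simp: tiling_close_iff_patch intro!: exI[of _ 0])

text \<open>The small translation in \<open>tiling_close\<close> is absorbed by the choice of
  \<open>x\<close>, since the whole orbit of \<open>P\<close> is available. Membership in the hull
  becomes exact: every patch of \<open>A\<close> occurs in \<open>P\<close>.\<close>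

lemma mem_tiling_hull_iff_patch: "A \<in> tiling_hull P \<longleftrightarrow> (\<forall>R. \<exists>x. patch R A 0 = patch R P x)"
proof
  assume A: "A \<in> tiling_hull P"
  show "\<forall>R. \<exists>x. patch R A 0 = patch R P x"
  proof
    fix R :: real
    have "1 / max R 1 > 0" by simp
    with A obtain x where "tiling_close (1 / max R 1) A (translate P x)"
      unfolding mem_tiling_hull_iff by blast
    then obtain t where "patch (max R 1) A 0 = patch (max R 1) P (x + t)"
      by (auto simp: tiling_close_iff_patch patch_translate)
    from patch_eq_mono[OF this] show "\<exists>x. patch R A 0 = patch R P x" by auto
  qed
next
  assume *: "\<forall>R. \<exists>x. patch R A 0 = patch R P x"
  show "A \<in> tiling_hull P"
    unfolding mem_tiling_hull_iff
  proof (intro allI impI)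
    fix \<delta> :: real assume "\<delta> > 0"
    obtain x where "patch (1/\<delta>) A 0 = patch (1/\<delta>) P x" using * by blast
    then have "tiling_close \<delta> A (translate P x)"
      using \<open>\<delta> > 0\<close> by (intro tiling_close_refl_patch) (auto simp: patch_translate)
    then show "\<exists>x. tiling_close \<delta> A (translate P x)" ..
  qed
qed

lemma tiling_hull_patch: 
  assumes "A \<in> tiling_hull P" shows "\<exists>x. patch R A y = patch R P x"
proof -
  obtain x where "patch (norm y + R) A 0 = patch (norm y + R) P x"
    using assms unfolding mem_tiling_hull_iff_patch by blast
  from patch_eq_shift[OF this, of y R] show ?thesis by auto
qed

lemma self_in_tiling_hull: "P \<in> tiling_hull P"
  unfolding mem_tiling_hull_iff_patch by blast

lemma translate_in_tiling_hull: "A \<in> tiling_hull P \<Longrightarrow> translate A x \<in> tiling_hull P"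
  unfolding mem_tiling_hull_iff_patch[of "translate A x"] patch_translate
  using tiling_hull_patch by blast

section \<open>Continuity on hulls\<close>

lemma topspace_tiling_topology [simp]: "topspace tiling_topology = UNIV"
proof -
  have "openin tiling_topology (UNIV :: 'a set set)"
    unfolding openin_tiling_topology by (intro ballI exI[of _ "1::real"]) simp
  then show ?thesis using openin_subset[of tiling_topology "UNIV :: 'a set set"] by blast
qed

text \<open>The ball \<open>tiling_close \<delta> A\<close> itself need not be open. Its interior is
  written down explicitly, and the halved radii in \<open>tiling_close_trans\<close> show that this
  set is open.\<close>

lemma tiling_close_nbhd:
  assumes "\<delta> > 0"
  shows "\<exists>U. openin tiling_topology U \<and> A \<in> U \<and> (\<forall>B\<in>U. tiling_close \<delta> A B)"
proof (intro exI conjI)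
  let ?U = "{B. \<exists>\<eta>>0. \<forall>C. tiling_close \<eta> B C \<longrightarrow> tiling_close \<delta> A C}"
  show "openin tiling_topology ?U"
    unfolding openin_tiling_topology
  proof
    fix B assume "B \<in> ?U"
    then obtain \<eta> where \<eta>: "\<eta> > 0" "\<And>C. tiling_close \<eta> B C \<Longrightarrow> tiling_close \<delta> A C" by auto
    define \<theta> where "\<theta> = min \<eta> 1"
    have \<theta>: "\<theta> > 0" "\<theta> \<le> 1" "\<theta> \<le> \<eta>" using \<eta>(1) by (auto simp: \<theta>_def)
    have "C \<in> ?U" if C: "tiling_close (\<theta>/2) B C" for C
    proof -
      have "tiling_close \<delta> A D" if "tiling_close (\<theta>/2) C D" for D
        using \<eta>(2) tiling_close_mono[OF tiling_close_trans[OF C that \<theta>(1,2)] \<theta>(1,3)] .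
      then show ?thesis using \<theta>(1) by (auto intro!: exI[of _ "\<theta>/2"])
    qed
    then show "\<exists>\<delta>>0. \<forall>C. tiling_close \<delta> B C \<longrightarrow> C \<in> ?U"
      using \<theta>(1) by (intro exI[of _ "\<theta>/2"]) auto
  qed
  show "A \<in> ?U" using assms by auto
  show "\<forall>B\<in>?U. tiling_close \<delta> A B"
  proof
    fix B assume "B \<in> ?U"
    then obtain \<eta> where \<eta>: "\<eta> > 0" "\<And>C. tiling_close \<eta> B C \<Longrightarrow> tiling_close \<delta> A C" by auto
    show "tiling_close \<delta> A B" using \<eta> by (intro \<eta>(2) tiling_close_refl_patch) auto
  qed
qed

lemma continuous_map_hullI:
  assumes "\<And>A. A \<in> \<Omega> \<Longrightarrow> f A \<in> topspace Y"
    and nbhd: "\<And>A U. A \<in> \<Omega> \<Longrightarrow> openin Y U \<Longrightarrow> f A \<in> U \<Longrightarrow>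
      \<exists>\<eta>>0. \<forall>B\<in>\<Omega>. tiling_close \<eta> A B \<longrightarrow> f B \<in> U"
  shows "continuous_map (hull_topology \<Omega>) Y f"
  unfolding continuous_map
proof (intro conjI allI impI)
  show "f ` topspace (hull_topology \<Omega>) \<subseteq> topspace Y" using assms(1) by auto
  fix U assume U: "openin Y U"
  show "openin (hull_topology \<Omega>) {x \<in> topspace (hull_topology \<Omega>). f x \<in> U}"
  proof (subst openin_subopen, safe)
    fix A assume "A \<in> topspace (hull_topology \<Omega>)" "f A \<in> U"
    then have A: "A \<in> \<Omega>" "f A \<in> U" by simp_all
    obtain \<eta> where \<eta>: "\<eta> > 0" "\<forall>B\<in>\<Omega>. tiling_close \<eta> A B \<longrightarrow> f B \<in> U"
      using nbhd[OF A(1) U A(2)] by (elim exE conjE)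
    obtain V where V: "openin tiling_topology V" "A \<in> V" "\<forall>B\<in>V. tiling_close \<eta> A B"
      using tiling_close_nbhd[OF \<eta>(1)] by blast
    show "\<exists>T. openin (hull_topology \<Omega>) T \<and> A \<in> T \<and>
        T \<subseteq> {x \<in> topspace (hull_topology \<Omega>). f x \<in> U}"
    proof (intro exI[of _ "\<Omega> \<inter> V"] conjI)
      show "openin (hull_topology \<Omega>) (\<Omega> \<inter> V)" using V(1) by (rule openin_subtopology_Int2)
    qed (use A V(2,3) \<eta>(2) in auto)
  qed
qed

lemma continuous_map_hull_iff:
  fixes \<Omega> :: "'a::real_normed_vector set set" and \<Omega>' :: "'b::real_normed_vector set set"
  shows "continuous_map (hull_topology \<Omega>) (hull_topology \<Omega>') \<phi> \<longleftrightarrow>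
     \<phi> ` \<Omega> \<subseteq> \<Omega>' \<and>
     (\<forall>A\<in>\<Omega>. \<forall>\<delta>>0. \<exists>\<eta>>0. \<forall>B\<in>\<Omega>. tiling_close \<eta> A B \<longrightarrow> tiling_close \<delta> (\<phi> A) (\<phi> B))"
  (is "?l \<longleftrightarrow> ?r")
proof
  assume c: ?l
  show ?r
  proof (intro conjI ballI allI impI)
    show "\<phi> ` \<Omega> \<subseteq> \<Omega>'" using c by (auto simp: continuous_map_in_subtopology)
    fix A and \<delta> :: real assume A: "A \<in> \<Omega>" and "\<delta> > 0"
    then obtain U where U: "openin tiling_topology U" "\<phi> A \<in> U" "\<forall>B\<in>U. tiling_close \<delta> (\<phi> A) B"
      using tiling_close_nbhd by blast
    have "continuous_map (hull_topology \<Omega>) tiling_topology \<phi>"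
      using c by (auto simp: continuous_map_in_subtopology)
    from openin_continuous_map_preimage[OF this U(1)]
    obtain V where V: "openin tiling_topology V" "{x \<in> \<Omega>. \<phi> x \<in> U} = V \<inter> \<Omega>"
      by (auto simp: openin_subtopology)
    have "A \<in> V" using V(2) A U(2) by auto
    then obtain \<eta> where "\<eta> > 0" "\<forall>B. tiling_close \<eta> A B \<longrightarrow> B \<in> V"
      using V(1) unfolding openin_tiling_topology by blast
    then show "\<exists>\<eta>>0. \<forall>B\<in>\<Omega>. tiling_close \<eta> A B \<longrightarrow> tiling_close \<delta> (\<phi> A) (\<phi> B)"
      using U(3) V(2) by (intro exI[of _ \<eta>]) auto
  qed
next
  assume r: ?r
  have "continuous_map (hull_topology \<Omega>) tiling_topology \<phi>"
  proof (rule continuous_map_hullI)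
    fix A U assume A: "A \<in> \<Omega>" "openin tiling_topology U" "\<phi> A \<in> U"
    then obtain \<delta> where \<delta>: "\<delta> > 0" "\<forall>B. tiling_close \<delta> (\<phi> A) B \<longrightarrow> B \<in> U"
      unfolding openin_tiling_topology by blast
    then obtain \<eta> where "\<eta> > 0" "\<forall>B\<in>\<Omega>. tiling_close \<eta> A B \<longrightarrow> tiling_close \<delta> (\<phi> A) (\<phi> B)"
      using r A(1) by blast
    then show "\<exists>\<eta>>0. \<forall>B\<in>\<Omega>. tiling_close \<eta> A B \<longrightarrow> \<phi> B \<in> U"
      using \<delta>(2) by (intro exI[of _ \<eta>]) simp
  qed simp
  then show ?l using r by (auto simp: continuous_map_in_subtopology)
qed

section \<open>Topological conjugacies\<close>

lemma topological_conjugacy_inv: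
  assumes "topological_conjugacy (tiling_hull P) (tiling_hull Q) \<phi>"
  shows "topological_conjugacy (tiling_hull Q) (tiling_hull P) (inv_into (tiling_hull P) \<phi>)"
    and "bij_betw \<phi> (tiling_hull P) (tiling_hull Q)"
proof -
  let ?\<psi> = "inv_into (tiling_hull P) \<phi>"
  obtain \<psi> where \<psi>: "homeomorphic_maps (hull_topology (tiling_hull P)) (hull_topology (tiling_hull Q)) \<phi> \<psi>"
    using assms unfolding topological_conjugacy_def homeomorphic_map_maps by blast
  show bij: "bij_betw \<phi> (tiling_hull P) (tiling_hull Q)"
    using assms homeomorphic_imp_injective_map[of "hull_topology (tiling_hull P)" "hull_topology (tiling_hull Q)" \<phi>]
      homeomorphic_imp_surjective_map[of "hull_topology (tiling_hull P)" "hull_topology (tiling_hull Q)" \<phi>]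
    unfolding topological_conjugacy_def bij_betw_def by simp
  have eq: "?\<psi> B = \<psi> B" if "B \<in> tiling_hull Q" for B
  proof -
    have "\<psi> B \<in> tiling_hull P" "\<phi> (\<psi> B) = B"
      using \<psi> that by (auto simp: homeomorphic_maps_def continuous_map_def Pi_iff)
    then show ?thesis using bij by (metis bij_betw_inv_into_left)
  qed
  have "homeomorphic_map (hull_topology (tiling_hull Q)) (hull_topology (tiling_hull P)) ?\<psi>"
  proof (rule homeomorphic_map_eq)
    show "homeomorphic_map (hull_topology (tiling_hull Q)) (hull_topology (tiling_hull P)) \<psi>"
      using \<psi> homeomorphic_maps_map by blast
  qed (use eq in auto)
  moreover have "?\<psi> (translate B x) = translate (?\<psi> B) x" if B: "B \<in> tiling_hull Q" for B x
  proof -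
    have "?\<psi> B \<in> tiling_hull P" using bij B by (metis bij_betwE bij_betw_inv_into)
    then have "translate (?\<psi> B) x \<in> tiling_hull P"
      and "\<phi> (translate (?\<psi> B) x) = translate (\<phi> (?\<psi> B)) x"
      using assms by (auto simp: topological_conjugacy_def translate_in_tiling_hull)
    moreover have "\<phi> (?\<psi> B) = B" using bij B by (metis bij_betw_inv_into_right)
    ultimately show ?thesis using bij by (metis bij_betw_inv_into_left)
  qed
  ultimately show "topological_conjugacy (tiling_hull Q) (tiling_hull P) ?\<psi>"
    unfolding topological_conjugacy_def by blast
qed

lemma topological_conjugacy_compose:
  assumes "topological_conjugacy A B f" "topological_conjugacy B C g"
  shows "topological_conjugacy A C (\<lambda>x. g (f x))"
proof -
  have "f ` A \<subseteq> B" 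
    using assms(1) homeomorphic_imp_continuous_map[of "hull_topology A" "hull_topology B" f]
    unfolding topological_conjugacy_def continuous_map_hull_iff by blast
  moreover have "homeomorphic_map (hull_topology A) (hull_topology C) (g \<circ> f)"
    using assms homeomorphic_map_compose unfolding topological_conjugacy_def by blast
  ultimately show ?thesis
    using assms unfolding topological_conjugacy_def o_def by auto
qed

text \<open>Allows \<open>\<phi> P\<close> to serve as base point of the target hull. Continuity
  carries the density of the orbit of \<open>P\<close> over to the orbit of
  \<open>\<phi> P\<close>.\<close>

lemma tiling_hull_image:
  assumes \<phi>: "topological_conjugacy (tiling_hull P) (tiling_hull Q) \<phi>"
  shows "tiling_hull (\<phi> P) = tiling_hull Q"
proof -
  have hom: "homeomorphic_map (hull_topology (tiling_hull P)) (hull_topology (tiling_hull Q)) \<phi>"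
    using \<phi> by (simp add: topological_conjugacy_def)
  have cont: "continuous_map (hull_topology (tiling_hull P)) (hull_topology (tiling_hull Q)) \<phi>"
    using hom by (rule homeomorphic_imp_continuous_map)
  note c = cont[unfolded continuous_map_hull_iff]
  have PQ: "\<phi> P \<in> tiling_hull Q" using c self_in_tiling_hull by auto
  show ?thesis
  proof (intro subset_antisym subsetI)
    fix A assume "A \<in> tiling_hull (\<phi> P)"
    then have A: "\<exists>x. patch R A 0 = patch R (\<phi> P) x" for R
      unfolding mem_tiling_hull_iff_patch by blast
    show "A \<in> tiling_hull Q"
      unfolding mem_tiling_hull_iff_patch
    proof
      fix R
      obtain x where x: "patch R A 0 = patch R (\<phi> P) x" using A by blast
      then show "\<exists>x. patch R A 0 = patch R Q x" using tiling_hull_patch[OF PQ] by simp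
    qed
  next
    fix A assume "A \<in> tiling_hull Q"
    then obtain B where B: "B \<in> tiling_hull P" "A = \<phi> B"
      using topological_conjugacy_inv(2)[OF \<phi>] by (auto simp: bij_betw_def)
    show "A \<in> tiling_hull (\<phi> P)"
      unfolding mem_tiling_hull_iff
    proof (intro allI impI)
      fix \<delta> :: real assume "\<delta> > 0"
      then obtain \<eta> where \<eta>: "\<eta> > 0"
        "\<forall>C\<in>tiling_hull P. tiling_close \<eta> B C \<longrightarrow> tiling_close \<delta> (\<phi> B) (\<phi> C)"
        using c B(1) by blast
      obtain x where x: "tiling_close \<eta> B (translate P x)"
        using B(1) \<eta>(1) unfolding mem_tiling_hull_iff by blast
      have "\<phi> (translate P x) = translate (\<phi> P) x"
        using \<phi> self_in_tiling_hull by (auto simp: topological_conjugacy_def)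
      moreover have "tiling_close \<delta> (\<phi> B) (\<phi> (translate P x))"
        using \<eta>(2) x translate_in_tiling_hull[OF self_in_tiling_hull] by blast
      ultimately show "\<exists>x. tiling_close \<delta> A (translate (\<phi> P) x)"
        using B(2) by auto
    qed
  qed
qed

section \<open>Delone sets and finite local complexity\<close>

lemma delone_covering: 
  assumes "delone P" obtains r where "r > 0" "\<And>x. \<exists>y\<in>P. dist x y \<le> r"
  using assms unfolding delone_def by blast

lemma delone_separation: 
  assumes "delone P" obtains e where "e > 0" "\<And>x y. x \<in> P \<Longrightarrow> y \<in> P \<Longrightarrow> dist x y < e \<Longrightarrow> x = y"
  using assms unfolding delone_def uniform_discrete_def by metis

lemma separation_tiling_hull:
  assumes A: "A \<in> tiling_hull P" and e: "\<And>x y. x \<in> P \<Longrightarrow> y \<in> P \<Longrightarrow> dist x y < e \<Longrightarrow> x = y"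
    and xy: "x \<in> A" "y \<in> A" "dist x y < e"
  shows "x = y"
proof -
  obtain u where u: "patch e A x = patch e P u" using tiling_hull_patch[OF A] by blast
  have "e > 0" using xy(3) zero_le_dist[of x y] by linarith
  have "0 + u \<in> P" using patch_eqD[OF u, of 0] xy \<open>e > 0\<close> by simp
  moreover have "(y - x) + u \<in> P"
    using patch_eqD[OF u, of "y - x"] xy by (simp add: dist_norm norm_minus_commute)
  ultimately have "0 + u = (y - x) + u"
    using xy(3) by (intro e) (simp_all add: dist_norm norm_minus_commute)
  then show ?thesis by simp
qed

lemma delone_tiling_hull:
  assumes P: "delone P" and A: "A \<in> tiling_hull P"
  shows "delone A"
proof -
  obtain r where r: "r > 0" "\<And>x. \<exists>y\<in>P. dist x y \<le> r" using P by (rule delone_covering) blast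
  obtain e where e: "e > 0" "\<And>x y. x \<in> P \<Longrightarrow> y \<in> P \<Longrightarrow> dist x y < e \<Longrightarrow> x = y"
    using P by (rule delone_separation) blast
  have "x = y" if "x \<in> A" "y \<in> A" "dist x y < e" for x y
    by (rule separation_tiling_hull[OF A e(2) that])
  moreover have "\<exists>y\<in>A. dist x y \<le> r" for x
  proof -
    obtain u where u: "patch r A x = patch r P u" using tiling_hull_patch[OF A] by blast
    obtain y where y: "y \<in> P" "dist u y \<le> r" using r(2) by blast
    have "(y - u) + x \<in> A"
      using patch_eqD[OF u, of "y - u"] y by (auto simp: dist_norm norm_minus_commute)
    then show ?thesis using y(2) by (intro bexI[of _ "(y - u) + x"]) (auto simp: dist_norm norm_minus_commute)
  qed
  ultimately show ?thesis
    unfolding delone_def uniform_discrete_def using r(1) e(1) by blast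
qed

lemma flc_tiling_hull:
  assumes P: "finite_local_complexity P" and A: "A \<in> tiling_hull P"
  shows "finite_local_complexity A"
  unfolding finite_local_complexity_def
proof (intro allI impI)
  fix R :: real assume "R > 0"
  have "patch R A ` A \<subseteq> patch R P ` P"
  proof safe
    fix x assume x: "x \<in> A"
    obtain u where u: "patch R A x = patch R P u" using tiling_hull_patch[OF A] by blast
    have "u \<in> P" using patch_eqD[OF u, of 0] x \<open>R > 0\<close> by simp
    with u show "patch R A x \<in> patch R P ` P" by blast
  qed
  moreover have "finite (patch R P ` P)"
    using P \<open>R > 0\<close> by (auto simp: finite_local_complexity_def)
  ultimately show "finite (patch R A ` A)" by (rule finite_subset)
qed

lemma delone_finite_cball:
  assumes "delone X" shows "finite (X \<inter> cball c R)"
proof -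
  have "uniform_discrete (X \<inter> cball c R)"
    using assms uniform_discrete_subset unfolding delone_def by blast
  then show ?thesis using uniform_discrete_finite_iff bounded_subset[OF bounded_cball] by blast
qed

lemma delone_closed: "delone X \<Longrightarrow> closed X"
  unfolding delone_def by (blast intro: uniform_discrete_imp_closed)

lemma delone_countable:
  assumes "delone X" shows "countable X"
proof -
  have "X = (\<Union>n. X \<inter> cball 0 (real n))"
    by (auto simp: real_arch_simple)
  moreover have "countable (\<Union>n. X \<inter> cball 0 (real n))"
    using delone_finite_cball[OF assms] by (intro countable_UN) (auto intro: countable_finite)
  ultimately show ?thesis by simp
qed

lemma delone_finite_patch:
  assumes "delone P" shows "finite (patch R P p)"
proof -
  have "patch R P p \<subseteq> (\<lambda>x. x - p) ` (P \<inter> cball p R)"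
    by (auto simp: patch_def translate_def dist_norm norm_minus_commute)
  then show ?thesis using finite_subset delone_finite_cball[OF assms] by blast
qed

text \<open>Diagonal sequences replace an appeal to compactness of the hull.\<close>

lemma patch_sequence_limit:
  fixes X :: "nat \<Rightarrow> 'a::euclidean_space"
  assumes P: "finite_local_complexity P" and X: "\<And>n. X n \<in> P"
  shows "\<exists>d A. strict_mono (d :: nat \<Rightarrow> nat) \<and> A \<in> tiling_hull P \<and>
    (\<forall>k n. k < n \<longrightarrow> patch (real k) A 0 = patch (real k) P (X (d n)))"
proof -
  \<comment> \<open>\<open>Q k\<close> asks the patches of radius k to be constant along the
    subsequence; this passes to further subsequences, as the diagonal argument requires.\<close>
  define Q where "Q k \<sigma> = (\<exists>F. \<forall>n. patch (real k) P (X (\<sigma> n)) = F)" for k and \<sigma> :: "nat \<Rightarrow> nat"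
  interpret subseqs Q
  proof
    fix k and s :: "nat \<Rightarrow> nat"
    \<comment> \<open>FLC speaks of positive radii only, hence \<open>Suc k\<close>, which also
      covers radius 0.\<close>
    have fin: "finite (patch (real (Suc k)) P ` P)"
      using P unfolding finite_local_complexity_def by (metis of_nat_0_less_iff zero_less_Suc)
    have "finite (range (\<lambda>n. patch (real (Suc k)) P (X (s n))))"
      by (rule finite_subset[OF _ fin]) (use X in auto)
    then obtain n0 where n0: "infinite {n \<in> UNIV. patch (real (Suc k)) P (X (s n)) = patch (real (Suc k)) P (X (s n0))}"
      using pigeonhole_infinite[of UNIV "\<lambda>n. patch (real (Suc k)) P (X (s n))"] by auto
    let ?N = "{n. patch (real (Suc k)) P (X (s n)) = patch (real (Suc k)) P (X (s n0))}"
    have inf: "infinite ?N" using n0 by simp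
    have "patch (real k) P (X (s (enumerate ?N n))) = patch (real k) P (X (s n0))" for n
    proof (rule patch_eq_mono)
      show "patch (real (Suc k)) P (X (s (enumerate ?N n))) = patch (real (Suc k)) P (X (s n0))"
        using enumerate_in_set[OF inf, of n] by blast
    qed simp
    then show "\<exists>r'. strict_mono r' \<and> Q k (s \<circ> r')"
      using strict_mono_enumerate[OF inf] by (auto simp: Q_def)
  qed
  have "Q k (diagseq \<circ> ((+) (Suc k)))" for k
    by (rule diagseq_holds) (auto simp: Q_def)
  then obtain F where F: "\<And>k n. patch (real k) P (X (diagseq (Suc k + n))) = F k"
    unfolding Q_def o_def by metis
  have F': "patch (real k) P (X (diagseq n)) = F k" if "k < n" for k n
    using F[of k "n - Suc k"] that by simp
  \<comment> \<open>The constant patches \<open>F k\<close> are nested: for any two radii, both are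
    patches of one common point far out in the diagonal sequence.\<close>
  define A where "A = (\<Union>k. F k)"
  have AF: "patch (real k) A 0 = F k" for k
  proof (intro set_eqI iffI)
    fix z assume "z \<in> patch (real k) A 0"
    then obtain l where l: "norm z \<le> k" "z \<in> F l" by (auto simp: mem_patch_iff A_def)
    then have "z + X (diagseq (Suc (max k l))) \<in> P"
      using F'[of l "Suc (max k l)"] mem_patch_iff[of z "real l" P "X (diagseq (Suc (max k l)))"] by simp
    then show "z \<in> F k" using F'[of k "Suc (max k l)"] l(1) mem_patch_iff[of z "real k" P "X (diagseq (Suc (max k l)))"] by simp
  next
    fix z assume "z \<in> F k"
    then show "z \<in> patch (real k) A 0"
      using F'[of k "Suc k"] mem_patch_iff[of z "real k" P "X (diagseq (Suc k))"]
      by (auto simp: mem_patch_iff A_def)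
  qed
  have "A \<in> tiling_hull P"
    unfolding mem_tiling_hull_iff_patch
  proof
    fix R :: real
    obtain k where "R \<le> real k" using real_arch_simple by blast
    then show "\<exists>x. patch R A 0 = patch R P x"
      using AF[of k] F'[of k "Suc k"] by (metis lessI patch_eq_mono)
  qed
  then show ?thesis using subseq_diagseq AF F' by (intro exI[of _ diagseq] exI[of _ A]) simp
qed

text \<open>Uniform continuity of \<open>s\<close> in terms of patches. If it failed, there would be
  bad pairs of points with equal patches of growing radius; along a subsequence both members of the
  pairs converge to the same \<open>A\<close> in the hull, and continuity of \<open>s\<close> at
  \<open>A\<close> brings their images together.\<close>

lemma hull_uniform_continuity:
  fixes P :: "'a::euclidean_space set"
  assumes P: "delone P" "finite_local_complexity P"
    and s: "topological_conjugacy (tiling_hull P) \<Omega> s"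
    and "\<epsilon> > 0"
  shows "\<exists>R>0. \<forall>x y. patch R P x = patch R P y \<longrightarrow>
    (\<exists>t. norm t \<le> \<epsilon> \<and> patch r (s P) x = patch r (s P) (y + t))"
proof -
  have cont: "continuous_map (hull_topology (tiling_hull P)) (hull_topology \<Omega>) s"
    using s homeomorphic_imp_continuous_map by (auto simp: topological_conjugacy_def)
  have str: "s (translate P x) = translate (s P) x" for x
    using s self_in_tiling_hull by (auto simp: topological_conjugacy_def)
  have main: "\<exists>n>0. \<forall>x\<in>P. \<forall>y\<in>P. patch (real n) P x = patch (real n) P y \<longrightarrow>
      (\<exists>t. norm t \<le> \<epsilon> \<and> patch r (s P) x = patch r (s P) (y + t))" for r :: real
  proof (rule ccontr)
    assume neg: "\<not> ?thesis"
    have "\<not> (\<forall>x\<in>P. \<forall>y\<in>P. patch (real (Suc n)) P x = patch (real (Suc n)) P y \<longrightarrow>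
      (\<exists>t. norm t \<le> \<epsilon> \<and> patch r (s P) x = patch r (s P) (y + t)))" for n
      using neg by (metis zero_less_Suc)
    then have "\<forall>n. \<exists>x y. x\<in>P \<and> y\<in>P \<and> patch (real (Suc n)) P x = patch (real (Suc n)) P y \<and>
      \<not> (\<exists>t. norm t \<le> \<epsilon> \<and> patch r (s P) x = patch r (s P) (y + t))" by blast
    from choice[OF this] obtain X where "\<forall>n. \<exists>y. X n\<in>P \<and> y\<in>P \<and>
        patch (real (Suc n)) P (X n) = patch (real (Suc n)) P y \<and>
        \<not> (\<exists>t. norm t \<le> \<epsilon> \<and> patch r (s P) (X n) = patch r (s P) (y + t))" ..
    from choice[OF this] obtain Y where "\<forall>n. X n\<in>P \<and> Y n\<in>P \<and>
        patch (real (Suc n)) P (X n) = patch (real (Suc n)) P (Y n) \<and>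
        \<not> (\<exists>t. norm t \<le> \<epsilon> \<and> patch r (s P) (X n) = patch r (s P) (Y n + t))" ..
    note XY0 = spec[OF this]
    have XY: "\<And>n. X n \<in> P" "\<And>n. Y n \<in> P"
       "\<And>n. patch (real (Suc n)) P (X n) = patch (real (Suc n)) P (Y n)"
       "\<And>n t. norm t \<le> \<epsilon> \<Longrightarrow> patch r (s P) (X n) \<noteq> patch r (s P) (Y n + t)"
      using XY0 by simp_all
    obtain A d where d: "strict_mono d" "A \<in> tiling_hull P"
      "\<And>k n. k < n \<Longrightarrow> patch (real k) A 0 = patch (real k) P (X (d n))"
      using patch_sequence_limit[of P X, OF P(2) XY(1)] by auto
    \<comment> \<open>Two translations of size \<delta> are subtracted below, hence \<epsilon>/2;
      recentring by \<open>t1\<close> costs \<delta> of the radius, so 1/\<delta> has to exceed r +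
      \<delta>.\<close>
    define \<delta> where "\<delta> = min (\<epsilon>/2) (1 / (\<bar>r\<bar>+1))"
    have \<delta>: "\<delta> > 0" "2 * \<delta> \<le> \<epsilon>" "\<delta> \<le> 1 / (\<bar>r\<bar>+1)" using \<open>\<epsilon> > 0\<close> by (auto simp: \<delta>_def)
    have "1 / (\<bar>r\<bar>+1) \<le> 1" by simp
    then have \<delta>1: "\<delta> \<le> 1" using \<delta>(3) by linarith
    have "1/\<delta> \<ge> \<bar>r\<bar> + 1" using \<delta>(1,3) by (simp add: field_simps)
    then have \<delta>r: "\<delta> + r \<le> 1/\<delta>" using \<delta>1 by linarith
    obtain \<eta> where \<eta>: "\<eta> > 0" "\<forall>B\<in>tiling_hull P. tiling_close \<eta> A B \<longrightarrow> tiling_close \<delta> (s A) (s B)"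
      using cont[unfolded continuous_map_hull_iff] d(2) \<delta>(1) by blast
    obtain k where k: "1/\<eta> \<le> real k" using real_arch_simple by blast
    define n where "n = d (Suc k)"
    have A1: "patch (real k) A 0 = patch (real k) P (X n)" using d(3)[of k "Suc k"] by (simp add: n_def)
    have "Suc k \<le> n" unfolding n_def using d(1) by (rule seq_suble)
    then have A2: "patch (real k) A 0 = patch (real k) P (Y n)"
      using A1 patch_eq_mono[OF XY(3)[of n], of "real k"] by auto
    have cl: "\<exists>t. norm t \<le> \<delta> \<and> patch (1/\<delta>) (s A) 0 = patch (1/\<delta>) (s P) (x + t)"
      if "patch (real k) A 0 = patch (real k) P x" for x
    proof -
      have "patch (1/\<eta>) A 0 = patch (1/\<eta>) P x" using patch_eq_mono[OF that k] .
      then have "tiling_close \<eta> A (translate P x)"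
        using \<eta>(1) by (intro tiling_close_refl_patch) (auto simp: patch_translate)
      then have "tiling_close \<delta> (s A) (translate (s P) x)"
        using \<eta>(2) translate_in_tiling_hull[OF self_in_tiling_hull, of P x] str[of x] by auto
      then show ?thesis by (auto simp: tiling_close_iff_patch patch_translate)
    qed
    obtain t1 where t1: "norm t1 \<le> \<delta>" "patch (1/\<delta>) (s A) 0 = patch (1/\<delta>) (s P) (X n + t1)" using cl[OF A1] by blast
    obtain t2 where t2: "norm t2 \<le> \<delta>" "patch (1/\<delta>) (s A) 0 = patch (1/\<delta>) (s P) (Y n + t2)" using cl[OF A2] by blast
    have "patch (1/\<delta>) (s P) (X n + t1) = patch (1/\<delta>) (s P) (Y n + t2)" using t1 t2 by simp
    then have "patch r (s P) (X n + t1 + - t1) = patch r (s P) (Y n + t2 + - t1)"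
      by (rule patch_eq_shift) (use t1(1) \<delta>r in auto)
    then have "patch r (s P) (X n) = patch r (s P) (Y n + (t2 - t1))" by (simp add: algebra_simps)
    moreover have "norm (t2 - t1) \<le> \<epsilon>" using norm_triangle_ineq4[of t2 t1] t1 t2 \<delta> by linarith
    ultimately show False using XY(4) by blast
  qed
  \<comment> \<open>So far both centres are points of \<open>P\<close>. An arbitrary centre is moved
    to a point of \<open>P\<close> within \<open>r0\<close> and back, which costs \<open>r0\<close>
    in both radii.\<close>
  obtain r0 where r0: "r0 > 0" "\<And>x. \<exists>y\<in>P. dist x y \<le> r0" using P(1) by (rule delone_covering) blast
  obtain n where n0: "n > 0" and n: "\<forall>x\<in>P. \<forall>y\<in>P. patch (real n) P x = patch (real n) P y \<longrightarrow>
      (\<exists>t. norm t \<le> \<epsilon> \<and> patch (r+r0) (s P) x = patch (r+r0) (s P) (y + t))"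
    using main[of "r + r0"] by (elim exE conjE)
  show ?thesis
  proof (intro exI[of _ "real n + r0"] conjI allI impI)
    show "real n + r0 > 0" using r0 by simp
    fix x y assume xy: "patch (real n + r0) P x = patch (real n + r0) P y"
    obtain p where p: "p \<in> P" "dist x p \<le> r0" using r0(2) by blast
    define v where "v = p - x"
    have v: "norm v \<le> r0" using p(2) by (simp add: v_def dist_norm norm_minus_commute)
    have 1: "patch (real n) P (x + v) = patch (real n) P (y + v)"
      using patch_eq_shift[OF xy, of v "real n"] v by simp
    have 2: "x + v \<in> P" using p(1) by (simp add: v_def)
    have "v + x \<in> P \<longleftrightarrow> v + y \<in> P" using patch_eqD[OF xy] v by simp
    then have 3: "y + v \<in> P" using 2 by (simp add: add.commute)
    obtain t where t: "norm t \<le> \<epsilon>" "patch (r+r0) (s P) (x + v) = patch (r+r0) (s P) (y + v + t)"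
      using n[rule_format, OF 2 3 1] by (elim exE conjE)
    have "patch r (s P) x = patch r (s P) (y + t)"
      using patch_eq_shift[OF t(2), of "- v" r] v by (simp add: algebra_simps)
    then show "\<exists>t. norm t \<le> \<epsilon> \<and> patch r (s P) x = patch r (s P) (y + t)"
      using t(1) by (intro exI[of _ t] conjI)
  qed
qed

text \<open>The induced maps \<open>ind\<close> are inverse to each other on the base points
  \<open>P\<close> and \<open>Q\<close>. Since they are local and every patch of a pattern in the
  hull occurs in the base point, they are inverse to each other on the whole hulls.\<close>

lemma mutual_local_derivation_exists:
  assumes R: "R > 0" "locally_derivable_within R P Q"
    and R': "R' > 0" "locally_derivable_within R' Q P"
  obtains \<psi> where "mutual_local_derivation P Q \<psi>"
    "topological_conjugacy (tiling_hull P) (tiling_hull Q) \<psi>"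
    "\<And>x. \<psi> (translate P x) = translate Q x"
proof -
  define ind where "ind R P Q A = {x. \<exists>y\<in>Q. patch R A x = patch R P y}"
    for R and P Q A :: "'a set"
  have tr: "ind R P Q (translate A x) = translate (ind R P Q A) x" for R P Q A x
    by (auto simp: ind_def patch_translate mem_translate_iff add.commute)
  have pt: "patch r (ind R P Q A) x = patch r (ind R P Q B) y"
    if "patch (r + R) A x = patch (r + R) B y" for r R P Q A B x y
  proof -
    have "patch R A (z + x) = patch R B (z + y)" if "norm z \<le> r" for z
      using patch_eq_shift[OF \<open>patch (r + R) A x = _\<close>, of z R] that by (simp add: add.commute)
    then have "z + x \<in> ind R P Q A \<longleftrightarrow> z + y \<in> ind R P Q B" if "norm z \<le> r" for z
      using that unfolding ind_def by simp
    then show ?thesis unfolding patch_eq_iff[of r] by blast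
  qed
  have base: "ind R P Q P = Q" if "locally_derivable_within R P Q" for R P Q
    using that unfolding ind_def locally_derivable_within_def by blast
  have hull: "ind R P Q A \<in> tiling_hull Q" if ld: "locally_derivable_within R P Q" and A: "A \<in> tiling_hull P" for R P Q A
    unfolding mem_tiling_hull_iff_patch
  proof
    fix r
    obtain x where "patch (r + R) A 0 = patch (r + R) P x" using tiling_hull_patch[OF A] by blast
    from pt[OF this, where P=P and Q=Q] show "\<exists>x. patch r (ind R P Q A) 0 = patch r Q x"
      using base[OF ld] by auto
  qed
  have inv: "ind R' Q P (ind R P Q A) = A"
    if ld: "locally_derivable_within R P Q" "locally_derivable_within R' Q P" and A: "A \<in> tiling_hull P" for R R' P Q A
  proof -
    have "patch r (ind R' Q P (ind R P Q A)) 0 = patch r A 0" for r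
    proof -
      \<comment> \<open>The signs of the two radii are not known here; \<open>max 0\<close> makes
        \<open>M\<close> dominate both r and r + R' + R.\<close>
      define M where "M = r + max 0 R' + max 0 R"
      obtain x where x0: "patch M A 0 = patch M P x"
        using tiling_hull_patch[OF A, where R=M and y=0] by blast
      have x: "patch (r + R' + R) A 0 = patch (r + R' + R) P x" "patch r A 0 = patch r P x"
        by (rule patch_eq_mono[OF x0], simp add: M_def)+
      from pt[OF x(1)] have "patch (r + R') (ind R P Q A) 0 = patch (r + R') Q x"
        using base[OF ld(1)] by metis
      from pt[OF this] have "patch r (ind R' Q P (ind R P Q A)) 0 = patch r P x"
        using base[OF ld(2)] by metis
      with x(2) show ?thesis by simp
    qed
    then show ?thesis
      by (auto simp: set_eq_iff mem_patch_iff)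
  qed
  have cont: "continuous_map (hull_topology (tiling_hull P)) (hull_topology (tiling_hull Q)) (ind R P Q)"
    if ld: "locally_derivable_within R P Q" and "R > 0" for R P Q
    unfolding continuous_map_hull_iff
  proof (intro conjI ballI allI impI)
    show "ind R P Q ` tiling_hull P \<subseteq> tiling_hull Q" using hull ld by auto
    fix A and \<delta> :: real assume "A \<in> tiling_hull P" "\<delta> > 0"
    \<comment> \<open>The ball of radius 1/\<eta> has to contain the R-neighbourhood of the ball of
      radius 1/\<delta>.\<close>
    define \<eta> where "\<eta> = min \<delta> (1 / (1/\<delta> + R))"
    have M: "1/\<delta> + R > 0" using \<open>\<delta> > 0\<close> \<open>R > 0\<close> by (simp add: add_pos_pos)
    have \<eta>: "\<eta> > 0" "\<eta> \<le> \<delta>" "\<eta> \<le> 1 / (1/\<delta> + R)" using \<open>\<delta> > 0\<close> M by (auto simp: \<eta>_def)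
    have "1/\<delta> + R \<le> 1/\<eta>" using \<eta>(1,3) M by (simp add: field_simps)
    have "tiling_close \<delta> (ind R P Q A) (ind R P Q B)" if "tiling_close \<eta> A B" for B
    proof -
      obtain t where t: "norm t \<le> \<eta>" "patch (1/\<eta>) A 0 = patch (1/\<eta>) B t"
        using \<open>tiling_close \<eta> A B\<close> unfolding tiling_close_iff_patch by blast
      from patch_eq_mono[OF t(2) \<open>1/\<delta> + R \<le> 1/\<eta>\<close>] have "patch (1/\<delta>) (ind R P Q A) 0 = patch (1/\<delta>) (ind R P Q B) t"
        by (rule pt)
      then show ?thesis unfolding tiling_close_iff_patch using t(1) \<eta>(2) by (intro exI[of _ t]) simp
    qed
    then show "\<exists>\<eta>>0. \<forall>B\<in>tiling_hull P. tiling_close \<eta> A B \<longrightarrow>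
        tiling_close \<delta> (ind R P Q A) (ind R P Q B)" using \<eta>(1) by blast
  qed
  let ?\<psi> = "ind R P Q" and ?\<psi>' = "ind R' Q P"
  note i1 = inv[OF R(2) R'(2)] and i2 = inv[OF R'(2) R(2)]
  have hm: "homeomorphic_maps (hull_topology (tiling_hull P)) (hull_topology (tiling_hull Q)) ?\<psi> ?\<psi>'"
    unfolding homeomorphic_maps_def using cont[OF R(2,1)] cont[OF R'(2,1)] i1 i2 by simp
  have conj: "topological_conjugacy (tiling_hull P) (tiling_hull Q) ?\<psi>"
    unfolding topological_conjugacy_def homeomorphic_map_maps using hm tr by blast
  have bij: "bij_betw ?\<psi> (tiling_hull P) (tiling_hull Q)" by (rule topological_conjugacy_inv(2)[OF conj])
  have "inv_into (tiling_hull P) ?\<psi> B = ?\<psi>' B" if "B \<in> tiling_hull Q" for B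
    using hull[OF R'(2) that] i2[OF that] bij by (metis bij_betw_inv_into_left)
  then have "local_derivation Q P (inv_into (tiling_hull P) ?\<psi>)"
    unfolding local_derivation_def using R' by (intro exI[of _ R']) (auto simp: ind_def)
  moreover have "local_derivation P Q ?\<psi>"
    unfolding local_derivation_def using R by (intro exI[of _ R]) (auto simp: ind_def)
  ultimately have "mutual_local_derivation P Q ?\<psi>" using bij unfolding mutual_local_derivation_def by blast
  then show ?thesis using that[of ?\<psi>] conj tr base[OF R(2)] by metis
qed

section \<open>Points in general position and empty spheres\<close>

lemma minimal_affine_dependent_subset:
  assumes "finite V" "affine_dependent V"
  shows "\<exists>U\<subseteq>V. affine_dependent U \<and> (\<forall>p\<in>U. \<not> affine_dependent (U - {p}))"
  using assms
proof (induction V rule: finite_psubset_induct)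
  case (psubset V)
  show ?case
  proof (cases "\<exists>p\<in>V. affine_dependent (V - {p})")
    case True
    then obtain p where "p \<in> V" "affine_dependent (V - {p})" by blast
    with psubset.IH[of "V - {p}"] show ?thesis by blast
  next
    case False
    with psubset.prems show ?thesis by blast
  qed
qed

text \<open>If the form vanished identically, polarisation would show that for each \<open>w\<close>
  the weights u p (w . p) again annihilate the points. Subtracting a multiple of \<open>u\<close>
  that kills the weight of one point gives an affine dependence among the remaining points, against
  minimality.\<close>

lemma circuit_quadratic_nonzero:
  fixes V :: "'a::euclidean_space set"
  assumes fin: "finite V" and min: "\<And>p. p \<in> V \<Longrightarrow> \<not> affine_dependent (V - {p})"
    and u: "sum u V = 0" "(\<Sum>p\<in>V. u p *\<^sub>R p) = 0" "\<exists>p\<in>V. u p \<noteq> 0"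
  shows "\<exists>w. (\<Sum>p\<in>V. u p * (w \<bullet> p)\<^sup>2) \<noteq> 0"
proof (rule ccontr)
  assume "\<not> ?thesis"
  then have B: "(\<Sum>p\<in>V. u p * (w \<bullet> p)\<^sup>2) = 0" for w by blast
  have B2: "(\<Sum>p\<in>V. u p * (w \<bullet> p) * (w' \<bullet> p)) = 0" for w w'
  proof -
    have "0 = (\<Sum>p\<in>V. u p * ((w + w') \<bullet> p)\<^sup>2)" using B by simp
    also have "\<dots> = (\<Sum>p\<in>V. u p * (w \<bullet> p)\<^sup>2 + u p * (w' \<bullet> p)\<^sup>2 + 2 * (u p * (w \<bullet> p) * (w' \<bullet> p)))"
      by (intro sum.cong) (auto simp: inner_add_left power2_eq_square algebra_simps)
    also have "\<dots> = 2 * (\<Sum>p\<in>V. u p * (w \<bullet> p) * (w' \<bullet> p))"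
      by (simp add: sum.distrib B sum_distrib_left)
    finally show ?thesis by simp
  qed
  have B3: "(\<Sum>p\<in>V. (u p * (w \<bullet> p)) *\<^sub>R p) = 0" for w
  proof -
    have "w' \<bullet> (\<Sum>p\<in>V. (u p * (w \<bullet> p)) *\<^sub>R p) = 0" for w'
      using B2[of w w'] by (simp add: inner_sum_right algebra_simps)
    then show ?thesis by (metis inner_eq_zero_iff)
  qed
  obtain p1 where p1: "p1 \<in> V" "u p1 \<noteq> 0" using u(3) by blast
  have "\<exists>p0\<in>V. p0 \<noteq> p1"
  proof (rule ccontr)
    assume "\<not> ?thesis"
    then have "V = {p1}" using p1 by blast
    with u(1) p1 show False by simp
  qed
  then obtain p0 where p0: "p0 \<in> V" "p0 \<noteq> p1" by blast
  \<comment> \<open>With this direction w . p1 - w . p0 is the square of the norm of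
    \<open>w\<close>, so the new weight of \<open>p1\<close> does not vanish.\<close>
  define w where "w = p1 - p0"
  define \<mu> where "\<mu> p = u p * (w \<bullet> p - w \<bullet> p0)" for p
  have \<mu>0: "\<mu> p0 = 0" by (simp add: \<mu>_def)
  have "w \<bullet> (\<Sum>p\<in>V. u p *\<^sub>R p) = 0" using u(2) by simp
  then have s1: "(\<Sum>p\<in>V. u p * (w \<bullet> p)) = 0" by (simp add: inner_sum_right)
  have "(\<Sum>p\<in>V. \<mu> p) = (\<Sum>p\<in>V. u p * (w \<bullet> p)) - (w \<bullet> p0) * sum u V"
    unfolding \<mu>_def sum_distrib_left by (subst sum_subtractf[symmetric], intro sum.cong) (auto simp: algebra_simps)
  then have "(\<Sum>p\<in>V. \<mu> p) = 0" using s1 u(1) by simp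
  then have m1: "(\<Sum>p\<in>V - {p0}. \<mu> p) = 0" using fin p0(1) \<mu>0 by (simp add: sum_diff1)
  have "(\<Sum>p\<in>V. \<mu> p *\<^sub>R p) = (\<Sum>p\<in>V. (u p * (w \<bullet> p)) *\<^sub>R p) - (w \<bullet> p0) *\<^sub>R (\<Sum>p\<in>V. u p *\<^sub>R p)"
    unfolding \<mu>_def scaleR_sum_right by (subst sum_subtractf[symmetric], intro sum.cong) (auto simp: algebra_simps)
  then have "(\<Sum>p\<in>V. \<mu> p *\<^sub>R p) = 0" using B3 u(2) by simp
  then have m2: "(\<Sum>p\<in>V - {p0}. \<mu> p *\<^sub>R p) = 0" using fin p0(1) \<mu>0 by (simp add: sum_diff1)
  have "w \<bullet> p1 - w \<bullet> p0 = w \<bullet> w" by (simp add: w_def inner_diff_right)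
  then have "\<mu> p1 \<noteq> 0" using p1 p0 by (simp add: \<mu>_def w_def)
  then have "affine_dependent (V - {p0})"
    using m1 m2 p1 p0 fin by (subst affine_dependent_explicit_finite) (auto intro!: exI[of _ \<mu>])
  with min p0 show False by blast
qed

section \<open>Shears and general position\<close>

text \<open>A symmetric rank-one perturbation of the identity. The inner product pulled back along
  it depends polynomially on \<open>v\<close> and contains the square of v . x, which brings in the
  quadratic form of a circuit.\<close>

definition shear :: "'a::euclidean_space \<Rightarrow> 'a \<Rightarrow> 'a" where
  "shear v x = x + (v \<bullet> x) *\<^sub>R v"

lemma linear_shear: "linear (shear v)"
  unfolding shear_def by (rule linearI) (auto simp: algebra_simps inner_add_right)

lemma inj_shear: "inj (shear v)"
proof -
  have "x = 0" if "shear v x = 0" for x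
  proof -
    have "0 = shear v x \<bullet> x" using that by simp
    also have "\<dots> = x \<bullet> x + (v \<bullet> x)\<^sup>2" by (simp add: shear_def inner_add_left power2_eq_square)
    finally have "x \<bullet> x + (v \<bullet> x)\<^sup>2 = 0" ..
    then have "x \<bullet> x = 0" by (simp add: add_nonneg_eq_0_iff)
    then show ?thesis by simp
  qed
  then show ?thesis by (simp add: linear_injective_0[OF linear_shear])
qed

lemma norm_shear_squared: "(norm (shear v x))\<^sup>2 = (norm x)\<^sup>2 + (2 + v \<bullet> v) * (v \<bullet> x)\<^sup>2"
  unfolding power2_norm_eq_inner by (simp add: shear_def inner_add_left inner_add_right inner_commute power2_eq_square algebra_simps)

text \<open>Along the line v + s w the sum is a polynomial of degree 4 in s, whose leading
  coefficient is the squared norm of \<open>w\<close> times the assumed nonzero sum. It has finitely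
  many roots, so arbitrarily small s avoid them.\<close>

lemma dense_shear_nonzero:
  fixes V :: "'a::euclidean_space set"
  assumes "(\<Sum>p\<in>V. u p * (w \<bullet> p)\<^sup>2) \<noteq> 0"
  shows "closure {v. (\<Sum>p\<in>V. u p * (norm (shear v p))\<^sup>2) \<noteq> 0} = UNIV" (is "closure ?G = UNIV")
proof -
  have "\<exists>y\<in>?G. dist y v < e" if "e > 0" for v e
  proof (rule ccontr)
    assume neg: "\<not> ?thesis"
    define C where "C = (\<Sum>p\<in>V. u p * (norm p)\<^sup>2)"
    define B0 where "B0 = (\<Sum>p\<in>V. u p * (v \<bullet> p)\<^sup>2)"
    define B1 where "B1 = (\<Sum>p\<in>V. u p * ((v \<bullet> p) * (w \<bullet> p)))"
    define B2 where "B2 = (\<Sum>p\<in>V. u p * (w \<bullet> p)\<^sup>2)"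
    define N0 where "N0 = 2 + v \<bullet> v"
    define N1 where "N1 = v \<bullet> w"
    define N2 where "N2 = w \<bullet> w"
    have "w \<noteq> 0" using assms by auto
    define c where "c i = [C + N0*B0, 2*N0*B1+2*N1*B0, N0*B2 + 4*N1*B1 + N2*B0, 2*N1*B2+2*N2*B1, N2*B2] ! i" for i
    have f: "(\<Sum>p\<in>V. u p * (norm (shear (v + s *\<^sub>R w) p))\<^sup>2) = (\<Sum>i\<le>4. c i * s ^ i)" for s
    proof -
      have "(\<Sum>p\<in>V. u p * ((v + s *\<^sub>R w) \<bullet> p)\<^sup>2) = (\<Sum>p\<in>V. u p * (v \<bullet> p)\<^sup>2 + (2 * s) * (u p * ((v \<bullet> p) * (w \<bullet> p))) + s\<^sup>2 * (u p * (w \<bullet> p)\<^sup>2))"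
        by (intro sum.cong) (auto simp: inner_add_left power2_eq_square algebra_simps)
      also have "\<dots> = B0 + (2 * s) * B1 + s\<^sup>2 * B2"
        by (simp add: sum.distrib sum_distrib_left B0_def B1_def B2_def)
      finally have 1: "(\<Sum>p\<in>V. u p * ((v + s *\<^sub>R w) \<bullet> p)\<^sup>2) = B0 + (2 * s) * B1 + s\<^sup>2 * B2" .
      have 2: "2 + (v + s *\<^sub>R w) \<bullet> (v + s *\<^sub>R w) = N0 + 2 * s * N1 + s\<^sup>2 * N2"
        by (simp add: inner_add_left inner_add_right inner_commute power2_eq_square algebra_simps N0_def N1_def N2_def)
      have "(\<Sum>p\<in>V. u p * (norm (shear (v + s *\<^sub>R w) p))\<^sup>2) =
        C + (2 + (v + s *\<^sub>R w) \<bullet> (v + s *\<^sub>R w)) * (\<Sum>p\<in>V. u p * ((v + s *\<^sub>R w) \<bullet> p)\<^sup>2)"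
        unfolding norm_shear_squared C_def
        by (subst sum_distrib_left, subst sum.distrib[symmetric], intro sum.cong) (auto simp: algebra_simps)
      also have "\<dots> = C + (N0 + 2 * s * N1 + s\<^sup>2 * N2) * (B0 + (2 * s) * B1 + s\<^sup>2 * B2)"
        unfolding 1 2 ..
      also have "\<dots> = (\<Sum>i\<le>4. c i * s ^ i)"
        by (simp add: c_def eval_nat_numeral algebra_simps)
      finally show ?thesis .
    qed
    define \<delta> where "\<delta> = e / norm w"
    have "\<delta> > 0" using \<open>e > 0\<close> \<open>w \<noteq> 0\<close> by (simp add: \<delta>_def)
    have "(\<Sum>i\<le>4. c i * s ^ i) = 0" if "s \<in> {0<..<\<delta>}" for s
    proof -
      have "dist (v + s *\<^sub>R w) v = s * norm w" using that by (simp add: dist_norm)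
      also have "\<dots> < e" using that \<open>w \<noteq> 0\<close> by (simp add: \<delta>_def field_simps)
      finally have "v + s *\<^sub>R w \<notin> ?G" using neg by blast
      then show ?thesis using f by simp
    qed
    then have "{0<..<\<delta>} \<subseteq> {s. (\<Sum>i\<le>4. c i * s ^ i) = 0}" by blast
    moreover have "c 4 \<noteq> 0" using assms \<open>w \<noteq> 0\<close> by (simp add: c_def N2_def B2_def eval_nat_numeral)
    then have "finite {s. (\<Sum>i\<le>4. c i * s ^ i) = 0}" by (rule polyfun_roots_finite) simp
    ultimately have "finite {0<..<\<delta>}" by (rule finite_subset)
    with \<open>\<delta> > 0\<close> show False by (simp add: infinite_Ioo)
  qed
  then show ?thesis by (auto simp: closure_approachable)
qed

text \<open>A cospherical set then has at most d + 1 points and spans a simplex. Dependence is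
  tested on the points themselves, since the maps \<open>g\<close> to be used are linear and
  injective.\<close>

definition in_general_position :: "('a::euclidean_space \<Rightarrow> 'a) \<Rightarrow> 'a set \<Rightarrow> bool" where
  "in_general_position g X \<longleftrightarrow>
     (\<forall>V\<subseteq>X. finite V \<longrightarrow> (\<exists>c \<rho>. \<forall>x\<in>V. dist (g x) c = \<rho>) \<longrightarrow> \<not> affine_dependent V)"

text \<open>On a sphere the squared norm is an affine function of the point, and an affine
  dependence annihilates affine functions.\<close>

lemma cospherical_relation:
  fixes g :: "'a::euclidean_space \<Rightarrow> 'a"
  assumes "linear g" "\<And>x. x \<in> V \<Longrightarrow> dist (g x) c = \<rho>"
    and u: "sum u V = 0" "(\<Sum>p\<in>V. u p *\<^sub>R p) = 0"
  shows "(\<Sum>p\<in>V. u p * (norm (g p))\<^sup>2) = 0"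
proof -
  have "(norm (g p))\<^sup>2 = \<rho>\<^sup>2 - c \<bullet> c + 2 * (c \<bullet> g p)" if "p \<in> V" for p
  proof -
    have "\<rho>\<^sup>2 = (norm (g p - c))\<^sup>2" using assms(2)[OF that] by (simp add: dist_norm)
    then show ?thesis unfolding power2_norm_eq_inner by (simp add: inner_diff inner_commute)
  qed
  then have "(\<Sum>p\<in>V. u p * (norm (g p))\<^sup>2) = (\<Sum>p\<in>V. u p * (\<rho>\<^sup>2 - c \<bullet> c) + 2 * (c \<bullet> (u p *\<^sub>R g p)))"
    by (intro sum.cong refl) (simp, simp add: algebra_simps)
  also have "\<dots> = sum u V * (\<rho>\<^sup>2 - c \<bullet> c) + 2 * (c \<bullet> (\<Sum>p\<in>V. u p *\<^sub>R g p))"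
    by (simp add: sum.distrib sum_distrib_right inner_sum_right sum_distrib_left)
  also have "(\<Sum>p\<in>V. u p *\<^sub>R g p) = g (\<Sum>p\<in>V. u p *\<^sub>R p)"
    using assms(1) by (simp add: linear_sum linear_cmul)
  finally show ?thesis using u assms(1) by (simp add: linear_0)
qed

text \<open>
  The Delaunay tiling of a lattice need not be simplicial, and moving its points breaks the symmetry.
  A change of the inner product preserves all translational symmetries.
\<close>

lemma in_general_position_exists:
  fixes X :: "'a::euclidean_space set"
  assumes "countable X"
  obtains g where "linear g" "inj g" "in_general_position g X"
proof -
  \<comment> \<open>Circuits suffice: a dependent cospherical set contains a circuit, which is
    cospherical as well. There are only countably many finite subsets to consider.\<close>
  define \<V> where "\<V> = {V. finite V \<and> V \<subseteq> X \<and> affine_dependent V \<and> (\<forall>p\<in>V. \<not> affine_dependent (V - {p}))}"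
  define dep where "dep V u \<longleftrightarrow> sum u V = 0 \<and> (\<exists>v\<in>V. u v \<noteq> 0) \<and> (\<Sum>v\<in>V. u v *\<^sub>R v) = 0"
    for V :: "'a set" and u
  define u where "u V = (SOME u. dep V u)" for V
  have u: "dep V (u V)" if "V \<in> \<V>" for V
    unfolding u_def
  proof (rule someI_ex[of "dep V"])
    show "\<exists>u. dep V u"
      using that affine_dependent_explicit_finite[of V] by (simp add: \<V>_def dep_def)
  qed
  define G where "G V = {v. (\<Sum>p\<in>V. u V p * (norm (shear v p))\<^sup>2) \<noteq> 0}" for V
  have "countable {V. finite V \<and> V \<subseteq> X}" using assms by (rule countable_Collect_finite_subset)
  then have "countable \<V>" by (rule countable_subset[rotated]) (auto simp: \<V>_def)
  have "open (G V)" for V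
  proof -
    have "G V = - {v. (\<Sum>p\<in>V. u V p * ((norm p)\<^sup>2 + (2 + v \<bullet> v) * (v \<bullet> p)\<^sup>2)) = 0}"
      by (auto simp: G_def norm_shear_squared)
    moreover have "closed {v. (\<Sum>p\<in>V. u V p * ((norm p)\<^sup>2 + (2 + v \<bullet> v) * (v \<bullet> p)\<^sup>2)) = 0}"
      by (intro closed_Collect_eq continuous_intros)
    ultimately show ?thesis by (simp add: closed_def)
  qed
  moreover have "closure (G V) = UNIV" if "V \<in> \<V>" for V
  proof -
    have "\<exists>w. (\<Sum>p\<in>V. u V p * (w \<bullet> p)\<^sup>2) \<noteq> 0"
      using that u[OF that] unfolding \<V>_def dep_def by (intro circuit_quadratic_nonzero) blast+
    then show ?thesis unfolding G_def using dense_shear_nonzero by blast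
  qed
  \<comment> \<open>Baire: for each circuit the good shears form an open dense set.\<close>
  ultimately have "UNIV \<subseteq> closure (\<Inter>(G ` \<V>))"
    using \<open>countable \<V>\<close> by (intro Baire) auto
  then have "\<Inter>(G ` \<V>) \<noteq> {}" by auto
  then obtain v where v: "\<And>V. V \<in> \<V> \<Longrightarrow> v \<in> G V" by blast
  have "in_general_position (shear v) X"
    unfolding in_general_position_def
  proof (intro allI impI notI)
    fix V assume V: "V \<subseteq> X" "finite V" "\<exists>c \<rho>. \<forall>x\<in>V. dist (shear v x) c = \<rho>" "affine_dependent V"
    obtain U where U: "U \<subseteq> V" "affine_dependent U" "\<forall>p\<in>U. \<not> affine_dependent (U - {p})"
      using minimal_affine_dependent_subset[OF V(2,4)] by (elim exE conjE)
    then have "U \<in> \<V>" using V(1) finite_subset[OF U(1) V(2)] by (auto simp: \<V>_def)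
    obtain c \<rho> where c: "\<forall>x\<in>V. dist (shear v x) c = \<rho>" using V(3) by (elim exE)
    have "(\<Sum>p\<in>U. u U p * (norm (shear v p))\<^sup>2) = 0"
      by (rule cospherical_relation[OF linear_shear, where c=c and \<rho>=\<rho>]) (use c U u[OF \<open>U \<in> \<V>\<close>] in \<open>auto simp: dep_def\<close>)
    with v[OF \<open>U \<in> \<V>\<close>] show False by (simp add: G_def)
  qed
  then show ?thesis using that linear_shear inj_shear by blast
qed

section \<open>Empty spheres\<close>

text \<open>\<open>J c\<close> is the power of \<open>x\<close> with respect to the largest empty
  sphere about c. It is the maximum over p in \<open>X\<close> of the functions |x - c|^2 - |p -
  c|^2, which are affine in c with gradient 2 (p - x). At a minimum, 0 is a convex combination of
  the gradients that belong to the contact points, so \<open>x\<close> is in their convex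
  hull.\<close>

lemma empty_sphere_exists:
  fixes X :: "'a::euclidean_space set"
  assumes "closed X" and fin: "\<And>c R. finite (X \<inter> cball c R)"
    and cov: "\<And>x. \<exists>y\<in>X. dist x y \<le> r"
  shows "\<exists>c \<rho>. (\<forall>p\<in>X. \<rho> \<le> dist p c) \<and> x \<in> convex hull {p\<in>X. dist p c = \<rho>}"
proof -
  have ne: "X \<noteq> {}" using cov by auto
  define J where "J c = (dist x c)\<^sup>2 - (infdist c X)\<^sup>2" for c
  have r: "infdist c X \<le> r" for c
  proof -
    obtain y where "y \<in> X" "dist c y \<le> r" using cov by blast
    then show ?thesis using infdist_le order_trans by blast
  qed
  then have "r \<ge> 0" using infdist_nonneg order_trans by blast
  have "continuous_on (cball x r) J"
    unfolding J_def by (intro continuous_intros)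
  then obtain c where c: "c \<in> cball x r" "\<And>y. y \<in> cball x r \<Longrightarrow> J c \<le> J y"
    using continuous_attains_inf[of "cball x r" J] \<open>r \<ge> 0\<close> by auto
  \<comment> \<open>Outside the ball, dist x y exceeds r and hence the distance of y from
    \<open>X\<close>, so \<open>J y\<close> is nonnegative, while \<open>J x\<close> is at most
    0.\<close>
  have min: "J c \<le> J y" for y
  proof (cases "y \<in> cball x r")
    case False
    have "J c \<le> J x" using c(2)[of x] \<open>r \<ge> 0\<close> by simp
    also have "\<dots> \<le> 0" by (simp add: J_def)
    also have "\<dots> \<le> J y"
      unfolding J_def using False r[of y] infdist_nonneg[of y X]
      by (simp add: power_mono)
    finally show ?thesis .
  qed (use c in auto)
  define \<rho> where "\<rho> = infdist c X"
  define V where "V = {p\<in>X. dist p c = \<rho>}"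
  have le: "\<rho> \<le> dist p c" if "p \<in> X" for p
    using infdist_le[OF that, of c] by (simp add: \<rho>_def dist_commute)
  have "finite V" by (rule finite_subset[OF _ fin[of c \<rho>]]) (auto simp: V_def dist_commute)
  have "x \<in> convex hull V"
  proof (rule ccontr)
    assume "x \<notin> convex hull V"
    moreover have "closed (convex hull V)"
      using \<open>finite V\<close> by (intro compact_imp_closed finite_imp_compact_convex_hull)
    ultimately obtain a b where ab: "a \<bullet> x < b" "\<And>p. p \<in> convex hull V \<Longrightarrow> b < a \<bullet> p"
      using separating_hyperplane_closed_point[of "convex hull V" x] by auto
    \<comment> \<open>By finiteness there is a gap above the contact distance. After a move of the
      centre by less than \<gamma>/2 the nearest points are still contact points.\<close>
    have "\<exists>\<gamma>>0. \<forall>p\<in>X. dist p c < \<rho> + \<gamma> \<longrightarrow> p \<in> V"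
    proof -
      define F where "F = X \<inter> cball c (\<rho> + 1) - V"
      have "finite F" using fin by (simp add: F_def)
      define \<gamma> where "\<gamma> = Min (insert 1 ((\<lambda>p. dist p c - \<rho>) ` F))"
      have "\<gamma> > 0" unfolding \<gamma>_def using \<open>finite F\<close> le
        by (subst Min_gr_iff) (auto simp: F_def V_def less_le)
      moreover have "p \<in> V" if "p \<in> X" "dist p c < \<rho> + \<gamma>" for p
      proof (rule ccontr)
        assume "p \<notin> V"
        have "\<gamma> \<le> 1" unfolding \<gamma>_def using \<open>finite F\<close> by simp
        then have "p \<in> F" using that \<open>p \<notin> V\<close> by (auto simp: F_def dist_commute)
        then have "\<gamma> \<le> dist p c - \<rho>" unfolding \<gamma>_def using \<open>finite F\<close> by simp
        then show False using that by simp
      qed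
      ultimately show ?thesis by blast
    qed
    then obtain \<gamma> where \<gamma>: "\<gamma> > 0" "\<And>p. p \<in> X \<Longrightarrow> dist p c < \<rho> + \<gamma> \<Longrightarrow> p \<in> V" by blast
    \<comment> \<open>A step shorter than \<gamma>/2; the summand 1 avoids a division by
      zero.\<close>
    define s where "s = \<gamma> / (2 * (norm a + 1))"
    have na: "norm a + 1 > 0" by (simp add: add_nonneg_pos)
    have s: "s > 0" using \<gamma> na by (simp add: s_def)
    have "s * norm a < s * (norm a + 1)" using s by simp
    also have "\<dots> = \<gamma> / 2" using na by (simp add: s_def field_simps)
    finally have sa: "2 * (s * norm a) < \<gamma>" by simp
    \<comment> \<open>The centre moves against the normal \<open>a\<close> that separates
      \<open>x\<close> from the contact points. This changes \<open>J\<close> by 2 s (a . x - a . p)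
      for a contact point p, which is negative.\<close>
    define c' where "c' = c - s *\<^sub>R a"
    have dc: "dist c c' = s * norm a" using s by (simp add: c'_def dist_norm)
    obtain p where p: "p \<in> X" "infdist c' X = dist c' p"
      using infdist_attains_inf[OF assms(1) ne] by blast
    have "infdist c' X \<le> \<rho> + s * norm a"
      using infdist_triangle[of c' X c] dc by (simp add: \<rho>_def dist_commute)
    then have "dist p c < \<rho> + \<gamma>"
      using p(2) dc sa dist_triangle[of p c c'] by (simp add: dist_commute)
    then have pV: "p \<in> V" using \<gamma>(2) p(1) by blast
    then have "b < a \<bullet> p" by (intro ab(2) hull_inc)
    have "J c' = (norm (x - c'))\<^sup>2 - (norm (p - c'))\<^sup>2"
      by (simp add: J_def p(2) dist_norm norm_minus_commute)
    also have "\<dots> = (norm (x - c))\<^sup>2 - (norm (p - c))\<^sup>2 + 2 * s * (a \<bullet> x - a \<bullet> p)"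
      unfolding power2_norm_eq_inner c'_def by (simp add: inner_diff inner_add inner_commute algebra_simps)
    also have "(norm (x - c))\<^sup>2 - (norm (p - c))\<^sup>2 = J c"
      using pV by (simp add: J_def V_def \<rho>_def dist_norm)
    finally have "J c' < J c" using s \<open>b < a \<bullet> p\<close> ab(1) by (simp add: mult_pos_neg)
    with min[of c'] show False by simp
  qed
  then show ?thesis using le unfolding V_def by blast
qed

section \<open>Delaunay cells\<close>

text \<open>Cells are given by their vertex sets. Only complete contact sets with exactly d + 1
  points count, so a sphere with more contacts yields no cell, and it takes general position to make
  the cells cover the space.\<close>

definition delaunay :: "('a::euclidean_space \<Rightarrow> 'a) \<Rightarrow> 'a set \<Rightarrow> 'a set set" where
  "delaunay g X = {V. card V = DIM('a) + 1 \<and>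
     (\<exists>c \<rho>. V = {x\<in>X. dist (g x) c = \<rho>} \<and> (\<forall>x\<in>X. \<rho> \<le> dist (g x) c))}"

lemma linear_dist_bounds:
  fixes g :: "'a::euclidean_space \<Rightarrow> 'a"
  assumes "linear g" "inj g"
  obtains m M where "m > 0" "M > 0" "\<And>x y. m * dist x y \<le> dist (g x) (g y)"
    "\<And>x y. dist (g x) (g y) \<le> M * dist x y"
proof -
  obtain m where "m > 0" "\<And>x. m * norm x \<le> norm (g x)" using linear_inj_bounded_below_pos[OF assms] by metis
  moreover obtain M where "M > 0" "\<And>x. norm (g x) \<le> M * norm x" using linear_bounded_pos[OF assms(1)] by metis
  ultimately show ?thesis using that[of m M] by (simp add: dist_norm linear_diff[OF assms(1), symmetric])
qed

lemma dist_le_if_mem_convex_hull: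
  fixes g :: "'a::euclidean_space \<Rightarrow> 'a"
  assumes "linear g" "\<And>v. v \<in> V \<Longrightarrow> dist (g v) c \<le> \<rho>" "x \<in> convex hull V"
  shows "dist (g x) c \<le> \<rho>"
proof -
  have "g x \<in> convex hull (g ` V)"
    using assms(3) by (simp add: convex_hull_linear_image[OF assms(1), symmetric])
  moreover have "convex hull (g ` V) \<subseteq> cball c \<rho>"
    using assms(2) by (intro hull_minimal convex_cball) (auto simp: dist_commute)
  ultimately show ?thesis by (auto simp: dist_commute)
qed

lemma linear_empty_sphere_exists:
  fixes g :: "'a::euclidean_space \<Rightarrow> 'a"
  assumes g: "linear g" "inj g" and X: "delone X"
  shows "\<exists>c \<rho>. (\<forall>p\<in>X. \<rho> \<le> dist (g p) c) \<and> x \<in> convex hull {p\<in>X. dist (g p) c = \<rho>}"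
proof -
  obtain m M where mM: "m > 0" "M > 0" "\<And>x y. m * dist x y \<le> dist (g x) (g y)"
    "\<And>x y. dist (g x) (g y) \<le> M * dist x y" using linear_dist_bounds[OF g] by metis
  obtain r where r: "r > 0" "\<And>x. \<exists>y\<in>X. dist x y \<le> r" using X by (rule delone_covering) blast
  have surj: "surj g" using linear_inj_imp_surj[OF g] .
  have cl: "closed (g ` X)" using closed_injective_linear_image[OF delone_closed[OF X] g] .
  have fin: "finite (g ` X \<inter> cball c R)" for c R
  proof -
    obtain c0 where c0: "c = g c0" using surj by (metis surjD)
    have "g ` X \<inter> cball c R \<subseteq> g ` (X \<inter> cball c0 (R/m))"
    proof
      fix y assume "y \<in> g ` X \<inter> cball c R"
      then obtain x where x: "x \<in> X" "y = g x" "dist (g c0) (g x) \<le> R" using c0 by auto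
      have "m * dist c0 x \<le> R" using mM(3)[of c0 x] x(3) by linarith
      then have "dist c0 x \<le> R/m" using mM(1) by (simp add: field_simps)
      with x show "y \<in> g ` (X \<inter> cball c0 (R/m))" by auto
    qed
    then show ?thesis using finite_subset delone_finite_cball[OF X] by blast
  qed
  have cov: "\<exists>y\<in>g ` X. dist z y \<le> M * r" for z
  proof -
    obtain z0 where z0: "z = g z0" using surj by (metis surjD)
    obtain y where y: "y \<in> X" "dist z0 y \<le> r" using r(2) by blast
    have "dist (g z0) (g y) \<le> M * dist z0 y" by (rule mM)
    also have "\<dots> \<le> M * r" using y(2) mM(2) by simp
    finally show ?thesis using y(1) z0 by auto
  qed
  obtain c \<rho> where c: "\<forall>p\<in>g ` X. \<rho> \<le> dist p c"
      "g x \<in> convex hull {p\<in>g ` X. dist p c = \<rho>}"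
    using empty_sphere_exists[OF cl fin cov, of "g x"] by (elim exE conjE)
  have "{p\<in>g ` X. dist p c = \<rho>} = g ` {p\<in>X. dist (g p) c = \<rho>}" by auto
  with c(2) have "g x \<in> g ` (convex hull {p\<in>X. dist (g p) c = \<rho>})"
    by (simp add: convex_hull_linear_image[OF g(1)])
  then have "x \<in> convex hull {p\<in>X. dist (g p) c = \<rho>}" using inj_image_mem_iff[OF g(2)] by blast
  then show ?thesis using c(1) by blast
qed

lemma empty_sphere_radius:
  fixes g :: "'a::euclidean_space \<Rightarrow> 'a"
  assumes "linear g" "inj g" and M: "\<And>x y. dist (g x) (g y) \<le> M * dist x y" "M > 0"
    and r: "\<And>x. \<exists>y\<in>X. dist x y \<le> r" and e: "\<And>x. x \<in> X \<Longrightarrow> \<rho> \<le> dist (g x) c"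
  shows "\<rho> \<le> M * r"
proof -
  obtain c0 where c0: "c = g c0"
    using linear_inj_imp_surj[OF assms(1,2)] by (metis surjD)
  obtain y where y: "y \<in> X" "dist c0 y \<le> r" using r by blast
  have "\<rho> \<le> dist (g y) (g c0)" using e[OF y(1)] c0 by simp
  also have "\<dots> \<le> M * dist c0 y" using M(1)[of y c0] by (simp add: dist_commute)
  also have "\<dots> \<le> M * r" using y(2) M(2) by simp
  finally show ?thesis .
qed

lemma affine_sum:
  fixes g :: "'a::euclidean_space \<Rightarrow> 'a"
  assumes "linear g" "finite V" "sum \<mu> V = 1"
  shows "(\<Sum>p\<in>V. \<mu> p * (g p \<bullet> u + k)) = g (\<Sum>p\<in>V. \<mu> p *\<^sub>R p) \<bullet> u + k"
proof -
  have "(\<Sum>p\<in>V. \<mu> p * (g p \<bullet> u + k)) = (\<Sum>p\<in>V. (\<mu> p *\<^sub>R g p) \<bullet> u) + sum \<mu> V * k"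
    by (simp add: algebra_simps sum.distrib sum_distrib_left)
  also have "(\<Sum>p\<in>V. (\<mu> p *\<^sub>R g p) \<bullet> u) = g (\<Sum>p\<in>V. \<mu> p *\<^sub>R p) \<bullet> u"
    using assms(1) by (simp add: inner_sum_left linear_sum linear_cmul)
  finally show ?thesis using assms(3) by simp
qed

text \<open>The difference of the powers of a point with respect to the two spheres is an affine function.\<close>

lemma empty_spheres_face_to_face:
  fixes g :: "'a::euclidean_space \<Rightarrow> 'a"
  assumes g: "linear g"
    and V: "V = {x\<in>X. dist (g x) c = \<rho>}" "finite V" "\<And>x. x \<in> X \<Longrightarrow> \<rho> \<le> dist (g x) c"
    and W: "W = {x\<in>X. dist (g x) d = \<sigma>}" "finite W" "\<And>x. x \<in> X \<Longrightarrow> \<sigma> \<le> dist (g x) d"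
  shows "convex hull V \<inter> convex hull W = convex hull (V \<inter> W)"
proof
  show "convex hull (V \<inter> W) \<subseteq> convex hull V \<inter> convex hull W" by (simp add: hull_mono)
  show "convex hull V \<inter> convex hull W \<subseteq> convex hull (V \<inter> W)"
  proof
    fix x assume x: "x \<in> convex hull V \<inter> convex hull W"
    obtain \<mu> where \<mu>: "\<forall>p\<in>V. 0 \<le> \<mu> p" "sum \<mu> V = 1" "(\<Sum>p\<in>V. \<mu> p *\<^sub>R p) = x"
      using x V(2) by (auto simp: convex_hull_finite)
    obtain \<nu> where \<nu>: "\<forall>p\<in>W. 0 \<le> \<nu> p" "sum \<nu> W = 1" "(\<Sum>p\<in>W. \<nu> p *\<^sub>R p) = x"
      using x W(2) by (auto simp: convex_hull_finite)
    have "W \<noteq> {}" "V \<noteq> {}" using \<mu>(2) \<nu>(2) by auto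
    then have pos: "\<sigma> \<ge> 0" "\<rho> \<ge> 0" unfolding V(1) W(1) by auto
    define a where "a y = (dist (g y) c)\<^sup>2 - \<rho>\<^sup>2 - ((dist (g y) d)\<^sup>2 - \<sigma>\<^sup>2)" for y
    define u where "u = 2 *\<^sub>R (d - c)"
    define k where "k = c \<bullet> c - d \<bullet> d - \<rho>\<^sup>2 + \<sigma>\<^sup>2"
    have a: "a y = g y \<bullet> u + k" for y
      unfolding a_def dist_norm power2_norm_eq_inner u_def k_def
      by (simp add: inner_diff inner_commute algebra_simps)
    \<comment> \<open>\<open>V\<close> lies on the first sphere and not inside the second, so the
      affine function is nonpositive on \<open>V\<close>, and by symmetry nonnegative on
      \<open>W\<close>. At \<open>x\<close>, a point of both hulls, it vanishes, so the weights of
      \<open>x\<close> are concentrated on its zeros in \<open>V\<close>, and these lie in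
      \<open>W\<close>.\<close>
    have aV: "a p \<le> 0" "a p = 0 \<Longrightarrow> p \<in> W" if "p \<in> V" for p
    proof -
      have "\<sigma>\<^sup>2 \<le> (dist (g p) d)\<^sup>2" using that V(1) W(3) pos by (auto intro: power_mono)
      then show "a p \<le> 0" using that V(1) by (auto simp: a_def)
      assume "a p = 0"
      then have "(dist (g p) d)\<^sup>2 = \<sigma>\<^sup>2" using that V(1) by (auto simp: a_def)
      then have "dist (g p) d = \<sigma>" using pos by (simp add: power2_eq_iff_nonneg)
      then show "p \<in> W" using that V(1) W(1) by auto
    qed
    have aW: "a p \<ge> 0" if "p \<in> W" for p
    proof -
      have "\<rho>\<^sup>2 \<le> (dist (g p) c)\<^sup>2" using that W(1) V(3) pos by (auto intro: power_mono)
      then show ?thesis using that W(1) by (auto simp: a_def)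
    qed
    have 1: "(\<Sum>p\<in>V. \<mu> p * a p) = a x" unfolding a using affine_sum[OF g V(2) \<mu>(2)] \<mu>(3) by simp
    have 2: "(\<Sum>p\<in>W. \<nu> p * a p) = a x" unfolding a using affine_sum[OF g W(2) \<nu>(2)] \<nu>(3) by simp
    have "a x \<ge> 0" unfolding 2[symmetric] using \<nu>(1) aW by (intro sum_nonneg) simp
    then have "(\<Sum>p\<in>V. - (\<mu> p * a p)) \<le> 0" using 1 by (simp add: sum_negf)
    moreover have nn: "0 \<le> - (\<mu> p * a p)" if "p \<in> V" for p
      using \<mu>(1) aV(1)[OF that] that by (simp add: mult_nonneg_nonpos)
    ultimately have z: "(\<Sum>p\<in>V. - (\<mu> p * a p)) = 0" by (meson antisym sum_nonneg)
    have zero: "\<mu> p = 0" if "p \<in> V" "p \<notin> W" for p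
    proof -
      have "- (\<mu> p * a p) = 0" using z nn sum_nonneg_eq_0_iff[OF V(2), of "\<lambda>p. - (\<mu> p * a p)"] that(1) by blast
      moreover have "a p \<noteq> 0" using aV(2) that by blast
      ultimately show ?thesis by simp
    qed
    have "sum \<mu> (V \<inter> W) = 1"
      using \<mu>(2) by (subst sum.mono_neutral_left[OF V(2)]) (use zero in auto)
    moreover have "(\<Sum>p\<in>V \<inter> W. \<mu> p *\<^sub>R p) = x"
      using \<mu>(3) by (subst sum.mono_neutral_left[OF V(2)]) (use zero in auto)
    ultimately show "x \<in> convex hull (V \<inter> W)"
      using \<mu>(1) V(2) by (auto simp: convex_hull_finite)
  qed
qed

section \<open>Limits of empty spheres under perturbation\<close>

text \<open>Otherwise there are perturbations of size 1/(n+1) with empty spheres through the images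
  of \<open>W\<close>. Their centres and radii stay in a compact set, and a limit sphere is empty
  for \<open>F\<close> and contains \<open>W\<close>.\<close>

lemma sphere_limit_finite:
  fixes g :: "'a::euclidean_space \<Rightarrow> 'a"
  assumes g: "linear g" and W: "W \<subseteq> F"
  shows "\<exists>\<delta>>0. \<forall>h c \<rho>. (\<forall>x\<in>F. dist (h x) x \<le> \<delta>) \<longrightarrow> c \<in> cball 0 K \<longrightarrow> \<rho> \<in> {0..K} \<longrightarrow>
      (\<forall>x\<in>F. \<rho> \<le> dist (g (h x)) c) \<longrightarrow> (\<forall>x\<in>W. dist (g (h x)) c = \<rho>) \<longrightarrow>
      (\<exists>c'\<in>cball 0 K. \<exists>\<rho>'\<in>{0..K}. (\<forall>x\<in>F. \<rho>' \<le> dist (g x) c') \<and> (\<forall>x\<in>W. dist (g x) c' = \<rho>'))"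
    (is "\<exists>\<delta>>0. \<forall>h c \<rho>. ?A \<delta> h \<longrightarrow> c \<in> ?C \<longrightarrow> \<rho> \<in> ?I \<longrightarrow> ?B h c \<rho> \<longrightarrow> ?E h c \<rho> \<longrightarrow> ?concl")
proof (rule ccontr)
  assume neg: "\<not> ?thesis"
  define bad where "bad \<delta> p \<longleftrightarrow> (case p of (h, c, \<rho>) \<Rightarrow>
     ?A \<delta> h \<and> c \<in> ?C \<and> \<rho> \<in> ?I \<and> ?B h c \<rho> \<and> ?E h c \<rho>)" for \<delta> p
  \<comment> \<open>The conclusion does not mention \<open>h\<close>, \<open>c\<close> or
    \<open>\<rho>\<close>; if it held, any bound, such as 1, would do.\<close>
  have nc: "\<not> ?concl"
  proof
    assume c: ?concl
    have "\<exists>\<delta>>0. \<forall>h c \<rho>. ?A \<delta> h \<longrightarrow> c \<in> ?C \<longrightarrow> \<rho> \<in> ?I \<longrightarrow> ?B h c \<rho> \<longrightarrow> ?E h c \<rho> \<longrightarrow> ?concl"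
      by (intro exI[of _ "1::real"] conjI allI impI c) simp
    with neg show False by contradiction
  qed
  have "\<exists>p. bad (1 / real (Suc n)) p" for n
  proof (rule ccontr)
    assume nb: "\<not> ?thesis"
    have "1 / real (Suc n) > 0" by simp
    moreover have "\<forall>h c \<rho>. ?A (1 / real (Suc n)) h \<longrightarrow> c \<in> ?C \<longrightarrow> \<rho> \<in> ?I \<longrightarrow> ?B h c \<rho> \<longrightarrow> ?E h c \<rho> \<longrightarrow> ?concl"
    proof (intro allI impI)
      fix h c \<rho>
      assume "?A (1 / real (Suc n)) h" "c \<in> ?C" "\<rho> \<in> ?I" "?B h c \<rho>" "?E h c \<rho>"
      then have "bad (1 / real (Suc n)) (h, c, \<rho>)" unfolding bad_def by simp
      then have "\<exists>p. bad (1 / real (Suc n)) p" by (rule exI)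
      with nb show ?concl by contradiction
    qed
    ultimately have "\<exists>\<delta>>0. \<forall>h c \<rho>. ?A \<delta> h \<longrightarrow> c \<in> ?C \<longrightarrow> \<rho> \<in> ?I \<longrightarrow> ?B h c \<rho> \<longrightarrow> ?E h c \<rho> \<longrightarrow> ?concl"
      by (intro exI[of _ "1 / real (Suc n)"] conjI)
    with neg show False by contradiction
  qed
  then have "\<forall>n. \<exists>p. bad (1 / real (Suc n)) p" by (rule allI)
  from choice[OF this] obtain p where "\<forall>n. bad (1 / real (Suc n)) (p n)" ..
  note p = spec[OF this]
  define h where "h n = fst (p n)" for n
  define c where "c n = fst (snd (p n))" for n
  define \<rho> where "\<rho> n = snd (snd (p n))" for n
  have hh: "dist (h n x) x \<le> 1 / real (Suc n)" if "x \<in> F" for n x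
    using p[of n] that by (auto simp: bad_def h_def split_beta)
  have hB: "\<rho> n \<le> dist (g (h n x)) (c n)" if "x \<in> F" for n x
    using p[of n] that by (auto simp: bad_def h_def c_def \<rho>_def split_beta)
  have hE: "dist (g (h n x)) (c n) = \<rho> n" if "x \<in> W" for n x
    using p[of n] that by (auto simp: bad_def h_def c_def \<rho>_def split_beta)
  have mem: "(c n, \<rho> n) \<in> ?C \<times> ?I" for n
    using p[of n] by (auto simp: bad_def c_def \<rho>_def split_beta mem_Times_iff)
  have "seq_compact (?C \<times> ?I)" by (intro compact_imp_seq_compact compact_Times) auto
  then obtain l s where l: "l \<in> ?C \<times> ?I" "strict_mono s" "((\<lambda>n. (c n, \<rho> n)) \<circ> s) \<longlonglongrightarrow> l"
    by (rule seq_compactE) (use mem in auto)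
  obtain c' \<rho>' where l': "l = (c', \<rho>')" by (cases l)
  have cl: "(\<lambda>n. c (s n)) \<longlonglongrightarrow> c'" using tendsto_fst[OF l(3)] l' by (simp add: o_def)
  have rl: "(\<lambda>n. \<rho> (s n)) \<longlonglongrightarrow> \<rho>'" using tendsto_snd[OF l(3)] l' by (simp add: o_def)
  have hl: "(\<lambda>n. h (s n) x) \<longlonglongrightarrow> x" if "x \<in> F" for x
  proof -
    have "(\<lambda>n. h n x) \<longlonglongrightarrow> x"
    proof (rule Lim_null_comparison[THEN LIM_zero_cancel])
      show "\<forall>\<^sub>F n in sequentially. norm (h n x - x) \<le> 1 / real (Suc n)"
        using hh[OF that] by (simp add: dist_norm)
      show "(\<lambda>n. 1 / real (Suc n)) \<longlonglongrightarrow> 0" by (rule LIMSEQ_Suc[OF lim_1_over_n])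
    qed
    then show ?thesis using LIMSEQ_subseq_LIMSEQ[OF _ l(2)] by (auto simp: o_def)
  qed
  have dl: "(\<lambda>n. dist (g (h (s n) x)) (c (s n))) \<longlonglongrightarrow> dist (g x) c'" if "x \<in> F" for x
    using bounded_linear.tendsto[OF linear_conv_bounded_linear[THEN iffD1, OF g] hl[OF that]] cl
    by (intro tendsto_dist)
  have "\<rho>' \<le> dist (g x) c'" if "x \<in> F" for x
    using LIMSEQ_le[OF rl dl[OF that]] hB[OF that] by blast
  moreover have "dist (g x) c' = \<rho>'" if "x \<in> W" for x
  proof -
    have "x \<in> F" using that W by blast
    from dl[OF this] have "(\<lambda>n. \<rho> (s n)) \<longlonglongrightarrow> dist (g x) c'" using hE[OF that] by simp
    then show ?thesis using LIMSEQ_unique rl by blast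
  qed
  ultimately have ?concl using l(1) l' by (intro bexI[of _ c'] bexI[of _ \<rho>']) auto
  with nc show False by contradiction
qed

definition sphere_stable ::
  "('a::euclidean_space \<Rightarrow> 'a) \<Rightarrow> real \<Rightarrow> 'a set \<Rightarrow> 'a set \<Rightarrow> real \<Rightarrow> bool" where
  "sphere_stable g K F W \<delta> \<longleftrightarrow> (\<forall>h c \<rho>. (\<forall>x\<in>F. dist (h x) x \<le> \<delta>) \<longrightarrow> c \<in> cball 0 K \<longrightarrow> \<rho> \<in> {0..K} \<longrightarrow>
      (\<forall>x\<in>F. \<rho> \<le> dist (g (h x)) c) \<longrightarrow> (\<forall>x\<in>W. dist (g (h x)) c = \<rho>) \<longrightarrow>
      (\<exists>c'\<in>cball 0 K. \<exists>\<rho>'\<in>{0..K}. (\<forall>x\<in>F. \<rho>' \<le> dist (g x) c') \<and> (\<forall>x\<in>W. dist (g x) c' = \<rho>')))"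

lemma sphere_limit:
  fixes g :: "'a::euclidean_space \<Rightarrow> 'a"
  assumes g: "linear g" and F: "finite F"
  shows "\<exists>\<delta>>0. \<forall>W\<in>Pow F. sphere_stable g K F W \<delta>"
proof -
  have "\<exists>\<delta>>0. sphere_stable g K F W \<delta>" if "W \<in> Pow F" for W
    using sphere_limit_finite[OF g, of W F K] that unfolding sphere_stable_def by simp
  then obtain D where D: "\<And>W. W \<in> Pow F \<Longrightarrow> D W > 0 \<and> sphere_stable g K F W (D W)" by metis
  define \<delta> where "\<delta> = Min (D ` Pow F)"
  have "\<delta> > 0" unfolding \<delta>_def using D F by (subst Min_gr_iff) auto
  moreover have "sphere_stable g K F W \<delta>" if W: "W \<in> Pow F" for W
  proof -
    have le: "\<delta> \<le> D W" unfolding \<delta>_def using W F by simp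
    show ?thesis
      unfolding sphere_stable_def
    proof (intro allI impI)
      fix h c \<rho>
      assume h: "\<forall>x\<in>F. dist (h x) x \<le> \<delta>" and rest: "c \<in> cball 0 K" "\<rho> \<in> {0..K}"
        "\<forall>x\<in>F. \<rho> \<le> dist (g (h x)) c" "\<forall>x\<in>W. dist (g (h x)) c = \<rho>"
      have "\<forall>x\<in>F. dist (h x) x \<le> D W" using h le by force
      with rest show "\<exists>c'\<in>cball 0 K. \<exists>\<rho>'\<in>{0..K}. (\<forall>x\<in>F. \<rho>' \<le> dist (g x) c') \<and> (\<forall>x\<in>W. dist (g x) c' = \<rho>')"
        using D[OF W] unfolding sphere_stable_def by simp
    qed
  qed
  ultimately show ?thesis by blast
qed

section \<open>Stability of the Delaunay triangulation\<close>

lemma convex_hull_image_near: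
  fixes h :: "'a::euclidean_space \<Rightarrow> 'a"
  assumes "finite W" "\<And>x. x \<in> W \<Longrightarrow> dist (h x) x \<le> \<delta>" "inj_on h W" "x \<in> convex hull (h ` W)"
  shows "\<exists>y\<in>convex hull W. dist x y \<le> \<delta>"
proof -
  have fin: "finite (h ` W)" using assms(1) by simp
  obtain \<mu> where \<mu>: "\<forall>p\<in>h ` W. 0 \<le> \<mu> p" "sum \<mu> (h ` W) = 1" "(\<Sum>p\<in>h ` W. \<mu> p *\<^sub>R p) = x"
    using assms(4) by (auto simp: convex_hull_finite[OF fin])
  define \<nu> where "\<nu> = \<mu> \<circ> h"
  have \<nu>: "\<forall>p\<in>W. 0 \<le> \<nu> p" "sum \<nu> W = 1" "(\<Sum>p\<in>W. \<nu> p *\<^sub>R h p) = x"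
    using \<mu> assms(3) by (auto simp: \<nu>_def sum.reindex)
  define y where "y = (\<Sum>p\<in>W. \<nu> p *\<^sub>R p)"
  have "y \<in> convex hull W" using \<nu> assms(1) by (auto simp: convex_hull_finite y_def)
  moreover have "dist x y \<le> \<delta>"
  proof -
    have "dist x y = norm (\<Sum>p\<in>W. \<nu> p *\<^sub>R (h p - p))"
      unfolding dist_norm y_def \<nu>(3)[symmetric] by (simp add: sum_subtractf scaleR_diff_right)
    also have "\<dots> \<le> (\<Sum>p\<in>W. \<nu> p * \<delta>)"
      using \<nu>(1) assms(2) by (intro sum_norm_le) (auto simp: dist_norm intro: mult_left_mono)
    also have "\<dots> = \<delta>" using \<nu>(2) by (simp add: sum_distrib_right[symmetric])
    finally show ?thesis .
  qed
  ultimately show ?thesis by blast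
qed

lemma affine_independent_if_interior:
  fixes V :: "'a::euclidean_space set"
  assumes "finite V" "card V = DIM('a) + 1" "interior (convex hull V) \<noteq> {}"
  shows "\<not> affine_dependent V"
  using assms aff_dim_nonempty_interior[OF assms(3)]
  by (simp add: affine_independent_iff_card aff_dim_convex_hull)

lemma interior_convex_hull_independent:
  fixes V :: "'a::euclidean_space set"
  assumes "\<not> affine_dependent V" "card V = DIM('a) + 1"
  shows "interior (convex hull V) \<noteq> {}"
proof -
  have "aff_dim V = DIM('a)" using assms by (simp add: affine_independent_iff_card)
  then have "affine hull (convex hull V) = UNIV"
    using aff_dim_lt_full[of V] by (simp add: affine_hull_convex_hull)
  then have "interior (convex hull V) = rel_interior (convex hull V)"
    by (rule rel_interior_interior[symmetric])
  moreover have "V \<noteq> {}" using assms(2) by auto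
  ultimately show ?thesis by (simp add: rel_interior_eq_empty)
qed

text \<open>A proper subset of the vertices of a simplex spans a proper face, which misses the
  interior. Thus one interior point identifies the complete vertex set.\<close>

lemma interior_convex_hull_proper_subset:
  fixes V :: "'a::euclidean_space set"
  assumes "\<not> affine_dependent V" "U \<subseteq> V" "x \<in> convex hull U" "x \<in> interior (convex hull V)"
  shows "U = V"
proof (rule ccontr)
  assume "U \<noteq> V"
  have ind: "\<not> affine_dependent U" using affine_independent_subset assms(1,2) by blast
  have "convex hull U face_of convex hull V"
    using face_of_convex_hull_affine_independent[OF assms(1)] assms(2) by blast
  moreover have "convex hull U \<noteq> convex hull V"
  proof
    assume eq: "convex hull U = convex hull V"
    have "p \<in> U \<longleftrightarrow> p \<in> V" for p
      using extreme_point_of_convex_hull_affine_independent[OF ind, of p]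
        extreme_point_of_convex_hull_affine_independent[OF assms(1), of p] eq by simp
    with \<open>U \<noteq> V\<close> show False by blast
  qed
  ultimately have "convex hull U \<inter> interior (convex hull V) = {}" by (rule face_of_disjoint_interior)
  with assms show False by blast
qed

lemma delone_image_near:
  fixes h :: "'a::euclidean_space \<Rightarrow> 'a"
  assumes Q: "delone Q" and e: "\<And>x y. x \<in> Q \<Longrightarrow> y \<in> Q \<Longrightarrow> dist x y < e \<Longrightarrow> x = y" "e > 0"
    and h: "\<And>x. x \<in> Q \<Longrightarrow> dist (h x) x \<le> \<delta>" and \<delta>: "4 * \<delta> \<le> e"
  shows "delone (h ` Q)" "inj_on h Q"
proof -
  \<comment> \<open>Each of the two points moves by at most \<delta>; as 4\<delta> is at most
    \<open>e\<close>, moved points remain e/2 apart.\<close>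
  have tri: "dist x y \<le> dist (h x) (h y) + 2 * \<delta>" if "x \<in> Q" "y \<in> Q" for x y
    using h[OF that(1)] h[OF that(2)] dist_triangle[of x y "h x"] dist_triangle[of "h x" y "h y"]
    by (simp add: dist_commute)
  show "inj_on h Q"
  proof (rule inj_onI)
    fix x y assume xy: "x \<in> Q" "y \<in> Q" "h x = h y"
    have "dist x y < e" using tri[OF xy(1,2)] xy(3) \<delta> \<open>e > 0\<close> by simp
    then show "x = y" using e(1) xy by blast
  qed
  have "uniform_discrete (h ` Q)"
    unfolding uniform_discrete_def
  proof (intro exI[of _ "e/2"] conjI ballI impI)
    show "e/2 > 0" using \<open>e > 0\<close> by simp
    fix a b assume "a \<in> h ` Q" "b \<in> h ` Q" and d: "dist a b < e/2"
    then obtain x y where xy: "x \<in> Q" "y \<in> Q" "a = h x" "b = h y" by blast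
    have "dist x y < e" using tri[OF xy(1,2)] d \<delta> xy by simp
    then show "a = b" using e(1) xy by blast
  qed
  moreover obtain r where r: "r > 0" "\<And>x. \<exists>y\<in>Q. dist x y \<le> r" using Q by (rule delone_covering) blast
  have cov: "\<exists>y\<in>h ` Q. dist x y \<le> r + \<bar>\<delta>\<bar>" for x
  proof -
    obtain y where y: "y \<in> Q" "dist x y \<le> r" using r(2) by blast
    have "dist x (h y) \<le> r + \<bar>\<delta>\<bar>" using dist_triangle[of x "h y" y] h[OF y(1)] y(2) by (simp add: dist_commute)
    with y(1) show ?thesis by blast
  qed
  ultimately show "delone (h ` Q)"
    unfolding delone_def using cov r(1) by (intro conjI exI[of _ "r + \<bar>\<delta>\<bar>"]) auto
qed

section \<open>Stability of contact sets\<close>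

locale generic_delone =
  fixes g :: "'a::euclidean_space \<Rightarrow> 'a" and Q :: "'a set"
  assumes lin: "linear g" and inj: "inj g" and delone: "delone Q"
    and flc: "finite_local_complexity Q" and generic: "in_general_position g Q"
begin

lemma contact_set:
  assumes W: "W = {x\<in>Q. dist (g x) c = \<rho>}"
  shows "finite W" "\<not> affine_dependent W" "card W \<le> DIM('a) + 1"
proof -
  obtain m M where m: "m > 0" "\<And>x y. m * dist x y \<le> dist (g x) (g y)"
    using linear_dist_bounds[OF lin inj] by metis
  show fin: "finite W"
  proof (cases "W = {}")
    case False
    then obtain p where p: "p \<in> W" by blast
    have "W \<subseteq> Q \<inter> cball p (2 * \<rho> / m)"
    proof
      fix x assume x: "x \<in> W"
      have "m * dist p x \<le> dist (g p) c + dist (g x) c"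
        using m(2)[of p x] dist_triangle2[of "g p" "g x" c] by linarith
      also have "\<dots> = 2 * \<rho>" using x p W by simp
      finally have "dist p x \<le> 2 * \<rho> / m" using m(1) by (simp add: field_simps)
      then show "x \<in> Q \<inter> cball p (2 * \<rho> / m)" using x W by simp
    qed
    then show ?thesis using finite_subset delone_finite_cball[OF delone] by blast
  qed simp
  show ind: "\<not> affine_dependent W"
  proof -
    have "W \<subseteq> Q" "\<exists>c \<rho>. \<forall>x\<in>W. dist (g x) c = \<rho>" using W by auto
    then show ?thesis using generic fin unfolding in_general_position_def by simp
  qed
  show "card W \<le> DIM('a) + 1"
    using affine_dependent_biggerset[OF fin] ind by linarith
qed

text \<open>Contact sets cannot gain points when the perturbation is undone. Each sphere in question
  passes through a moved point \<open>h p\<close>, so only the patch of \<open>Q\<close> around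
  \<open>p\<close> matters. Compactness gives a bound for each patch, and FLC leaves finitely many
  patches.\<close>

lemma sphere_perturbation:
  "\<exists>\<delta>>0. \<forall>h c \<rho> W. (\<forall>x\<in>Q. dist (h x) x \<le> \<delta>) \<longrightarrow> W = {x\<in>Q. dist (g (h x)) c = \<rho>} \<longrightarrow>
     W \<noteq> {} \<longrightarrow> (\<forall>x\<in>Q. \<rho> \<le> dist (g (h x)) c) \<longrightarrow>
     (\<exists>c' \<rho>' W'. W' = {x\<in>Q. dist (g x) c' = \<rho>'} \<and> (\<forall>x\<in>Q. \<rho>' \<le> dist (g x) c') \<and> W \<subseteq> W')"
proof -
  obtain m M where mM: "m > 0" "M > 0" "\<And>x y. m * dist x y \<le> dist (g x) (g y)"
    "\<And>x y. dist (g x) (g y) \<le> M * dist x y" using linear_dist_bounds[OF lin inj] by metis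
  obtain r where r: "r > 0" "\<And>x. \<exists>y\<in>Q. dist x y \<le> r" using delone by (rule delone_covering) blast
  \<comment> \<open>The moved points cover the space with radius r + 1, so the sphere has radius at
    most M (r + 1), and its centre is at most M further away from \<open>g p\<close>;
    \<open>K\<close> bounds both. \<open>R\<close> is so large that contact points lie in the patch
    (each of two points moved by at most 1), and that a point of \<open>Q\<close> outside the patch
    lies outside every sphere with centre and radius bounded by \<open>K\<close>.\<close>
  define K where "K = M * (r + 2)"
  define R where "R = 2 * K / m + 2"
  have K: "K > 0" using mM r by (simp add: K_def)
  have R: "R > 0" using K mM by (simp add: R_def add_pos_pos)
  \<comment> \<open>The bound is attached to the patch and not to the point, so it takes finitely
    many values.\<close>
  define D where "D F = (SOME \<delta>. \<delta> > 0 \<and> (\<forall>W\<in>Pow F. sphere_stable g K F W \<delta>))" for F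
  have D: "D F > 0 \<and> (\<forall>W\<in>Pow F. sphere_stable g K F W (D F))" if "finite F" for F
    unfolding D_def by (rule someI_ex[OF sphere_limit[OF lin that]])
  have finp: "finite (patch R Q ` Q)" using flc R by (simp add: finite_local_complexity_def)
  have finF: "finite (patch R Q p)" for p by (rule delone_finite_patch[OF delone])
  define \<delta> where "\<delta> = Min (insert 1 (D ` patch R Q ` Q))"
  have fin: "finite (insert 1 (D ` patch R Q ` Q))" using finp by simp
  have "\<delta> > 0" unfolding \<delta>_def using fin D finF by (subst Min_gr_iff) auto
  have \<delta>1: "\<delta> \<le> 1" unfolding \<delta>_def using fin by simp
  have \<delta>D: "\<delta> \<le> D (patch R Q p)" if "p \<in> Q" for p unfolding \<delta>_def using fin that by simp
  show ?thesis
  proof (intro exI[of _ \<delta>] conjI allI impI)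
    fix h c \<rho> Z assume h: "\<forall>x\<in>Q. dist (h x) x \<le> \<delta>" and c: "\<forall>x\<in>Q. \<rho> \<le> dist (g (h x)) c"
      and Z: "Z = {x\<in>Q. dist (g (h x)) c = \<rho>}" and "Z \<noteq> {}"
    then obtain p where p: "p \<in> Q" "dist (g (h p)) c = \<rho>" by blast
    have h1: "dist (h x) x \<le> 1" if "x \<in> Q" for x using h that \<delta>1 by fastforce
    have cov: "\<exists>y\<in>h ` Q. dist x y \<le> r + 1" for x
    proof -
      obtain y where y: "y \<in> Q" "dist x y \<le> r" using r(2) by blast
      then have "dist x (h y) \<le> r + 1" using h1[OF y(1)] dist_triangle[of x "h y" y] by (simp add: dist_commute)
      with y(1) show ?thesis by blast
    qed
    have \<rho>: "\<rho> \<le> M * (r + 1)" "\<rho> \<ge> 0"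
      using empty_sphere_radius[OF lin inj mM(4) mM(2) cov, of \<rho> c] c p(2) by auto
    have near: "dist x p \<le> R" if "x \<in> Q" "dist (g (h x)) c = \<rho>" for x
    proof -
      have "m * dist (h x) (h p) \<le> 2 * \<rho>"
        using mM(3)[of "h x" "h p"] dist_triangle2[of "g (h x)" "g (h p)" c] that(2) p(2) by linarith
      also have "\<dots> \<le> 2 * K" using \<rho>(1) mM(2) by (simp add: K_def algebra_simps)
      finally have "dist (h x) (h p) \<le> 2 * K / m" using mM(1) by (simp add: field_simps)
      then show ?thesis
        using h1[OF that(1)] h1[OF p(1)] dist_triangle[of x p "h x"] dist_triangle[of "h x" p "h p"]
        by (simp add: R_def dist_commute)
    qed
    \<comment> \<open>Everything is translated by \<open>p\<close>, so that equal patches become one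
      and the same finite set.\<close>
    define F where "F = patch R Q p"
    define h' where "h' z = h (z + p) - p" for z
    define d where "d = c - g p"
    have FQ: "z + p \<in> Q" if "z \<in> F" for z using that by (simp add: F_def mem_patch_iff)
    have gh: "dist (g (h' z)) d = dist (g (h (z + p))) c" for z
      by (simp add: h'_def d_def dist_norm linear_diff[OF lin])
    have gz: "dist (g z) c' = dist (g (z + p)) (c' + g p)" for z c'
      by (simp add: dist_norm linear_add[OF lin])
    have "dist (h' z) z = dist (h (z + p)) (z + p)" for z
      by (simp add: h'_def dist_norm algebra_simps)
    then have a1: "\<forall>z\<in>F. dist (h' z) z \<le> D F" using h FQ \<delta>D[OF p(1)] F_def by fastforce
    have M1: "M * dist (h p) p \<le> M * 1" using h1[OF p(1)] mM(2) by (intro mult_left_mono) auto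
    have "norm d \<le> dist (g (h p)) c + dist (g (h p)) (g p)"
      using dist_triangle2[of c "g p" "g (h p)"] by (simp add: d_def dist_norm norm_minus_commute)
    also have "\<dots> \<le> M * (r + 1) + M * 1"
      using p(2) \<rho> mM(4)[of "h p" p] M1 by linarith
    also have "\<dots> = K" by (simp add: K_def algebra_simps)
    finally have a2: "d \<in> cball 0 K" by simp
    have a3: "\<rho> \<in> {0..K}" using \<rho> mM(2) by (simp add: K_def algebra_simps)
    have a4: "\<forall>z\<in>F. \<rho> \<le> dist (g (h' z)) d" using c FQ gh by simp
    define W where "W = {z\<in>F. dist (g (h' z)) d = \<rho>}"
    have a5: "\<forall>z\<in>W. dist (g (h' z)) d = \<rho>" by (simp add: W_def)
    have "sphere_stable g K F W (D F)" using D[OF finF, of p] by (simp add: F_def W_def)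
    from this[unfolded sphere_stable_def, THEN spec[of _ h'], THEN spec[of _ d], THEN spec[of _ \<rho>],
        THEN mp, OF a1, THEN mp, OF a2, THEN mp, OF a3, THEN mp, OF a4, THEN mp, OF a5]
    obtain c' \<rho>' where c': "c' \<in> cball 0 K" "\<rho>' \<in> {0..K}" "\<forall>x\<in>F. \<rho>' \<le> dist (g x) c'"
      "\<forall>x\<in>W. dist (g x) c' = \<rho>'" by (elim bexE conjE)
    have FI: "x - p \<in> F" if "x \<in> Q" "dist x p \<le> R" for x
      using that by (simp add: F_def mem_patch_iff dist_norm)
    show "\<exists>c' \<rho>' W'. W' = {x\<in>Q. dist (g x) c' = \<rho>'} \<and> (\<forall>x\<in>Q. \<rho>' \<le> dist (g x) c') \<and> Z \<subseteq> W'"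
    proof (intro exI conjI ballI subsetI)
      fix x assume x: "x \<in> Q"
      show "\<rho>' \<le> dist (g x) (c' + g p)"
      proof (cases "dist x p \<le> R")
        case True
        then show ?thesis using c'(3) FI[OF x] gz[of "x - p" c'] by force
      next
        case False
        then have "m * R \<le> m * dist x p" using mM(1) by simp
        also have "\<dots> \<le> dist (g x) (g p)" by (rule mM)
        also have "\<dots> \<le> dist (g x) (c' + g p) + dist (g p) (c' + g p)" by (rule dist_triangle2)
        also have "dist (g p) (c' + g p) \<le> K" using c'(1) by (simp add: dist_norm)
        finally have "m * R \<le> dist (g x) (c' + g p) + K" by simp
        moreover have "m * R \<ge> 2 * K" using mM(1) by (simp add: R_def algebra_simps)
        ultimately show ?thesis using c'(2) by simp
      qed
    next
      fix x assume "x \<in> Z"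
      then have x: "x \<in> Q" "dist (g (h x)) c = \<rho>" by (simp_all add: Z)
      have "x - p \<in> F" using FI near x by blast
      moreover have "dist (g (h' (x - p))) d = \<rho>" using x gh[of "x - p"] by simp
      ultimately have "dist (g (x - p)) c' = \<rho>'" using c'(4) by (simp add: W_def)
      then show "x \<in> {x\<in>Q. dist (g x) (c' + g p) = \<rho>'}" using gz[of "x - p" c'] x(1) by simp
    qed (rule refl)
  qed fact
qed

end

section \<open>Size and local finiteness of the cells\<close>

lemma delaunay_cell:
  fixes V :: "'a::euclidean_space set"
  assumes "V \<in> delaunay g X"
  shows "card V = DIM('a) + 1" "finite V" "V \<noteq> {}" "V \<subseteq> X"
    "\<exists>c \<rho>. V = {x\<in>X. dist (g x) c = \<rho>} \<and> (\<forall>x\<in>X. \<rho> \<le> dist (g x) c)"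
proof -
  show card: "card V = DIM('a) + 1" using assms by (simp add: delaunay_def)
  show "finite V" using card by (metis add_is_0 card.infinite one_neq_zero)
  show "V \<noteq> {}" using card by auto
  show c: "\<exists>c \<rho>. V = {x\<in>X. dist (g x) c = \<rho>} \<and> (\<forall>x\<in>X. \<rho> \<le> dist (g x) c)"
    using assms by (simp add: delaunay_def)
  show "V \<subseteq> X" using c by blast
qed

lemma delaunay_diameter:
  fixes g :: "'a::euclidean_space \<Rightarrow> 'a"
  assumes g: "linear g" "inj g" and X: "delone X"
  shows "\<exists>D>0. \<forall>V\<in>delaunay g X. \<forall>x\<in>convex hull V. \<forall>y\<in>convex hull V. dist x y \<le> D"
proof -
  obtain m M where mM: "m > 0" "M > 0" "\<And>x y. m * dist x y \<le> dist (g x) (g y)"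
    "\<And>x y. dist (g x) (g y) \<le> M * dist x y" using linear_dist_bounds[OF g] by metis
  obtain r where r: "r > 0" "\<And>x. \<exists>y\<in>X. dist x y \<le> r" using X by (rule delone_covering) blast
  define D where "D = 2 * (M * r) / m"
  have "D > 0" using mM r by (simp add: D_def)
  moreover have "dist x y \<le> D" if V: "V \<in> delaunay g X" and xy: "x \<in> convex hull V" "y \<in> convex hull V" for V x y
  proof -
    obtain c \<rho> where c: "V = {x\<in>X. dist (g x) c = \<rho>}" "\<forall>x\<in>X. \<rho> \<le> dist (g x) c"
      using delaunay_cell(5)[OF V] by (elim exE conjE)
    have \<rho>: "\<rho> \<le> M * r" by (rule empty_sphere_radius[OF g mM(4,2) r(2) bspec[OF c(2)]])
    have V1: "V \<subseteq> cball v D" if "v \<in> V" for v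
    proof
      fix w assume "w \<in> V"
      have "m * dist v w \<le> dist (g v) c + dist (g w) c"
        using mM(3)[of v w] dist_triangle2[of "g v" "g w" c] by linarith
      also have "\<dots> = 2 * \<rho>" using \<open>w \<in> V\<close> \<open>v \<in> V\<close> c(1) by simp
      also have "\<dots> \<le> 2 * (M * r)" using \<rho> by simp
      finally show "w \<in> cball v D" using mM(1) by (simp add: D_def field_simps)
    qed
    have V2: "convex hull V \<subseteq> cball v D" if "v \<in> V" for v
      using V1[OF that] convex_cball by (rule hull_minimal)
    have "V \<subseteq> cball x D"
    proof
      fix v assume "v \<in> V"
      from subsetD[OF V2[OF this] xy(1)] show "v \<in> cball x D" by (simp add: dist_commute)
    qed
    then have "convex hull V \<subseteq> cball x D" using convex_cball by (rule hull_minimal)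
    with xy(2) show ?thesis by auto
  qed
  ultimately show ?thesis by blast
qed

lemma delaunay_locally_finite:
  fixes g :: "'a::euclidean_space \<Rightarrow> 'a"
  assumes g: "linear g" "inj g" and X: "delone X"
  shows "finite {V\<in>delaunay g X. convex hull V \<inter> cball x R \<noteq> {}}"
proof -
  obtain D where D: "\<forall>V\<in>delaunay g X. \<forall>x\<in>convex hull V. \<forall>y\<in>convex hull V. dist x y \<le> D"
    using delaunay_diameter[OF g X] by blast
  have "{V\<in>delaunay g X. convex hull V \<inter> cball x R \<noteq> {}} \<subseteq> Pow (X \<inter> cball x (R + D))"
  proof (intro subsetI PowI)
    fix V v assume "V \<in> {V\<in>delaunay g X. convex hull V \<inter> cball x R \<noteq> {}}" "v \<in> V"
    then obtain z where V: "V \<in> delaunay g X" "z \<in> convex hull V" "z \<in> cball x R" "v \<in> V"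
      by blast
    have "V \<subseteq> X" by (rule delaunay_cell(4)[OF V(1)])
    moreover have "dist z v \<le> D" using D V hull_inc by metis
    ultimately show "v \<in> X \<inter> cball x (R + D)"
      using V(3,4) dist_triangle[of x v z] by auto
  qed
  then show ?thesis using delone_finite_cball[OF X] finite_subset by blast
qed

context generic_delone
begin

lemma delaunay_independent:
  assumes "V \<in> delaunay g Q" shows "\<not> affine_dependent V"
proof -
  obtain c \<rho> where "V = {x\<in>Q. dist (g x) c = \<rho>}"
    using delaunay_cell(5)[OF assms] by (elim exE conjE)
  then show ?thesis by (rule contact_set)
qed

text \<open>FLC leaves finitely many cells up to translation, and each of them has interior
  points.\<close>

lemma delaunay_inradius: "\<exists>\<kappa>>0. \<forall>V\<in>delaunay g Q. \<exists>b. cball b \<kappa> \<subseteq> convex hull V"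
proof -
  obtain D where D: "D > 0" "\<forall>V\<in>delaunay g Q. \<forall>x\<in>convex hull V. \<forall>y\<in>convex hull V. dist x y \<le> D"
    using delaunay_diameter[OF lin inj delone] by blast
  have finp: "finite (patch D Q ` Q)" using flc D by (simp add: finite_local_complexity_def)
  have finF: "finite (patch D Q p)" for p by (rule delone_finite_patch[OF delone])
  define \<U> where "\<U> = {U \<in> \<Union>(Pow ` patch D Q ` Q). interior (convex hull U) \<noteq> {}}"
  have "finite (\<Union>(Pow ` patch D Q ` Q))" using finp finF by (intro finite_UN_I) auto
  then have fin: "finite \<U>" unfolding \<U>_def by (rule finite_subset[OF Collect_restrict])
  have "\<exists>k>0. \<exists>b. cball b k \<subseteq> convex hull U" if "U \<in> \<U>" for U
  proof -
    have "interior (convex hull U) \<noteq> {}" using \<open>U \<in> \<U>\<close> by (simp add: \<U>_def)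
    then obtain b where "b \<in> interior (convex hull U)" unfolding ex_in_conv[symmetric] ..
    then show ?thesis unfolding mem_interior_cball by blast
  qed
  then obtain k where k: "\<And>U. U \<in> \<U> \<Longrightarrow> k U > 0 \<and> (\<exists>b. cball b (k U) \<subseteq> convex hull U)" by metis
  define \<kappa> where "\<kappa> = Min (insert 1 (k ` \<U>))"
  have "\<kappa> > 0" unfolding \<kappa>_def using fin k by (subst Min_gr_iff) auto
  moreover have "\<exists>b. cball b \<kappa> \<subseteq> convex hull V" if V: "V \<in> delaunay g Q" for V
  proof -
    note V' = delaunay_cell(1,3,4)[OF V]
    then obtain p where p: "p \<in> V" by blast
    define U where "U = (\<lambda>x. - p + x) ` V"
    have hU: "convex hull U = (\<lambda>x. - p + x) ` (convex hull V)"
      unfolding U_def by (rule convex_hull_translation)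
    have "interior (convex hull V) \<noteq> {}"
      by (rule interior_convex_hull_independent[OF delaunay_independent[OF V] V'(1)])
    then have "interior (convex hull U) \<noteq> {}" unfolding hU interior_translation by simp
    moreover have "U \<subseteq> patch D Q p"
    proof
      fix u assume "u \<in> U"
      then obtain v where v: "v \<in> V" "u = v - p" by (auto simp: U_def)
      have "dist v p \<le> D" using D(2) V v(1) p hull_inc by metis
      then show "u \<in> patch D Q p" using v V'(3) by (auto simp: mem_patch_iff dist_norm)
    qed
    ultimately have "U \<in> \<U>" using p V'(3) by (auto simp: \<U>_def)
    then obtain b where b: "cball b (k U) \<subseteq> convex hull U" "\<kappa> \<le> k U"
      using k fin unfolding \<kappa>_def by (metis Min_le finite_imageI finite_insert imageI insertCI)
    have "cball (b + p) \<kappa> \<subseteq> convex hull V"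
    proof
      fix x assume "x \<in> cball (b + p) \<kappa>"
      then have "x - p \<in> cball b (k U)" using b(2) by (simp add: dist_norm algebra_simps)
      then have "x - p \<in> convex hull U" using b(1) by blast
      then show "x \<in> convex hull V" unfolding hU by auto
    qed
    then show ?thesis by blast
  qed
  ultimately show ?thesis by blast
qed

text \<open>A moved contact set is contained in a contact set of \<open>Q\<close>, which has at most
  d + 1 points; so a moved contact set with d + 1 points comes from a cell of \<open>Q\<close>.
  Conversely, the empty spheres of the moved set around the centre of a ball inscribed in a cell of
  \<open>Q\<close> have exactly the moved cell as contact set.\<close>

theorem delaunay_perturbation:
  "\<exists>\<delta>>0. \<forall>h. (\<forall>x\<in>Q. dist (h x) x \<le> \<delta>) \<longrightarrow>
     inj_on h Q \<and> delone (h ` Q) \<and> delaunay g (h ` Q) = (`) h ` delaunay g Q \<and>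
     (\<forall>V\<in>delaunay g (h ` Q). \<not> affine_dependent V) \<and>
     (\<Union>V\<in>delaunay g (h ` Q). convex hull V) = UNIV"
proof -
  obtain \<delta>0 where \<delta>0: "\<delta>0 > 0" and pert: "\<forall>h c \<rho> W.
     (\<forall>x\<in>Q. dist (h x) x \<le> \<delta>0) \<longrightarrow> W = {x\<in>Q. dist (g (h x)) c = \<rho>} \<longrightarrow>
     W \<noteq> {} \<longrightarrow> (\<forall>x\<in>Q. \<rho> \<le> dist (g (h x)) c) \<longrightarrow>
     (\<exists>c' \<rho>' W'. W' = {x\<in>Q. dist (g x) c' = \<rho>'} \<and> (\<forall>x\<in>Q. \<rho>' \<le> dist (g x) c') \<and> W \<subseteq> W')"
    using sphere_perturbation by (elim exE conjE)
  obtain e where e: "e > 0" "\<And>x y. x \<in> Q \<Longrightarrow> y \<in> Q \<Longrightarrow> dist x y < e \<Longrightarrow> x = y"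
    using delone by (rule delone_separation) blast
  obtain \<kappa> where \<kappa>: "\<kappa> > 0" "\<forall>V\<in>delaunay g Q. \<exists>b. cball b \<kappa> \<subseteq> convex hull V"
    using delaunay_inradius by blast
  \<comment> \<open>e/4 keeps the moved set separated. With \<kappa>/3, a point within \<delta> of
    the centre of an inscribed ball stays in the open ball when it is moved by \<delta> once
    more.\<close>
  define \<delta> where "\<delta> = min \<delta>0 (min (e / 4) (\<kappa> / 3))"
  have \<delta>: "\<delta> > 0" "\<delta> \<le> \<delta>0" "4 * \<delta> \<le> e" "3 * \<delta> \<le> \<kappa>" using \<delta>0 e(1) \<kappa>(1) by (auto simp: \<delta>_def)
  show ?thesis
  proof (intro exI[of _ \<delta>] conjI allI impI)
    fix h assume h: "\<forall>x\<in>Q. dist (h x) x \<le> \<delta>"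
    have hd: "dist (h x) x \<le> \<delta>" if "x \<in> Q" for x using h that by blast
    show X: "delone (h ` Q)" and hinj: "inj_on h Q"
      using delone_image_near[OF delone e(2) e(1) hd \<delta>(3)] by blast+
    have h0: "\<forall>x\<in>Q. dist (h x) x \<le> \<delta>0" using h \<delta>(2) by force
    note limit = pert[THEN spec[of _ h], THEN spec, THEN spec, THEN spec, THEN mp, OF h0, THEN mp, THEN mp, THEN mp]
    have sphere: "\<exists>c \<rho> W. W = {x\<in>Q. dist (g (h x)) c = \<rho>} \<and> (\<forall>x\<in>Q. \<rho> \<le> dist (g (h x)) c) \<and>
        W \<noteq> {} \<and> x \<in> convex hull (h ` W)" for x
    proof -
      obtain c \<rho> where c: "\<forall>p\<in>h ` Q. \<rho> \<le> dist (g p) c"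
        "x \<in> convex hull {p\<in>h ` Q. dist (g p) c = \<rho>}"
        using linear_empty_sphere_exists[OF lin inj X, of x] by (elim exE conjE)
      define W where "W = {x\<in>Q. dist (g (h x)) c = \<rho>}"
      have "{p\<in>h ` Q. dist (g p) c = \<rho>} = h ` W" by (auto simp: W_def)
      then have "x \<in> convex hull (h ` W)" using c(2) by simp
      moreover from this have "W \<noteq> {}" by auto
      ultimately show ?thesis using c(1) W_def by (intro exI[of _ c] exI[of _ \<rho>] exI[of _ W]) auto
    qed
    have image: "h ` V \<in> delaunay g (h ` Q) \<and> \<not> affine_dependent (h ` V)" if V: "V \<in> delaunay g Q" for V
    proof -
      obtain c0 \<rho>0 where sph: "V = {x\<in>Q. dist (g x) c0 = \<rho>0}" "\<forall>x\<in>Q. \<rho>0 \<le> dist (g x) c0"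
        using delaunay_cell(5)[OF V] by (elim exE conjE)
      note c0 = sph(1) bspec[OF sph(2)] delaunay_cell(1-4)[OF V]
      note ind = delaunay_independent[OF V]
      obtain b where b: "cball b \<kappa> \<subseteq> convex hull V" using \<kappa>(2) V by blast
      have cardh: "card (h ` V) = DIM('a) + 1"
        using c0(3) card_image[OF inj_on_subset[OF hinj c0(6)]] by simp
      have loc: "\<exists>c \<rho>. V = {x\<in>Q. dist (g (h x)) c = \<rho>} \<and> (\<forall>x\<in>Q. \<rho> \<le> dist (g (h x)) c) \<and> x \<in> convex hull (h ` V)"
        if x: "x \<in> cball b \<delta>" for x
      proof -
        obtain c \<rho> W where W: "W = {x\<in>Q. dist (g (h x)) c = \<rho>}" "\<forall>x\<in>Q. \<rho> \<le> dist (g (h x)) c"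
          "W \<noteq> {}" "x \<in> convex hull (h ` W)" using sphere[of x] by (elim exE conjE)
        obtain c' \<rho>' W' where W': "W' = {x\<in>Q. dist (g x) c' = \<rho>'}" "\<forall>x\<in>Q. \<rho>' \<le> dist (g x) c'" "W \<subseteq> W'"
          using limit[OF W(1,3,2)] by (elim exE conjE)
        note fW' = contact_set[OF W'(1)]
        have fW: "finite W" using finite_subset[OF W'(3) fW'(1)] .
        have WQ: "W \<subseteq> Q" using W(1) by blast
        obtain y where y: "y \<in> convex hull W" "dist x y \<le> \<delta>"
          using convex_hull_image_near[OF fW _ inj_on_subset[OF hinj WQ] W(4), of \<delta>] hd WQ by blast
        have "y \<in> ball b \<kappa>"
          using x y(2) dist_triangle[of b y x] \<delta> by simp
        then have yi: "y \<in> interior (convex hull V)"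
          using interior_maximal[of "ball b \<kappa>" "convex hull V"] b ball_subset_cball by blast
        have "y \<in> convex hull W'" using y(1) hull_mono[OF W'(3)] by blast
        moreover have yV: "y \<in> convex hull V" using yi interior_subset by blast
        ultimately have "y \<in> convex hull (V \<inter> W')"
          using empty_spheres_face_to_face[OF lin c0(1,4,2) W'(1) fW'(1)] W'(2) by blast
        then have "V \<inter> W' = V"
          using interior_convex_hull_proper_subset[OF ind _ _ yi] by blast
        then have "V \<subseteq> W'" by blast
        then have "V = W'" using card_subset_eq[OF fW'(1)] fW'(3) c0(3) card_mono[OF fW'(1), of V] by simp
        then have "W = V" using interior_convex_hull_proper_subset[OF ind _ y(1) yi] W'(3) by blast
        then show ?thesis using W by (intro exI[of _ c] exI[of _ \<rho>]) simp
      qed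
      have "b \<in> cball b \<delta>" using \<delta>(1) by simp
      from loc[OF this] obtain c \<rho> where c: "V = {x\<in>Q. dist (g (h x)) c = \<rho>}" "\<forall>x\<in>Q. \<rho> \<le> dist (g (h x)) c"
        by (elim exE conjE)
      have "h ` V \<in> delaunay g (h ` Q)"
        unfolding delaunay_def using cardh c
        by (intro CollectI conjI exI[of _ c] exI[of _ \<rho>]) auto
      moreover have "cball b \<delta> \<subseteq> convex hull (h ` V)"
        using loc by (meson subsetI)
      then have "ball b \<delta> \<subseteq> interior (convex hull (h ` V))"
        by (intro interior_maximal) (use ball_subset_cball in blast, simp)
      then have "interior (convex hull (h ` V)) \<noteq> {}" using \<delta>(1) by (metis ball_eq_empty not_le subset_empty)
      then have "\<not> affine_dependent (h ` V)"
        using affine_independent_if_interior cardh c0(4) by blast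
      ultimately show ?thesis by blast
    qed
    have full: "W \<in> delaunay g Q" if W: "W = {x\<in>Q. dist (g (h x)) c = \<rho>}" "\<forall>x\<in>Q. \<rho> \<le> dist (g (h x)) c" "card W \<ge> DIM('a) + 1" for W c \<rho>
    proof -
      have "W \<noteq> {}" using W(3) by auto
      obtain c' \<rho>' W' where W': "W' = {x\<in>Q. dist (g x) c' = \<rho>'}" "\<forall>x\<in>Q. \<rho>' \<le> dist (g x) c'" "W \<subseteq> W'"
        using limit[OF W(1) \<open>W \<noteq> {}\<close> W(2)] by (elim exE conjE)
      note fW' = contact_set[OF W'(1)]
      have "W = W'" using card_subset_eq[OF fW'(1) W'(3)] card_mono[OF fW'(1) W'(3)] fW'(3) W(3) by simp
      moreover have "W' \<in> delaunay g Q"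
        unfolding delaunay_def using W' fW'(3) \<open>W = W'\<close> W(3) by (intro CollectI conjI exI[of _ c'] exI[of _ \<rho>']) auto
      ultimately show ?thesis by simp
    qed
    show eq: "delaunay g (h ` Q) = (`) h ` delaunay g Q"
    proof
      show "(`) h ` delaunay g Q \<subseteq> delaunay g (h ` Q)" using image by blast
      show "delaunay g (h ` Q) \<subseteq> (`) h ` delaunay g Q"
      proof
        fix U assume Uh: "U \<in> delaunay g (h ` Q)"
        obtain c \<rho> where c: "U = {x\<in>h ` Q. dist (g x) c = \<rho>}" "\<forall>x\<in>h ` Q. \<rho> \<le> dist (g x) c"
          using delaunay_cell(5)[OF Uh] by (elim exE conjE)
        note cU = delaunay_cell(1)[OF Uh]
        define W where "W = {x\<in>Q. dist (g (h x)) c = \<rho>}"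
        have U: "U = h ` W" using c(1) by (auto simp: W_def)
        have "inj_on h W" by (rule inj_on_subset[OF hinj]) (auto simp: W_def)
        then have "card W = DIM('a) + 1" using cU U by (simp add: card_image)
        then have "W \<in> delaunay g Q" using full[OF W_def] c(2) by simp
        then show "U \<in> (`) h ` delaunay g Q" using U by blast
      qed
    qed
    show "\<forall>V\<in>delaunay g (h ` Q). \<not> affine_dependent V" unfolding eq using image by simp
    \<comment> \<open>Exceptional points, whose empty sphere may have too few contacts to be a cell.
      They lie in countably many polytopes of lower dimension.\<close>
    define N where "N = (\<Union>S\<in>{S. finite S \<and> S \<subseteq> h ` Q \<and> card S \<le> DIM('a)}. convex hull S)"
    have "countable {S. finite S \<and> S \<subseteq> h ` Q}"
      using delone_countable[OF X] by (rule countable_Collect_finite_subset)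
    then have "countable {S. finite S \<and> S \<subseteq> h ` Q \<and> card S \<le> DIM('a)}"
      by (rule countable_subset[rotated]) auto
    moreover have "negligible (convex hull S)" if "finite S" "card S \<le> DIM('a)" for S :: "'a set"
    proof -
      have "aff_dim (convex hull S) < DIM('a)" using aff_dim_le_card[OF that(1)] that(2) by (simp add: aff_dim_convex_hull)
      then have "interior (convex hull S) = {}" using aff_dim_nonempty_interior by fastforce
      then show ?thesis by (simp add: negligible_convex_interior)
    qed
    ultimately have negN: "negligible N" unfolding N_def by (intro negligible_countable_Union) auto
    have offN: "x \<in> (\<Union>V\<in>delaunay g (h ` Q). convex hull V)" if "x \<notin> N" for x
    proof -
      obtain c \<rho> W where W: "W = {x\<in>Q. dist (g (h x)) c = \<rho>}" "\<forall>x\<in>Q. \<rho> \<le> dist (g (h x)) c"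
        "W \<noteq> {}" "x \<in> convex hull (h ` W)" using sphere[of x] by (elim exE conjE)
      have WQ: "W \<subseteq> Q" using W(1) by blast
      have "finite W"
      proof -
        obtain c' \<rho>' W' where W': "W' = {x\<in>Q. dist (g x) c' = \<rho>'}" "\<forall>x\<in>Q. \<rho>' \<le> dist (g x) c'" "W \<subseteq> W'"
          using limit[OF W(1,3,2)] by (elim exE conjE)
        then show ?thesis using finite_subset contact_set(1) by blast
      qed
      moreover have "card (h ` W) = card W" using card_image[OF inj_on_subset[OF hinj WQ]] .
      ultimately have "h ` W \<in> {S. finite S \<and> S \<subseteq> h ` Q \<and> card S \<le> DIM('a)}" if "card W \<le> DIM('a)"
        using WQ that by auto
      then have "\<not> card W \<le> DIM('a)" using \<open>x \<notin> N\<close> W(4) unfolding N_def by (meson UN_I)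
      then have "W \<in> delaunay g Q" using full[OF W(1,2)] by simp
      then have "h ` W \<in> delaunay g (h ` Q)" using image by blast
      then show ?thesis using W(4) by blast
    qed
    \<comment> \<open>The union of the cells is closed by local finiteness, so an uncovered point
      would have an uncovered ball around it, contained in the null set \<open>N\<close>.\<close>
    show "(\<Union>V\<in>delaunay g (h ` Q). convex hull V) = UNIV"
    proof (rule ccontr)
      assume "\<not> ?thesis"
      then obtain x where x: "x \<notin> (\<Union>V\<in>delaunay g (h ` Q). convex hull V)" by blast
      define \<A> where "\<A> = {V\<in>delaunay g (h ` Q). convex hull V \<inter> cball x 1 \<noteq> {}}"
      have "finite \<A>" unfolding \<A>_def by (rule delaunay_locally_finite[OF lin inj X])
      moreover have "closed (convex hull V)" if "V \<in> \<A>" for V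
      proof -
        have "V \<in> delaunay g (h ` Q)" using that by (simp add: \<A>_def)
        then have "finite V" by (rule delaunay_cell)
        then show ?thesis by (intro compact_imp_closed finite_imp_compact_convex_hull)
      qed
      ultimately have "open (- (\<Union>V\<in>\<A>. convex hull V))" by (intro open_Compl closed_UN ballI)
      moreover have "x \<in> - (\<Union>V\<in>\<A>. convex hull V)" using x by (auto simp: \<A>_def)
      ultimately obtain d where d: "d > 0" "ball x d \<subseteq> - (\<Union>V\<in>\<A>. convex hull V)"
        using open_contains_ball by metis
      have "ball x (min d 1) \<subseteq> N"
      proof
        fix y assume y: "y \<in> ball x (min d 1)"
        show "y \<in> N"
        proof (rule ccontr)
          assume "y \<notin> N"
          then obtain V where V: "V \<in> delaunay g (h ` Q)" "y \<in> convex hull V" using offN by blast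
          then have "V \<in> \<A>" using y by (auto simp: \<A>_def)
          with V(2) d(2) y show False by auto
        qed
      qed
      then have "negligible (ball x (min d 1))" using negligible_subset[OF negN] by blast
      moreover have "ball x (min d 1) \<noteq> {}" using d(1) by simp
      ultimately show False using open_not_negligible by blast
    qed
  qed (fact \<delta>(1))
qed

end

section \<open>The Delaunay triangulation as a polyhedral tiling\<close>

lemma translate_eq_image_plus: "translate P x = (+) (- x) ` P"
  by (auto simp: translate_def)

lemma translate_convex_hull: "translate (convex hull V) x = convex hull (translate V x)"
  unfolding translate_eq_image_plus by (rule convex_hull_translation[symmetric])

lemma extreme_point_of_translate: "z extreme_point_of translate t x \<longleftrightarrow> z + x extreme_point_of t"
  using extreme_point_of_translation_eq[of "-x" "z + x" t] by (simp add: translate_eq_image_plus)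

text \<open>The intersection with another tile is a proper face and so avoids the interior.\<close>

lemma tiling_interior_boundary:
  assumes T: "polyhedral_tiling T" and t: "t \<in> T"
  shows "interior t \<inter> tiling_boundary T = {}"
proof (rule ccontr)
  assume "\<not> ?thesis"
  then obtain y u where y: "y \<in> interior t" "u \<in> T" "y \<in> frontier u" by (auto simp: tiling_boundary_def)
  have "u \<noteq> t" using y by (auto simp: frontier_def)
  have poly: "polytope u" "interior t \<noteq> {}" and face: "(t \<inter> u) face_of t" "(t \<inter> u) face_of u"
    using T t y(2) unfolding polyhedral_tiling_def by auto
  have "t \<inter> u \<noteq> t"
  proof
    assume eq: "t \<inter> u = t"
    then have "t \<inter> interior u = {}" using face(2) \<open>u \<noteq> t\<close> face_of_disjoint_interior by metis
    moreover have "interior t \<subseteq> interior u" using eq by (metis inf_le2 interior_mono)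
    ultimately show False using poly(2) interior_subset by blast
  qed
  then have "(t \<inter> u) \<inter> interior t = {}" using face(1) face_of_disjoint_interior by blast
  moreover have "y \<in> u" using y(3) poly(1) polytope_imp_closed frontier_subset_closed by blast
  ultimately show False using y(1) interior_subset by blast
qed

lemma mem_tiling_vertices_iff: "x \<in> tiling_vertices T \<longleftrightarrow> (\<exists>t\<in>T. x extreme_point_of t)"
  by (auto simp: tiling_vertices_def tiling_cells_def face_of_singleton)

text \<open>
  The interiors of the tiles are the components of the complement of the boundary set, so the
  vertices can be read off from that set as the extreme points of closures of components.
\<close>

lemma tiling_vertices_from_boundary:
  fixes T :: "'a::euclidean_space set set"
  assumes T: "polyhedral_tiling T" and D: "\<And>t x y. t \<in> T \<Longrightarrow> x \<in> t \<Longrightarrow> y \<in> t \<Longrightarrow> dist x y \<le> D"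
  shows "locally_derivable_within D (tiling_boundary T) (tiling_vertices T)"
proof -
  \<comment> \<open>Containment in the ball makes the criterion local. The condition on the frontier
    makes \<open>U\<close> a whole component of the complement, hence the interior of a
    tile.\<close>
  define crit where "crit x U \<longleftrightarrow> open U \<and> connected U \<and> U \<noteq> {} \<and> U \<subseteq> cball x D \<and>
    U \<inter> tiling_boundary T = {} \<and> frontier U \<subseteq> tiling_boundary T \<and> x extreme_point_of closure U" for x U
  have tile: "convex t" "closed t" "interior t \<noteq> {}" "closure (interior t) = t" if "t \<in> T" for t
  proof -
    have "polytope t" and ne: "interior t \<noteq> {}" using T that by (auto simp: polyhedral_tiling_def)
    then show c: "convex t" "closed t" by (auto simp: polytope_imp_convex polytope_imp_closed)
    show "interior t \<noteq> {}" by fact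
    show "closure (interior t) = t" using convex_closure_interior[OF c(1) ne] c(2) by simp
  qed
  have vertex: "x \<in> tiling_vertices T \<longleftrightarrow> (\<exists>U. crit x U)" for x
  proof
    assume "x \<in> tiling_vertices T"
    then obtain t where t: "t \<in> T" "x extreme_point_of t" by (auto simp: mem_tiling_vertices_iff)
    have "x \<in> t" using t(2) by (simp add: extreme_point_of_def)
    then have "t \<subseteq> cball x D" using D[OF t(1)] by auto
    moreover have "frontier (interior t) = frontier t"
      using tile[OF t(1)] by (simp add: frontier_def)
    moreover have "interior t \<subseteq> cball x D" using interior_subset \<open>t \<subseteq> cball x D\<close> by (rule order_trans)
    moreover have "frontier t \<subseteq> tiling_boundary T" using t(1) by (auto simp: tiling_boundary_def)
    moreover have "connected (interior t)" using tile[OF t(1)] by (simp add: convex_interior convex_connected)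
    ultimately have "crit x (interior t)"
      unfolding crit_def using t(2) tile[OF t(1)] tiling_interior_boundary[OF T t(1)] by simp
    then show "\<exists>U. crit x U" ..
  next
    assume "\<exists>U. crit x U"
    then obtain U where U: "open U" "connected U" "U \<noteq> {}" "U \<inter> tiling_boundary T = {}"
        "frontier U \<subseteq> tiling_boundary T" "x extreme_point_of closure U"
      unfolding crit_def by blast
    obtain y where y: "y \<in> U" using U(3) by blast
    obtain t where t: "t \<in> T" "y \<in> t" using T unfolding polyhedral_tiling_def by blast
    have "U \<inter> frontier t = {}" using U(4) t(1) by (auto simp: tiling_boundary_def)
    \<comment> \<open>A connected set that meets \<open>t\<close> but not its frontier lies in
      \<open>t\<close>. The same argument is applied below with the interior of \<open>t\<close> and
      \<open>U\<close> exchanged.\<close>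
    then have "U \<subseteq> t" using connected_Int_frontier[OF U(2), of t] y t(2) by blast
    then have sub: "U \<subseteq> interior t" using U(1) by (rule interior_maximal)
    have "interior t \<inter> frontier U = {}" using U(5) tiling_interior_boundary[OF T t(1)] by blast
    moreover have "connected (interior t)" using tile[OF t(1)] by (simp add: convex_interior convex_connected)
    ultimately have "interior t \<subseteq> U" using connected_Int_frontier[of "interior t" U] y sub by blast
    then have "closure U = t" using sub tile(4)[OF t(1)] by (metis subset_antisym)
    then show "x \<in> tiling_vertices T" using U(6) t(1) by (auto simp: mem_tiling_vertices_iff)
  qed
  have move: "\<exists>U. crit y U" if p: "patch D (tiling_boundary T) x = patch D (tiling_boundary T) y" and "crit x U" for x y U
  proof
    let ?B = "tiling_boundary T" and ?U = "translate U (x - y)"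
    have U: "open U" "connected U" "U \<noteq> {}" "U \<subseteq> cball x D" "U \<inter> ?B = {}"
        "frontier U \<subseteq> ?B" "x extreme_point_of closure U"
      using \<open>crit x U\<close> unfolding crit_def by blast+
    have "closure U \<subseteq> cball x D" using U(4) by (simp add: closure_minimal)
    then have fr: "frontier U \<subseteq> cball x D" by (auto simp: frontier_def)
    have B: "z + (x - y) \<in> ?B \<longleftrightarrow> z \<in> ?B" if "z + (x - y) \<in> cball x D" for z
    proof -
      have "norm (z - y) \<le> D" using that by (simp add: dist_norm norm_minus_commute algebra_simps)
      from patch_eqD[OF p this] show ?thesis by (simp add: algebra_simps)
    qed
    have cl: "closure ?U = translate (closure U) (x - y)"
      unfolding translate_eq_image_plus by (rule closure_translation)
    have frU: "frontier ?U = translate (frontier U) (x - y)"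
      unfolding translate_eq_image_plus by (rule frontier_translation)
    show "crit y ?U"
      unfolding crit_def
    proof (intro conjI)
      show "open ?U" "connected ?U" "?U \<noteq> {}"
        using U(1-3) unfolding translate_eq_image_plus
        by (auto simp: open_translation intro!: connected_continuous_image continuous_intros)
      show "?U \<subseteq> cball y D"
        using U(4) by (auto simp: mem_translate_iff dist_norm subset_iff algebra_simps)
      show "?U \<inter> ?B = {}"
      proof (intro equals0I)
        fix z assume "z \<in> ?U \<inter> ?B"
        then have z: "z + (x - y) \<in> U" "z \<in> ?B" by (auto simp: mem_translate_iff)
        have "z + (x - y) \<in> ?B" using B[OF subsetD[OF U(4) z(1)]] z(2) by simp
        then show False using U(5) z(1) by (meson disjoint_iff)
      qed
      show "frontier ?U \<subseteq> ?B"
      proof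
        fix z assume "z \<in> frontier ?U"
        then have z: "z + (x - y) \<in> frontier U" unfolding frU by (simp add: mem_translate_iff)
        show "z \<in> ?B" using B[OF subsetD[OF fr z]] subsetD[OF U(6) z] by simp
      qed
      show "y extreme_point_of closure ?U"
        unfolding cl extreme_point_of_translate using U(7) by simp
    qed
  qed
  show ?thesis
    unfolding locally_derivable_within_def vertex
  proof (intro allI impI iffI)
    fix x y assume p: "patch D (tiling_boundary T) x = patch D (tiling_boundary T) y"
    show "\<exists>U. crit y U" if "\<exists>U. crit x U" using that move[OF p] by (elim exE)
    show "\<exists>U. crit x U" if "\<exists>U. crit y U" using that move[OF p[symmetric]] by (elim exE)
  qed
qed

text \<open>Pattern equivariance is defined by tiles, local derivability by points. A vertex within
  \<open>R\<close> is a corner of a tile within \<open>R\<close>, so tile patterns determine vertex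
  patches.\<close>

lemma patch_from_tiles:
  assumes "translate_tiles (tiles_within R T {x}) x = translate_tiles (tiles_within R T {y}) y"
  shows "patch R (tiling_vertices T) x = patch R (tiling_vertices T) y"
proof -
  have "z + x \<in> tiling_vertices T \<longleftrightarrow> (\<exists>t\<in>translate_tiles (tiles_within R T {x}) x. z extreme_point_of t)"
    if "norm z \<le> R" for x z
  proof -
    have "t \<in> tiles_within R T {x}" if "t \<in> T" "z + x extreme_point_of t" for t
    proof -
      have "z + x \<in> t" using that(2) by (simp add: extreme_point_of_def)
      moreover have "dist x (z + x) \<le> R" using \<open>norm z \<le> R\<close> by (simp add: dist_norm)
      ultimately show ?thesis using that(1) by (auto simp: tiles_within_def)
    qed
    moreover have "tiles_within R T {x} \<subseteq> T" by (auto simp: tiles_within_def)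
    ultimately show ?thesis
      unfolding mem_tiling_vertices_iff translate_tiles_def by (auto simp: extreme_point_of_translate)
  qed
  then show ?thesis using assms unfolding patch_eq_iff by simp
qed

section \<open>Delaunay triangulations\<close>

definition delaunay_tiling :: "('a::euclidean_space \<Rightarrow> 'a) \<Rightarrow> 'a set \<Rightarrow> 'a set set" where
  "delaunay_tiling g X = (hull) convex ` delaunay g X"

definition delaunay_simplices :: "('a::euclidean_space \<Rightarrow> 'a) \<Rightarrow> 'a set \<Rightarrow> 'a set set" where
  "delaunay_simplices g X = {U. U \<noteq> {} \<and> (\<exists>V\<in>delaunay g X. U \<subseteq> V)}"

text \<open>To be instantiated with \<open>Q\<close> and with the moved set. Independence and
  covering come from general position and from \<open>delaunay_perturbation\<close>, which treats
  \<open>Q\<close> itself as the image under the identity.\<close>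

locale delaunay_triangulation =
  fixes g :: "'a::euclidean_space \<Rightarrow> 'a" and X :: "'a set"
  assumes lin: "linear g" and inj: "inj g" and delone: "delone X"
    and flc: "finite_local_complexity X"
    and independent: "\<And>V. V \<in> delaunay g X \<Longrightarrow> \<not> affine_dependent V"
    and cover: "(\<Union>V\<in>delaunay g X. convex hull V) = UNIV"
begin

abbreviation "T \<equiv> delaunay_tiling g X"

lemma face_to_face:
  assumes "V \<in> delaunay g X" "W \<in> delaunay g X"
  shows "convex hull V \<inter> convex hull W = convex hull (V \<inter> W)"
proof -
  obtain c \<rho> where c: "V = {x\<in>X. dist (g x) c = \<rho>}" "\<forall>x\<in>X. \<rho> \<le> dist (g x) c"
    using delaunay_cell(5)[OF assms(1)] by (elim exE conjE)
  obtain d \<sigma> where d: "W = {x\<in>X. dist (g x) d = \<sigma>}" "\<forall>x\<in>X. \<sigma> \<le> dist (g x) d"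
    using delaunay_cell(5)[OF assms(2)] by (elim exE conjE)
  show ?thesis
    using empty_spheres_face_to_face[OF lin c(1) delaunay_cell(2)[OF assms(1)] _ d(1) delaunay_cell(2)[OF assms(2)]] c(2) d(2)
    by blast
qed

lemma polyhedral: "polyhedral_tiling T"
  unfolding polyhedral_tiling_def
proof (intro conjI ballI allI)
  fix t assume "t \<in> T"
  then obtain V where V: "V \<in> delaunay g X" "t = convex hull V" by (auto simp: delaunay_tiling_def)
  show "polytope t" using V delaunay_cell(2) by (auto simp: polytope_def)
  show "interior t \<noteq> {}"
    using interior_convex_hull_independent[OF independent[OF V(1)] delaunay_cell(1)[OF V(1)]] V(2) by simp
  fix u assume "u \<in> T"
  then obtain W where W: "W \<in> delaunay g X" "u = convex hull W" by (auto simp: delaunay_tiling_def)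
  have eq: "t \<inter> u = convex hull (V \<inter> W)" using face_to_face[OF V(1) W(1)] V(2) W(2) by simp
  show "(t \<inter> u) face_of t"
    unfolding eq unfolding V(2) face_of_convex_hull_affine_independent[OF independent[OF V(1)]]
    by (intro exI[of _ "V \<inter> W"]) simp
  show "(t \<inter> u) face_of u"
    unfolding eq unfolding W(2) face_of_convex_hull_affine_independent[OF independent[OF W(1)]]
    by (intro exI[of _ "V \<inter> W"]) simp
next
  show "\<Union>T = UNIV" using cover by (simp add: delaunay_tiling_def)
  fix R
  have "{t \<in> T. t \<inter> cball 0 R \<noteq> {}} = (hull) convex ` {V\<in>delaunay g X. convex hull V \<inter> cball 0 R \<noteq> {}}"
    by (auto simp: delaunay_tiling_def)
  then show "finite {t \<in> T. t \<inter> cball 0 R \<noteq> {}}"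
    using delaunay_locally_finite[OF lin inj delone] by simp
qed

lemma cells: "tiling_cells T = (hull) convex ` delaunay_simplices g X"
proof -
  have face: "c face_of convex hull V \<longleftrightarrow> (\<exists>U. U \<subseteq> V \<and> c = convex hull U)" if "V \<in> delaunay g X" for c V
    using face_of_convex_hull_affine_independent[OF independent[OF that]] by simp
  show ?thesis
  proof (intro subset_antisym subsetI)
    fix c assume "c \<in> tiling_cells T"
    then obtain V where V: "c \<noteq> {}" "V \<in> delaunay g X" "c face_of convex hull V"
      by (auto simp: tiling_cells_def delaunay_tiling_def)
    obtain U where U: "U \<subseteq> V" "c = convex hull U" using V(3) unfolding face[OF V(2)] by (elim exE conjE)
    have "U \<noteq> {}" using V(1) U(2) by auto
    then have "U \<in> delaunay_simplices g X" using U(1) V(2) unfolding delaunay_simplices_def by blast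
    then show "c \<in> (hull) convex ` delaunay_simplices g X" using U(2) by simp
  next
    fix c assume "c \<in> (hull) convex ` delaunay_simplices g X"
    then obtain U V where U: "U \<noteq> {}" "V \<in> delaunay g X" "U \<subseteq> V" "c = convex hull U"
      by (auto simp: delaunay_simplices_def)
    have "c face_of convex hull V" unfolding face[OF U(2)] using U(3,4) by (intro exI[of _ U]) simp
    moreover have "c \<noteq> {}" using U(1,4) by simp
    ultimately show "c \<in> tiling_cells T"
      using U(2) unfolding tiling_cells_def delaunay_tiling_def by (intro CollectI conjI bexI[of _ "convex hull V"]) simp_all
  qed
qed

lemma simplex_independent: "U \<in> delaunay_simplices g X \<Longrightarrow> \<not> affine_dependent U"
  unfolding delaunay_simplices_def using independent affine_independent_subset by blast

text \<open>The hull of a cell lies in the closed ball of its sphere, and no point of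
  \<open>X\<close> lies inside that sphere.\<close>

lemma mem_cell:
  assumes "V \<in> delaunay g X" "x \<in> X" "x \<in> convex hull V" shows "x \<in> V"
proof -
  obtain c \<rho> where c: "V = {x\<in>X. dist (g x) c = \<rho>}" "\<forall>x\<in>X. \<rho> \<le> dist (g x) c"
    using delaunay_cell(5)[OF assms(1)] by (elim exE conjE)
  have "dist (g x) c \<le> \<rho>"
    by (rule dist_le_if_mem_convex_hull[OF lin _ assms(3)]) (subst (asm) c(1), simp)
  then have "dist (g x) c = \<rho>" using bspec[OF c(2) assms(2)] by (rule antisym)
  then show ?thesis using assms(2) by (subst c(1)) simp
qed

text \<open>The two simplices may belong to different cells. A vertex of the first that lies in the
  second is a point of \<open>X\<close> in the other cell, hence a vertex of that cell by
  \<open>mem_cell\<close>, and independence makes it a vertex of the second simplex.\<close>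

lemma simplex_subset_iff:
  assumes U: "U \<in> delaunay_simplices g X" "U' \<in> delaunay_simplices g X"
  shows "convex hull U \<subseteq> convex hull U' \<longleftrightarrow> U \<subseteq> U'"
proof
  assume sub: "convex hull U \<subseteq> convex hull U'"
  obtain V V' where V: "V \<in> delaunay g X" "U \<subseteq> V" "V' \<in> delaunay g X" "U' \<subseteq> V'"
    using U unfolding delaunay_simplices_def by (elim CollectE conjE bexE)
  show "U \<subseteq> U'"
  proof
    fix u assume u: "u \<in> U"
    have uU': "u \<in> convex hull U'" by (rule subsetD[OF sub hull_inc[OF u]])
    have "u \<in> convex hull V'" by (rule subsetD[OF hull_mono[OF V(4)] uU'])
    moreover have "u \<in> X" using u V(2) delaunay_cell(4)[OF V(1)] by (meson subsetD)
    ultimately have "u \<in> V'" using mem_cell[OF V(3)] by simp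
    show "u \<in> U'"
    proof (rule ccontr)
      assume "u \<notin> U'"
      then have "U' \<subseteq> V' - {u}" using V(4) by blast
      then have "u \<in> affine hull (V' - {u})"
        by (intro subsetD[OF hull_mono[of U' "V' - {u}" affine]] subsetD[OF convex_hull_subset_affine_hull uU'])
      with \<open>u \<in> V'\<close> have "affine_dependent V'" unfolding affine_dependent_def by (rule bexI[rotated])
      with independent[OF V(3)] show False by contradiction
    qed
  qed
qed (rule hull_mono)

lemma extreme_points_simplex:
  "U \<in> delaunay_simplices g X \<Longrightarrow> {x. x extreme_point_of (convex hull U)} = U"
  using extreme_point_of_convex_hull_affine_independent[OF simplex_independent] by blast

lemma vertices: "tiling_vertices T = X"
proof (intro set_eqI iffI)
  fix x assume "x \<in> tiling_vertices T"
  then obtain V where V: "V \<in> delaunay g X" "x extreme_point_of (convex hull V)"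
    by (auto simp: mem_tiling_vertices_iff delaunay_tiling_def)
  then have "x \<in> V" using extreme_point_of_convex_hull by blast
  then show "x \<in> X" using delaunay_cell(4)[OF V(1)] by blast
next
  fix x assume "x \<in> X"
  obtain V where V: "V \<in> delaunay g X" "x \<in> convex hull V" using cover by blast
  have "x \<in> V" by (rule mem_cell) fact+
  then have "x extreme_point_of (convex hull V)"
    using extreme_point_of_convex_hull_affine_independent[OF independent[OF V(1)]] by simp
  then show "x \<in> tiling_vertices T" using V(1) by (auto simp: mem_tiling_vertices_iff delaunay_tiling_def)
qed

lemma oriented_edge_cell:
  assumes "(x, y) \<in> oriented_edges T"
  shows "\<exists>V\<in>delaunay g X. x \<in> V \<and> y \<in> V"
proof -
  have "closed_segment x y \<in> (hull) convex ` delaunay_simplices g X"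
    using assms by (simp add: oriented_edges_def cells)
  then obtain U V where U: "closed_segment x y = convex hull U" "U \<subseteq> V" "V \<in> delaunay g X"
    by (auto simp: delaunay_simplices_def)
  have "x extreme_point_of closed_segment x y" "y extreme_point_of closed_segment x y"
    by (simp_all add: extreme_point_of_segment)
  then have "x \<in> U" "y \<in> U" unfolding U(1) using extreme_point_of_convex_hull by blast+
  then show ?thesis using U(2,3) by auto
qed

text \<open>Empty spheres have bounded radius, so a patch of fixed size shows all points that could
  lie on or inside the sphere of a cell containing its centre.\<close>

lemma delaunay_local:
  "\<exists>R>0. \<forall>x y V. patch R X x = patch R X y \<longrightarrow> V \<in> delaunay g X \<longrightarrow> x \<in> convex hull V \<longrightarrow>
     translate V (x - y) \<in> delaunay g X"
proof -
  obtain m M where mM: "m > 0" "M > 0" "\<And>x y. m * dist x y \<le> dist (g x) (g y)"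
    "\<And>x y. dist (g x) (g y) \<le> M * dist x y" using linear_dist_bounds[OF lin inj] by metis
  obtain r where r: "r > 0" "\<And>x. \<exists>y\<in>X. dist x y \<le> r" using delone by (rule delone_covering) blast
  obtain D where D: "D > 0" "\<forall>V\<in>delaunay g X. \<forall>x\<in>convex hull V. \<forall>y\<in>convex hull V. dist x y \<le> D"
    using delaunay_diameter[OF lin inj delone] by blast
  \<comment> \<open>The closed ball of the sphere contains \<open>g x\<close>, so a point farther
    than 2 M r / m from \<open>x\<close> is outside it; the summand \<open>D\<close> makes this
    strict and keeps \<open>V\<close> itself in view.\<close>
  define R where "R = D + 2 * (M * r) / m"
  have "R > 0" "D \<le> R" using D(1) mM r by (auto simp: R_def add_pos_nonneg)
  have mR: "m * R > 2 * (M * r)" using D(1) mM(1) by (simp add: R_def algebra_simps)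
  have "translate V (x - y) \<in> delaunay g X"
    if p: "patch R X x = patch R X y" and V: "V \<in> delaunay g X" and x: "x \<in> convex hull V" for x y V
  proof -
    obtain c \<rho> where c: "V = {x\<in>X. dist (g x) c = \<rho>}" "\<forall>x\<in>X. \<rho> \<le> dist (g x) c"
      using delaunay_cell(5)[OF V] by (elim exE conjE)
    have \<rho>: "\<rho> \<le> M * r" by (rule empty_sphere_radius[OF lin inj mM(4,2) r(2) bspec[OF c(2)]])
    define d where "d = c + g (y - x)"
    have dd: "dist (g p) d = dist (g (p + (x - y))) c" for p
      by (simp add: d_def dist_norm linear_add[OF lin] linear_diff[OF lin] algebra_simps)
    have gx: "dist (g x) c \<le> \<rho>"
      by (rule dist_le_if_mem_convex_hull[OF lin _ x]) (subst (asm) c(1), simp)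
    have far: "\<rho> < dist (g (p + (x - y))) c" if "dist p y > R" for p
    proof -
      have "m * R < m * dist p y" using that mM(1) by simp
      also have "m * dist p y = m * dist (p + (x - y)) x" by (simp add: dist_norm)
      also have "\<dots> \<le> dist (g (p + (x - y))) (g x)" by (rule mM)
      also have "\<dots> \<le> dist (g (p + (x - y))) c + dist (g x) c" by (rule dist_triangle2)
      finally show ?thesis using mR gx \<rho> by linarith
    qed
    have near: "p \<in> X \<longleftrightarrow> p + (x - y) \<in> X" if "dist p y \<le> R" for p
      using patch_eqD[OF p, of "p - y"] that by (simp add: dist_norm algebra_simps)
    have Vnear: "dist p y \<le> R" if "p + (x - y) \<in> V" for p
    proof -
      have "dist (p + (x - y)) x \<le> D" using D(2) V x that hull_inc by metis
      then show ?thesis using \<open>D \<le> R\<close> by (simp add: dist_norm)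
    qed
    have 1: "translate V (x - y) = {p\<in>X. dist (g p) d = \<rho>}"
    proof (intro set_eqI iffI)
      fix p assume "p \<in> translate V (x - y)"
      then have pV: "p + (x - y) \<in> V" by (simp add: mem_translate_iff)
      then have "p \<in> X" using near[OF Vnear[OF pV]] delaunay_cell(4)[OF V] by blast
      with pV show "p \<in> {p\<in>X. dist (g p) d = \<rho>}" using c(1) dd by simp
    next
      fix p assume p: "p \<in> {p\<in>X. dist (g p) d = \<rho>}"
      then have "\<not> dist p y > R" using far[of p] dd by auto
      then have "p + (x - y) \<in> X" using p near[of p] by simp
      then show "p \<in> translate V (x - y)" using p dd c(1) by (simp add: mem_translate_iff)
    qed
    moreover have "\<rho> \<le> dist (g p) d" if "p \<in> X" for p
    proof (cases "dist p y > R")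
      case True
      then show ?thesis using far[of p] dd by simp
    next
      case False
      then show ?thesis using near[of p] that c(2) dd by simp
    qed
    moreover have "card (translate V (x - y)) = DIM('a) + 1"
      unfolding translate_def using delaunay_cell(1)[OF V] by (subst card_image) (auto simp: inj_on_def)
    ultimately show ?thesis unfolding delaunay_def by (intro CollectI conjI exI[of _ d] exI[of _ \<rho>]) auto
  qed
  then show ?thesis using \<open>R > 0\<close> by blast
qed

lemma mutually_derivable_boundary:
  "\<exists>R>0. locally_derivable_within R X (tiling_boundary T)"
  "\<exists>R>0. locally_derivable_within R (tiling_boundary T) X"
proof -
  obtain R where R: "R > 0" and loc: "\<forall>x y V. patch R X x = patch R X y \<longrightarrow> V \<in> delaunay g X \<longrightarrow> x \<in> convex hull V \<longrightarrow>
     translate V (x - y) \<in> delaunay g X" using delaunay_local by blast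
  have "y \<in> tiling_boundary T" if p: "patch R X x = patch R X y" and x: "x \<in> tiling_boundary T" for x y
  proof -
    obtain V where V: "V \<in> delaunay g X" "x \<in> frontier (convex hull V)"
      using x by (auto simp: tiling_boundary_def delaunay_tiling_def)
    have "closed (convex hull V)"
      using delaunay_cell(2)[OF V(1)] by (intro compact_imp_closed finite_imp_compact_convex_hull)
    then have "x \<in> convex hull V" using V(2) frontier_subset_closed by blast
    then have V': "translate V (x - y) \<in> delaunay g X" using loc p V(1) by simp
    have "frontier (convex hull (translate V (x - y))) = translate (frontier (convex hull V)) (x - y)"
      unfolding translate_convex_hull[symmetric] unfolding translate_eq_image_plus by (rule frontier_translation)
    then have "y \<in> frontier (convex hull (translate V (x - y)))" using V(2) by (simp add: mem_translate_iff)
    then show ?thesis using V' by (auto simp: tiling_boundary_def delaunay_tiling_def)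
  qed
  then have "locally_derivable_within R X (tiling_boundary T)"
    unfolding locally_derivable_within_def by metis
  then show "\<exists>R>0. locally_derivable_within R X (tiling_boundary T)" using R by blast
  obtain D where D: "D > 0" "\<forall>V\<in>delaunay g X. \<forall>x\<in>convex hull V. \<forall>y\<in>convex hull V. dist x y \<le> D"
    using delaunay_diameter[OF lin inj delone] by blast
  have "locally_derivable_within D (tiling_boundary T) (tiling_vertices T)"
    using D(2) by (intro tiling_vertices_from_boundary[OF polyhedral]) (auto simp: delaunay_tiling_def)
  then show "\<exists>R>0. locally_derivable_within R (tiling_boundary T) X" using D(1) vertices by auto
qed

lemma flc_tiling: "flc_tiling T"
  unfolding flc_tiling_def
proof (intro allI impI)
  fix R :: real assume "R > 0"
  obtain r where r: "r > 0" "\<And>x. \<exists>y\<in>X. dist x y \<le> r" using delone by (rule delone_covering) blast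
  obtain D where D: "D > 0" "\<forall>V\<in>delaunay g X. \<forall>x\<in>convex hull V. \<forall>y\<in>convex hull V. dist x y \<le> D"
    using delaunay_diameter[OF lin inj delone] by blast
  \<comment> \<open>From \<open>p\<close> to \<open>x\<close>, from there to a tile, and across the
    tile to its vertices.\<close>
  define R' where "R' = R + r + D"
  have "R' > 0" using \<open>R > 0\<close> r D by (simp add: R'_def)
  define \<Q> where "\<Q> = (\<Union>F\<in>patch R' X ` X. Pow ((hull) convex ` Pow F))"
  have "finite (patch R' X p)" for p by (rule delone_finite_patch[OF delone])
  moreover have "finite (patch R' X ` X)" using flc \<open>R' > 0\<close> by (simp add: finite_local_complexity_def)
  ultimately have "finite \<Q>" unfolding \<Q>_def by (intro finite_UN_I) auto
  moreover have "\<exists>S\<in>\<Q>. \<exists>v. tiles_within R T {x} = translate_tiles S v" for x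
  proof -
    obtain p where p: "p \<in> X" "dist x p \<le> r" using r(2) by blast
    define S where "S = translate_tiles (tiles_within R T {x}) p"
    have "S \<subseteq> (hull) convex ` Pow (patch R' X p)"
    proof
      fix s assume "s \<in> S"
      then obtain V y where V: "V \<in> delaunay g X" "s = translate (convex hull V) p" "y \<in> convex hull V" "dist x y \<le> R"
        by (auto simp: S_def translate_tiles_def tiles_within_def delaunay_tiling_def)
      have "translate V p \<subseteq> patch R' X p"
      proof
        fix z assume "z \<in> translate V p"
        then have z: "z + p \<in> V" by (simp add: mem_translate_iff)
        then have "dist y (z + p) \<le> D" using D(2) V(1,3) hull_inc by metis
        then have "dist p (z + p) \<le> R'"
          using V(4) p(2) dist_triangle[of p "z + p" x] dist_triangle[of x "z + p" y]
          by (simp add: R'_def dist_commute)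
        then show "z \<in> patch R' X p"
          using z delaunay_cell(4)[OF V(1)] by (auto simp: mem_patch_iff dist_norm)
      qed
      then show "s \<in> (hull) convex ` Pow (patch R' X p)" using V(2) by (simp add: translate_convex_hull)
    qed
    then have "S \<in> \<Q>" using p(1) by (auto simp: \<Q>_def)
    moreover have "tiles_within R T {x} = translate_tiles S (- p)"
      by (simp add: S_def translate_tiles_def image_image translate_translate)
    ultimately show ?thesis by blast
  qed
  ultimately show "\<exists>\<Q>. finite \<Q> \<and> (\<forall>x. \<exists>S\<in>\<Q>. \<exists>v. tiles_within R T {x} = translate_tiles S v)" by blast
qed

end

text \<open>Every cell is a simplex and is recovered from its extreme points, so the bijection
  \<open>k\<close> of the vertices that matches the Delaunay cells induces the map on all cells.
  Inclusion and dimension can be read off from the vertex sets.\<close>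

lemma delaunay_combinatorial_isomorphism:
  fixes k :: "'a::euclidean_space \<Rightarrow> 'a"
  assumes "delaunay_triangulation g P" "delaunay_triangulation g Q"
    and k: "inj_on k P" and del: "delaunay g Q = (`) k ` delaunay g P"
  defines "\<Phi> \<equiv> \<lambda>c. convex hull (k ` {x. x extreme_point_of c})"
  shows "combinatorial_isomorphism (delaunay_tiling g P) (delaunay_tiling g Q) \<Phi>"
    and "\<And>x. x \<in> P \<Longrightarrow> corresponding_vertex \<Phi> x = k x"
proof -
  interpret P: delaunay_triangulation g P by fact
  interpret Q: delaunay_triangulation g Q by fact
  have \<Phi>: "\<Phi> (convex hull U) = convex hull (k ` U)" if "U \<in> delaunay_simplices g P" for U
    using P.extreme_points_simplex[OF that] by (simp add: \<Phi>_def)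
  have simp: "delaunay_simplices g Q = (`) k ` delaunay_simplices g P"
  proof (intro subset_antisym subsetI)
    fix W assume "W \<in> delaunay_simplices g Q"
    then obtain V where V: "V \<in> delaunay g P" "W \<noteq> {}" "W \<subseteq> k ` V"
      by (auto simp: delaunay_simplices_def del)
    then obtain U where "U \<subseteq> V" "W = k ` U" by (auto simp: subset_image_iff)
    with V show "W \<in> (`) k ` delaunay_simplices g P"
      by (intro image_eqI[of _ _ U]) (auto simp: delaunay_simplices_def)
  next
    fix W assume "W \<in> (`) k ` delaunay_simplices g P"
    then show "W \<in> delaunay_simplices g Q" by (auto simp: delaunay_simplices_def del)
  qed
  have sub: "U \<subseteq> P" if "U \<in> delaunay_simplices g P" for U
    using that delaunay_cell(4) by (fastforce simp: delaunay_simplices_def)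
  have iff: "\<Phi> (convex hull U) \<subseteq> \<Phi> (convex hull U') \<longleftrightarrow> convex hull U \<subseteq> convex hull U'"
    if "U \<in> delaunay_simplices g P" "U' \<in> delaunay_simplices g P" for U U'
  proof -
    have "\<Phi> (convex hull U) \<subseteq> \<Phi> (convex hull U') \<longleftrightarrow> k ` U \<subseteq> k ` U'"
      unfolding \<Phi>[OF that(1)] \<Phi>[OF that(2)] using that simp by (intro Q.simplex_subset_iff) auto
    also have "\<dots> \<longleftrightarrow> U \<subseteq> U'" using inj_on_image_subset_iff[OF k] sub that by blast
    also have "\<dots> \<longleftrightarrow> convex hull U \<subseteq> convex hull U'" using P.simplex_subset_iff[OF that] by simp
    finally show ?thesis .
  qed
  show "combinatorial_isomorphism (delaunay_tiling g P) (delaunay_tiling g Q) \<Phi>"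
    unfolding combinatorial_isomorphism_def P.cells Q.cells
  proof (intro conjI ballI)
    show "bij_betw \<Phi> ((hull) convex ` delaunay_simplices g P) ((hull) convex ` delaunay_simplices g Q)"
      unfolding bij_betw_def
    proof
      show "inj_on \<Phi> ((hull) convex ` delaunay_simplices g P)"
        using iff by (intro inj_onI) (auto intro!: subset_antisym)
      show "\<Phi> ` (hull) convex ` delaunay_simplices g P = (hull) convex ` delaunay_simplices g Q"
        unfolding simp image_image using \<Phi> by (intro image_cong) auto
    qed
  next
    fix c assume "c \<in> (hull) convex ` delaunay_simplices g P"
    then obtain U where U: "U \<in> delaunay_simplices g P" "c = convex hull U" by auto
    have "\<not> affine_dependent (k ` U)" using U(1) simp by (intro Q.simplex_independent) auto
    moreover have "card (k ` U) = card U" using card_image inj_on_subset[OF k sub[OF U(1)]] by blast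
    ultimately show "aff_dim (\<Phi> c) = aff_dim c"
      unfolding U(2) \<Phi>[OF U(1)] using P.simplex_independent[OF U(1)]
      by (simp add: aff_dim_convex_hull affine_independent_iff_card)
  next
    fix c c' assume "c \<in> (hull) convex ` delaunay_simplices g P" "c' \<in> (hull) convex ` delaunay_simplices g P"
    then show "\<Phi> c \<subseteq> \<Phi> c' \<longleftrightarrow> c \<subseteq> c'" using iff by auto
  qed
  show "corresponding_vertex \<Phi> x = k x" if "x \<in> P" for x
  proof -
    have "{y. y extreme_point_of {x}} = {x}" by (auto simp: extreme_point_of_def)
    then show ?thesis by (simp add: corresponding_vertex_def \<Phi>_def)
  qed
qed

section \<open>Moving a point set into a locally derivable one\<close>

text \<open>Differences of bounded length form a finite set and hence have a positive gap, so an
  approximate value determines the exact one.\<close>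

lemma flc_differences:
  assumes Q: "delone Q" "finite_local_complexity Q" and "S > 0"
  shows "\<exists>e>0. \<forall>x\<in>Q. \<forall>y\<in>Q. \<forall>x'\<in>Q. \<forall>y'\<in>Q. dist x y \<le> S \<longrightarrow> dist x' y' \<le> S \<longrightarrow>
    dist (y - x) (y' - x') < e \<longrightarrow> y - x = y' - x'"
proof -
  define \<D> where "\<D> = \<Union>(patch S Q ` Q)"
  have "finite \<D>"
    unfolding \<D>_def using Q(2) \<open>S > 0\<close> delone_finite_patch[OF Q(1)]
    by (intro finite_Union) (auto simp: finite_local_complexity_def)
  then have "uniform_discrete \<D>" using uniform_discrete_finite_iff by blast
  then obtain e where e: "e > 0" "\<forall>a\<in>\<D>. \<forall>b\<in>\<D>. dist a b < e \<longrightarrow> a = b"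
    unfolding uniform_discrete_def by blast
  have mem: "y - x \<in> \<D>" if "x \<in> Q" "y \<in> Q" "dist x y \<le> S" for x y
    unfolding \<D>_def using that by (intro UN_I[of x]) (simp_all add: mem_patch_iff dist_norm norm_minus_commute)
  show ?thesis using e mem by (intro exI[of _ e]) simp
qed

text \<open>A patch of \<open>Q\<close> is determined by the patch of \<open>P\<close> at a nearby
  point together with the offset to it. With one representative for each patch of \<open>P\<close>,
  only finitely many offsets occur.\<close>

lemma flc_locally_derivable:
  assumes P: "delone P" "finite_local_complexity P" and Q: "delone Q"
    and ld: "R > 0" "locally_derivable_within R P Q"
  shows "finite_local_complexity Q"
  unfolding finite_local_complexity_def
proof (intro allI impI)
  fix K :: real assume "K > 0"
  obtain r where r: "r > 0" "\<And>x. \<exists>y\<in>P. dist x y \<le> r" using P(1) by (rule delone_covering) blast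
  define M where "M = r + K + R"
  have "M > 0" using r \<open>K > 0\<close> ld by (simp add: M_def)
  then have fin: "finite (patch M P ` P)" using P(2) by (simp add: finite_local_complexity_def)
  define rep where "rep F = (SOME p. p \<in> P \<and> patch M P p = F)" for F
  have "patch K Q ` Q \<subseteq> (\<Union>F\<in>patch M P ` P. patch K Q ` (Q \<inter> cball (rep F) r))"
  proof
    fix G assume "G \<in> patch K Q ` Q"
    then obtain w where w: "w \<in> Q" "G = patch K Q w" by (elim imageE)
    obtain p where p: "p \<in> P" "dist w p \<le> r" using r(2) by blast
    define F where "F = patch M P p"
    have "rep F \<in> P \<and> patch M P (rep F) = F" unfolding rep_def by (rule someI[of _ p]) (simp add: p F_def)
    then have F: "patch M P p = patch M P (rep F)" by (simp add: F_def)
    define w' where "w' = w - p + rep F"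
    have wp: "norm (w - p) \<le> r" using p(2) by (simp add: dist_norm)
    have eq: "z + w \<in> Q \<longleftrightarrow> z + w' \<in> Q" if "norm z \<le> K" for z
    proof -
      have "norm (z + (w - p)) + R \<le> M" using wp that norm_triangle_ineq[of z "w - p"] by (simp add: M_def)
      from patch_eq_shift[OF F this] have "patch R P (z + w) = patch R P (z + w')"
        by (simp add: w'_def algebra_simps)
      then show ?thesis by (rule ld(2)[unfolded locally_derivable_within_def, rule_format])
    qed
    have "w' \<in> Q" using eq[of 0] w(1) \<open>K > 0\<close> by simp
    moreover have "dist (rep F) w' \<le> r" using wp by (simp add: w'_def dist_norm norm_minus_commute)
    moreover have "G = patch K Q w'" unfolding w(2) patch_eq_iff using eq by simp
    ultimately have "G \<in> patch K Q ` (Q \<inter> cball (rep F) r)" by auto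
    then show "G \<in> (\<Union>F\<in>patch M P ` P. patch K Q ` (Q \<inter> cball (rep F) r))"
      using p(1) F_def by (intro UN_I[of F]) simp_all
  qed
  moreover have "finite (\<Union>F\<in>patch M P ` P. patch K Q ` (Q \<inter> cball (rep F) r))"
    using delone_finite_cball[OF Q] by (intro finite_UN_I[OF fin] finite_imageI)
  ultimately show "finite (patch K Q ` Q)" by (rule finite_subset)
qed

lemma locally_derivable_withinI:
  assumes "\<And>x y. patch R P x = patch R P y \<Longrightarrow> x \<in> Q \<Longrightarrow> y \<in> Q"
  shows "locally_derivable_within R P Q"
  unfolding locally_derivable_within_def
proof (intro allI impI iffI)
  fix x y assume p: "patch R P x = patch R P y"
  show "y \<in> Q" if "x \<in> Q" using p that by (rule assms)
  show "x \<in> Q" if "y \<in> Q" using p[symmetric] that by (rule assms)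
qed

text \<open>
  The moved points determine short differences in \<open>Q\<close>, hence by chaining its patches, and these
  tell which of the finitely many patterns of \<open>P\<close> occurs around a moved point.
\<close>

lemma local_displacement:
  fixes P Q :: "'a::euclidean_space set"
  assumes P: "delone P" "finite_local_complexity P" and Q: "delone Q" "finite_local_complexity Q"
    and \<phi>: "topological_conjugacy (tiling_hull P) (tiling_hull Q) \<phi>" "\<phi> P = Q" and "\<delta>0 > 0"
  shows "\<exists>h. (\<forall>x\<in>Q. dist (h x) x \<le> \<delta>0) \<and> (\<exists>R>0. locally_derivable_within R P (h ` Q)) \<and>
     (\<exists>R>0. locally_derivable_within R (h ` Q) P)"
proof -
  obtain rP where rP: "rP > 0" "\<And>x. \<exists>y\<in>P. dist x y \<le> rP" using P(1) by (rule delone_covering) blast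
  obtain r where r: "r > 0" "\<And>x. \<exists>y\<in>Q. dist x y \<le> r" using Q(1) by (rule delone_covering) blast
  obtain e where e: "e > 0" "\<And>x y. x \<in> P \<Longrightarrow> y \<in> P \<Longrightarrow> dist x y < e \<Longrightarrow> x = y"
    using P(1) by (rule delone_separation) blast
  have "2 * r + 2 > 0" using r by simp
  from flc_differences[OF Q this] obtain e' where e': "e' > 0"
    "\<forall>x\<in>Q. \<forall>y\<in>Q. \<forall>x'\<in>Q. \<forall>y'\<in>Q. dist x y \<le> 2 * r + 2 \<longrightarrow> dist x' y' \<le> 2 * r + 2 \<longrightarrow>
      dist (y - x) (y' - x') < e' \<longrightarrow> y - x = y' - x'" by (elim exE conjE)
  \<comment> \<open>3\<delta> < e identifies two nearby occurrences of the same patch of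
    \<open>P\<close>; 4\<delta> < e' absorbs the displacements of the four points in a comparison of
    two differences.\<close>
  define \<delta> where "\<delta> = min (min \<delta>0 (1/4)) (min (e / 4) (e' / 5))"
  have \<delta>: "\<delta> > 0" "\<delta> \<le> \<delta>0" "4 * \<delta> \<le> 1" "3 * \<delta> < e" "4 * \<delta> < e'"
    using \<open>\<delta>0 > 0\<close> e(1) e'(1) by (auto simp: \<delta>_def min_def)
  \<comment> \<open>A patch of radius \<open>rP\<close> contains a point of \<open>P\<close>, which
    pins down its position. From \<open>h x\<close> the radius must also reach the points of
    \<open>P\<close> within \<open>r\<close> of \<open>x\<close>; the 2 is slack for
    displacements.\<close>
  define \<rho> where "\<rho> = rP + r + 2"
  have \<phi>': "topological_conjugacy (tiling_hull Q) (tiling_hull P) (inv_into (tiling_hull P) \<phi>)"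
    "inv_into (tiling_hull P) \<phi> Q = P"
    using topological_conjugacy_inv(1)[OF \<phi>(1)]
      bij_betw_inv_into_left[OF topological_conjugacy_inv(2)[OF \<phi>(1)] self_in_tiling_hull] \<phi>(2) by simp_all
  obtain R1 where R1: "R1 > 0" "\<forall>x y. patch R1 Q x = patch R1 Q y \<longrightarrow>
      (\<exists>t. norm t \<le> \<delta> \<and> patch (\<rho> + \<delta>) P x = patch (\<rho> + \<delta>) P (y + t))"
    using hull_uniform_continuity[OF Q \<phi>'(1) \<delta>(1), where r="\<rho> + \<delta>"] unfolding \<phi>'(2)
    by (elim exE conjE)
  obtain R2 where R2: "R2 > 0" "\<forall>x y. patch R2 P x = patch R2 P y \<longrightarrow>
      (\<exists>t. norm t \<le> \<delta> \<and> patch (R1 + 1) Q x = patch (R1 + 1) Q (y + t))"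
    using hull_uniform_continuity[OF P \<phi>(1) \<delta>(1), where r="R1 + 1"] unfolding \<phi>(2)
    by (elim exE conjE)
  \<comment> \<open>One point for each patch of \<open>Q\<close>. The pattern of \<open>P\<close>
    around \<open>h x\<close> is copied from the representative, so it depends on the patch of
    \<open>Q\<close> at \<open>x\<close> alone.\<close>
  define rep where "rep F = (SOME q. q \<in> Q \<and> patch R1 Q q = F)" for F
  have rep: "rep (patch R1 Q x) \<in> Q \<and> patch R1 Q (rep (patch R1 Q x)) = patch R1 Q x" if "x \<in> Q" for x
    unfolding rep_def by (rule someI[of _ x]) (simp add: that)
  define ok where "ok x w \<longleftrightarrow> dist w x \<le> \<delta> \<and> patch \<rho> P w = patch \<rho> P (rep (patch R1 Q x))" for x w
  have ex: "\<exists>w. ok x w" if "x \<in> Q" for x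
  proof -
    have "patch R1 Q x = patch R1 Q (rep (patch R1 Q x))" using rep[OF that] by simp
    from R1(2)[rule_format, OF this] obtain t where t: "norm t \<le> \<delta>"
      "patch (\<rho> + \<delta>) P x = patch (\<rho> + \<delta>) P (rep (patch R1 Q x) + t)" by (elim exE conjE)
    have "patch \<rho> P (x + - t) = patch \<rho> P (rep (patch R1 Q x) + t + - t)"
      by (rule patch_eq_shift[OF t(2)]) (use t(1) in simp)
    then have "ok x (x - t)" using t(1) by (simp add: ok_def dist_norm)
    then show ?thesis ..
  qed
  define h where "h x = (SOME w. ok x w)" for x
  have hok: "ok x (h x)" if "x \<in> Q" for x unfolding h_def by (rule someI_ex[OF ex[OF that]])
  have h: "dist (h x) x \<le> \<delta>" "patch \<rho> P (h x) = patch \<rho> P (rep (patch R1 Q x))" if "x \<in> Q" for x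
    using hok[OF that] by (auto simp: ok_def)
  have unique: "w = w'" if "patch \<rho> P w = patch \<rho> P w'" "dist w w' < e" for w w'
  proof -
    obtain p where p: "p \<in> P" "dist w p \<le> rP" using rP(2) by blast
    have "norm (p - w) \<le> \<rho>" using p(2) r by (simp add: \<rho>_def dist_norm norm_minus_commute)
    from patch_eqD[OF that(1) this] have "p - w + w' \<in> P" using p(1) by simp
    moreover have "dist p (p - w + w') < e" using that(2) by (simp add: dist_norm)
    ultimately have "p = p - w + w'" using e(2) p(1) by blast
    then show ?thesis by (simp add: algebra_simps)
  qed
  \<comment> \<open>The patch of \<open>P\<close> at w' reveals a point x' of \<open>Q\<close> whose
    surroundings match those of \<open>x\<close>. Then h x' carries the same patch of
    \<open>P\<close> as w' and is within 3\<delta> of it, so the two coincide.\<close>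
  have "locally_derivable_within (R2 + \<rho>) P (h ` Q)"
  proof (rule locally_derivable_withinI)
    fix w w' assume p: "patch (R2 + \<rho>) P w = patch (R2 + \<rho>) P w'" and "w \<in> h ` Q"
    then obtain x where x: "x \<in> Q" "w = h x" by blast
    have \<rho>0: "\<rho> > 0" using rP r by (simp add: \<rho>_def)
    have "patch R2 P w = patch R2 P w'" by (rule patch_eq_mono[OF p]) (use \<rho>0 in simp)
    from R2(2)[rule_format, OF this] obtain t where t: "norm t \<le> \<delta>" "patch (R1 + 1) Q w = patch (R1 + 1) Q (w' + t)"
      by (elim exE conjE)
    define v where "v = x - w"
    have v: "norm v \<le> \<delta>" using h(1)[OF x(1)] x(2) by (simp add: v_def dist_norm norm_minus_commute)
    define x' where "x' = w' + t + v"
    have "patch R1 Q (w + v) = patch R1 Q (w' + t + v)"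
      by (rule patch_eq_shift[OF t(2)]) (use v \<delta>(3) \<delta>(1) in simp)
    then have px: "patch R1 Q x = patch R1 Q x'" by (simp add: v_def x'_def)
    have x': "x' \<in> Q" using patch_eqD[OF px, of 0] x(1) R1(1) by simp
    have "patch \<rho> P (h x') = patch \<rho> P w" using h(2)[OF x'] h(2)[OF x(1)] px x(2) by simp
    also have "\<dots> = patch \<rho> P w'" by (rule patch_eq_mono[OF p]) (use R2 in simp)
    finally have pw: "patch \<rho> P (h x') = patch \<rho> P w'" .
    have "dist x' w' \<le> 2 * \<delta>" using norm_triangle_ineq[of t v] t(1) v by (simp add: x'_def dist_norm algebra_simps)
    then have "dist (h x') w' \<le> 3 * \<delta>" using dist_triangle[of "h x'" w' x'] h(1)[OF x'] by simp
    then have "h x' = w'" using unique[OF pw] \<delta>(4) by simp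
    then show "w' \<in> h ` Q" using x' by blast
  qed
  moreover have "R2 + \<rho> > 0" using R2 rP r by (simp add: \<rho>_def)
  moreover have "locally_derivable_within (R1 + r + 2) (h ` Q) P"
  proof (rule locally_derivable_withinI)
    define R where "R = R1 + r + 2"
    have transfer: "y - x + x' \<in> Q"
      if p: "patch R (h ` Q) u = patch R (h ` Q) v" and x: "x \<in> Q" "x' \<in> Q" "h x' - v = h x - u" "dist x u \<le> r + 1"
        and y: "y \<in> Q" "dist y x \<le> R1" for u v x x' y
    proof -
      have move: "\<exists>y'\<in>Q. h y' = h y - u + v" if "y \<in> Q" "dist y x \<le> R1" for y
      proof -
        have "dist (h y) u \<le> R"
          using h(1)[OF that(1)] that(2) x(4) dist_triangle[of "h y" u y] dist_triangle[of y u x] \<delta>(3) \<delta>(1)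
          by (simp add: R_def)
        then have "norm (h y - u) \<le> R" by (simp add: dist_norm)
        from patch_eqD[OF p this] have "h y - u + v \<in> h ` Q" using that(1) by simp
        then show ?thesis by auto
      qed
      \<comment> \<open>Differences as long as \<open>R1\<close> cannot be compared at once:
        \<open>R1\<close> was obtained from \<delta>, and \<delta> from the gap \<open>e'\<close>.
        So \<open>y\<close> is joined to \<open>x\<close> by steps of length at most 2 r + 1, for
        which \<open>e'\<close> was chosen, and exactness is passed on from step to step.\<close>
      have chain: "\<exists>y'\<in>Q. h y' = h y - u + v \<and> y' - x' = y - x"
        if "y \<in> Q" "dist y x \<le> R1" "dist y x \<le> real n" for n y
        using that
      proof (induction n arbitrary: y)
        case 0
        then have "y = x" by simp
        then show ?case using x by (intro bexI[of _ x']) (simp_all add: algebra_simps)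
      next
        case (Suc n)
        have "\<exists>z z'. z \<in> Q \<and> z' \<in> Q \<and> dist z y \<le> 2 * r + 1 \<and> h z' = h z - u + v \<and> z' - x' = z - x"
        proof (cases "dist y x \<le> r + 1")
          case True
          then show ?thesis using x r(1) by (intro exI[of _ x] exI[of _ x']) (simp add: dist_commute algebra_simps)
        next
          case False
          \<comment> \<open>The point \<open>c\<close> of the segment from y to x at distance r + 1
            from y has a point of \<open>Q\<close> within r. That point is nearer to x than y by at
            least 1 and is within 2 r + 1 of y.\<close>
          define l where "l = (r + 1) / dist y x"
          have d0: "dist y x > 0" using False r(1) by linarith
          have l: "0 \<le> l" "l \<le> 1" using False r(1) d0 by (simp_all add: l_def divide_le_eq_1_pos)
          define c where "c = y + l *\<^sub>R (x - y)"
          have ld: "l * dist y x = r + 1" using d0 by (simp add: l_def)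
          have "dist c y = l * dist y x" using l by (simp add: c_def dist_norm norm_minus_commute)
          then have cy: "dist c y = r + 1" using ld by simp
          have "c - x = (1 - l) *\<^sub>R (y - x)" by (simp add: c_def algebra_simps)
          then have "dist c x = (1 - l) * dist y x" using l by (simp add: dist_norm)
          also have "\<dots> = dist y x - (r + 1)" using ld by (simp add: left_diff_distrib)
          finally have cx: "dist c x = dist y x - (r + 1)" .
          obtain z where z: "z \<in> Q" "dist c z \<le> r" using r(2) by blast
          have zx: "dist z x \<le> dist y x - 1" using dist_triangle[of z x c] z(2) cx by (simp add: dist_commute)
          have "\<exists>z'\<in>Q. h z' = h z - u + v \<and> z' - x' = z - x"
            using zx Suc.prems by (intro Suc.IH z(1)) simp_all
          moreover have "dist z y \<le> 2 * r + 1" using dist_triangle[of z y c] z(2) cy by (simp add: dist_commute)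
          ultimately show ?thesis using z(1) by blast
        qed
        then obtain z z' where z: "z \<in> Q" "z' \<in> Q" "dist z y \<le> 2 * r + 1" "h z' = h z - u + v" "z' - x' = z - x"
          by (elim exE conjE)
        obtain y' where y': "y' \<in> Q" "h y' = h y - u + v" using move[OF Suc.prems(1,2)] by (elim bexE)
        have "(y - z) - (y' - z') = (h y' - y') - (h y - y) - ((h z' - z') - (h z - z))"
          using y'(2) z(4) by simp
        then have "norm ((y - z) - (y' - z')) \<le> norm ((h y' - y') - (h y - y)) + norm ((h z' - z') - (h z - z))"
          by (simp only: norm_triangle_ineq4)
        then have "norm ((y - z) - (y' - z')) \<le> (norm (h y' - y') + norm (h y - y)) + (norm (h z' - z') + norm (h z - z))"
          using norm_triangle_ineq4[of "h y' - y'" "h y - y"] norm_triangle_ineq4[of "h z' - z'" "h z - z"] by linarith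
        then have d: "dist (y - z) (y' - z') \<le> 4 * \<delta>"
          using h(1)[OF y'(1)] h(1)[OF Suc.prems(1)] h(1)[OF z(1)] h(1)[OF z(2)] by (simp add: dist_norm)
        have "dist z' y' \<le> dist z y + 4 * \<delta>"
          using d norm_triangle_ineq2[of "y' - z'" "y - z"] by (simp add: dist_norm norm_minus_commute)
        then have "dist z' y' \<le> 2 * r + 2" "dist z y \<le> 2 * r + 2" using z(3) \<delta>(3) by simp_all
        then have "y - z = y' - z'" using e'(2) z(1,2) y'(1) Suc.prems(1) d \<delta>(5) by simp
        then have "(y' - z') + (z' - x') = (y - z) + (z - x)" using z(5) by simp
        then have "y' - x' = y - x" by simp
        then show ?case using y' by blast
      qed
      obtain n where "dist y x \<le> real n" using real_arch_simple by blast
      from chain[OF y this] obtain y' where "y' \<in> Q" "y' - x' = y - x" by (elim bexE conjE)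
      then show ?thesis by (metis diff_add_cancel)
    qed
    fix u v assume "patch (R1 + r + 2) (h ` Q) u = patch (R1 + r + 2) (h ` Q) v" and u: "u \<in> P"
    then have p: "patch R (h ` Q) u = patch R (h ` Q) v" by (simp add: R_def)
    obtain x where x: "x \<in> Q" "dist u x \<le> r" using r(2) by blast
    have hxu: "dist (h x) u \<le> r + \<delta>" using dist_triangle[of "h x" u x] h(1)[OF x(1)] x(2) by (simp add: dist_commute)
    have "norm (h x - u) \<le> R" using hxu \<delta>(3) R1(1) by (simp add: R_def dist_norm)
    from patch_eqD[OF p this] have "h x - u + v \<in> h ` Q" using x(1) by simp
    then obtain x' where x': "x' \<in> Q" "h x' = h x - u + v" by auto
    have xu: "dist x u \<le> r + 1" using x(2) by (simp add: dist_commute)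
    have "dist (h x') v = dist (h x) u" using x'(2) by (simp add: dist_norm)
    then have x'v: "dist x' v \<le> r + 1"
      using dist_triangle[of x' v "h x'"] h(1)[OF x'(1)] hxu \<delta>(1,3) by (simp add: dist_commute)
    have "patch R1 Q x = patch R1 Q x'"
      unfolding patch_eq_iff
    proof (intro allI impI iffI)
      fix z :: 'a assume z: "norm z \<le> R1"
      show "z + x' \<in> Q" if "z + x \<in> Q"
        using transfer[OF p x(1) x'(1) _ xu that] x'(2) z by (simp add: dist_norm)
      show "z + x \<in> Q" if "z + x' \<in> Q"
        using transfer[OF p[symmetric] x'(1) x(1) _ x'v that] x'(2) z by (simp add: dist_norm)
    qed
    then have "patch \<rho> P (h x) = patch \<rho> P (h x')" using h(2)[OF x(1)] h(2)[OF x'(1)] by simp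
    moreover have "norm (u - h x) \<le> \<rho>" using hxu rP \<delta>(3) by (simp add: \<rho>_def dist_norm norm_minus_commute)
    ultimately have "u - h x + h x \<in> P \<longleftrightarrow> u - h x + h x' \<in> P" by (rule patch_eqD)
    then show "v \<in> P" using u x'(2) by simp
  qed
  moreover have "R1 + r + 2 > 0" using R1 r by simp
  moreover have "\<forall>x\<in>Q. dist (h x) x \<le> \<delta>0" using h(1) \<delta>(2) by force
  ultimately show ?thesis by blast
qed

section \<open>From the base points to the whole hull\<close>

text \<open>By continuity at \<open>A\<close>, a single place in \<open>P\<close> models both
  \<open>A\<close> and its image, up to a small shift of the image. Relations between the points of
  \<open>P\<close> and of \<open>s P\<close> thus pass to the whole hull.\<close>

lemma joint_approximation:
  assumes s: "topological_conjugacy (tiling_hull P) \<Omega> s" and A: "A \<in> tiling_hull P" and "\<gamma> > 0"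
  shows "\<exists>a t. norm t \<le> \<gamma> \<and> patch \<rho> A 0 = patch \<rho> P a \<and> patch \<rho> (s A) 0 = patch \<rho> (s P) (a + t)"
proof -
  have cont: "continuous_map (hull_topology (tiling_hull P)) (hull_topology \<Omega>) s"
    using s homeomorphic_imp_continuous_map by (auto simp: topological_conjugacy_def)
  define \<theta> where "\<theta> = min \<gamma> (1 / (\<bar>\<rho>\<bar> + 1))"
  have \<theta>: "\<theta> > 0" "\<theta> \<le> \<gamma>" "\<theta> \<le> 1 / (\<bar>\<rho>\<bar> + 1)" using \<open>\<gamma> > 0\<close> by (auto simp: \<theta>_def)
  have \<theta>\<rho>: "\<rho> \<le> 1 / \<theta>"
  proof -
    have "\<bar>\<rho>\<bar> + 1 \<le> 1 / \<theta>" using \<theta>(1,3) by (simp add: field_simps)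
    then show ?thesis by linarith
  qed
  obtain \<eta> where \<eta>: "\<eta> > 0" "\<forall>B\<in>tiling_hull P. tiling_close \<eta> A B \<longrightarrow> tiling_close \<theta> (s A) (s B)"
    using cont[unfolded continuous_map_hull_iff] A \<theta>(1) by blast
  obtain a where a: "patch (max \<rho> (1/\<eta>)) A 0 = patch (max \<rho> (1/\<eta>)) P a"
    using A unfolding mem_tiling_hull_iff_patch by (elim allE exE)
  have "patch (1/\<eta>) A 0 = patch (1/\<eta>) P a" by (rule patch_eq_mono[OF a]) simp
  then have "tiling_close \<eta> A (translate P a)"
    using \<eta>(1) by (intro tiling_close_refl_patch) (simp_all add: patch_translate)
  moreover have "translate P a \<in> tiling_hull P" by (rule translate_in_tiling_hull[OF self_in_tiling_hull])
  ultimately have "tiling_close \<theta> (s A) (s (translate P a))" using \<eta>(2) by simp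
  moreover have "s (translate P a) = translate (s P) a"
    using s self_in_tiling_hull by (auto simp: topological_conjugacy_def)
  ultimately obtain t where t: "norm t \<le> \<theta>" "patch (1/\<theta>) (s A) 0 = patch (1/\<theta>) (s P) (a + t)"
    by (auto simp: tiling_close_iff_patch patch_translate)
  have "patch \<rho> (s A) 0 = patch \<rho> (s P) (a + t)" by (rule patch_eq_mono[OF t(2) \<theta>\<rho>])
  moreover have "patch \<rho> A 0 = patch \<rho> P a" by (rule patch_eq_mono[OF a]) simp
  moreover have "norm t \<le> \<gamma>" using t(1) \<theta>(2) by simp
  ultimately show ?thesis by (intro exI[of _ a] exI[of _ t]) simp
qed

lemma continuous_map_hull_euclidean:
  fixes f :: "'a::real_normed_vector set \<Rightarrow> 'b::metric_space"
  assumes "\<And>A e. A \<in> \<Omega> \<Longrightarrow> e > 0 \<Longrightarrow> \<exists>\<eta>>0. \<forall>B\<in>\<Omega>. tiling_close \<eta> A B \<longrightarrow> dist (f A) (f B) < e"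
  shows "continuous_map (hull_topology \<Omega>) euclidean f"
proof (rule continuous_map_hullI)
  fix A and U :: "'b set" assume A: "A \<in> \<Omega>" "openin euclidean U" "f A \<in> U"
  obtain e where e: "e > 0" "ball (f A) e \<subseteq> U"
    using A(2,3) open_contains_ball by (metis open_openin)
  obtain \<eta> where \<eta>: "\<eta> > 0" "\<forall>B\<in>\<Omega>. tiling_close \<eta> A B \<longrightarrow> dist (f A) (f B) < e"
    using assms[OF A(1) e(1)] by (elim exE conjE)
  show "\<exists>\<eta>>0. \<forall>B\<in>\<Omega>. tiling_close \<eta> A B \<longrightarrow> f B \<in> U"
    using \<eta> e(2) by (intro exI[of _ \<eta>]) (simp add: subset_iff)
qed simp

section \<open>The decomposition\<close>

text \<open>The continuous extension of the displacement is obtained without a limit: for a pattern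
  \<open>A\<close> of the hull that contains 0, the image \<open>s A\<close> has exactly one point
  within 2\<delta> of 0, and \<open>f A\<close> is that point.\<close>

lemma displacement_function:
  fixes P Q :: "'a::euclidean_space set"
  assumes s: "topological_conjugacy (tiling_hull P) (tiling_hull Q) s" "s P = Q"
    and near: "\<forall>x\<in>Q. dist (h x) x \<le> \<delta>" "P = h ` Q"
    and sep: "\<forall>x\<in>Q. \<forall>y\<in>Q. dist x y < e \<longrightarrow> x = y"
    and \<delta>: "0 < \<delta>" "5 * \<delta> < e" "4 * \<delta> \<le> 1"
  defines "f \<equiv> \<lambda>A. SOME z. z \<in> s A \<and> norm z \<le> 2 * \<delta>"
  shows "\<And>A. A \<in> tiling_hull P \<Longrightarrow> 0 \<in> A \<Longrightarrow> norm (f A) \<le> 2 * \<delta>"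
    and "\<And>x. x \<in> Q \<Longrightarrow> f (translate P (h x)) = x - h x"
    and "\<And>A. A \<in> tiling_hull P \<Longrightarrow> s A = {x + f (translate A x) | x. x \<in> A}"
    and "continuous_map (hull_topology {A \<in> tiling_hull P. 0 \<in> A}) euclidean f"
proof -
  note h = bspec[OF near(1)] near(2) and e = sep[rule_format]
  have str: "s (translate A x) = translate (s A) x" if "A \<in> tiling_hull P" for A x
    using s(1) that by (simp add: topological_conjugacy_def)
  have cont: "continuous_map (hull_topology (tiling_hull P)) (hull_topology (tiling_hull Q)) s"
    using s(1) homeomorphic_imp_continuous_map by (auto simp: topological_conjugacy_def)
  have sQ: "s A \<in> tiling_hull Q" if "A \<in> tiling_hull P" for A
    using cont that unfolding continuous_map_hull_iff by blast
  have unique: "z = z'" if "A \<in> tiling_hull P" "z \<in> s A" "z' \<in> s A" "dist z z' < e" for A z z'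
    by (rule separation_tiling_hull[OF sQ[OF that(1)] e that(2-4)])
  \<comment> \<open>One \<delta> comes from the displacement by \<open>h\<close>, the other from the
    shift between the models of \<open>A\<close> and of \<open>s A\<close>.\<close>
  have near0: "\<exists>z\<in>s A. norm z \<le> 2 * \<delta>" if A: "A \<in> tiling_hull P" "0 \<in> A" for A
  proof -
    obtain a t where at: "norm t \<le> \<delta>" "patch 1 A 0 = patch 1 P a" "patch 1 (s A) 0 = patch 1 Q (a + t)"
      using joint_approximation[OF s(1) A(1) \<delta>(1), of 1] unfolding s(2) by (elim exE conjE)
    have "a \<in> P" using patch_eqD[OF at(2), of 0] A(2) by simp
    then obtain q where q: "q \<in> Q" "a = h q" using h(2) by blast
    define z where "z = q - a - t"
    have "norm (q - a) \<le> \<delta>" using h(1)[OF q(1)] q(2) by (simp add: dist_norm norm_minus_commute)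
    then have z: "norm z \<le> 2 * \<delta>" unfolding z_def using at(1) norm_triangle_ineq4[of "q - a" t] by simp
    then have "norm z \<le> 1" using \<delta>(1,3) by simp
    from patch_eqD[OF at(3) this] have "z \<in> s A" using q(1) by (simp add: z_def)
    then show ?thesis using z by blast
  qed
  have f: "f A \<in> s A" "norm (f A) \<le> 2 * \<delta>" if A: "A \<in> tiling_hull P" "0 \<in> A" for A
  proof -
    have "f A \<in> s A \<and> norm (f A) \<le> 2 * \<delta>"
      unfolding f_def by (rule someI_ex) (use near0[OF A] in blast)
    then show "f A \<in> s A" "norm (f A) \<le> 2 * \<delta>" by simp_all
  qed
  \<comment> \<open>Uniqueness with some room: 2\<delta> + 3\<delta> is still below the separation
    of \<open>s A\<close>. The room serves the continuity proof.\<close>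
  have feq: "f A = z" if A: "A \<in> tiling_hull P" "0 \<in> A" and z: "z \<in> s A" "norm z \<le> 3 * \<delta>" for A z
  proof (rule unique[OF A(1) f(1)[OF A] z(1)])
    show "dist (f A) z < e"
      using f(2)[OF A] z(2) \<delta> norm_triangle_ineq4[of "f A" z] by (simp add: dist_norm)
  qed
  show "norm (f A) \<le> 2 * \<delta>" if "A \<in> tiling_hull P" "0 \<in> A" for A by (rule f(2)[OF that])
  have hull: "translate A x \<in> tiling_hull P" if "A \<in> tiling_hull P" for A x
    using that by (rule translate_in_tiling_hull)
  show "f (translate P (h x)) = x - h x" if x: "x \<in> Q" for x
  proof (rule feq)
    show "0 \<in> translate P (h x)" using x h(2) by (simp add: mem_translate_iff)
    show "x - h x \<in> s (translate P (h x))"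
      using x s(2) by (simp add: str[OF self_in_tiling_hull] mem_translate_iff)
    show "norm (x - h x) \<le> 3 * \<delta>" using h(1)[OF x] \<delta>(1) by (simp add: dist_norm norm_minus_commute)
  qed (rule hull[OF self_in_tiling_hull])
  show "s A = {x + f (translate A x) | x. x \<in> A}" if A: "A \<in> tiling_hull P" for A
  proof (intro subset_antisym subsetI)
    fix y assume y: "y \<in> s A"
    define \<rho> where "\<rho> = norm y + 1"
    obtain a t where at: "norm t \<le> \<delta>" "patch \<rho> A 0 = patch \<rho> P a" "patch \<rho> (s A) 0 = patch \<rho> Q (a + t)"
      using joint_approximation[OF s(1) A \<delta>(1), of \<rho>] unfolding s(2) by (elim exE conjE)
    have "norm y \<le> \<rho>" by (simp add: \<rho>_def)
    from patch_eqD[OF at(3) this] have q: "y + (a + t) \<in> Q" using y by simp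
    define x where "x = h (y + (a + t)) - a"
    have "norm (x - y) \<le> norm (h (y + (a + t)) - (y + (a + t))) + norm t"
      using norm_triangle_ineq[of "h (y + (a + t)) - (y + (a + t))" t] by (simp add: x_def algebra_simps)
    then have xy: "norm (x - y) \<le> 2 * \<delta>" using h(1)[OF q] at(1) by (simp add: dist_norm)
    then have "norm x \<le> \<rho>" using norm_triangle_sub[of x y] \<delta>(1,3) by (simp add: \<rho>_def)
    moreover have "x + a \<in> P" using q h(2) by (simp add: x_def)
    ultimately have x: "x \<in> A" using patch_eqD[OF at(2), of x] by simp
    have "f (translate A x) = y - x"
    proof (rule feq[OF hull[OF A]])
      show "0 \<in> translate A x" using x by (simp add: mem_translate_iff)
      show "y - x \<in> s (translate A x)" using y by (simp add: str[OF A] mem_translate_iff)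
      show "norm (y - x) \<le> 3 * \<delta>" using xy \<delta>(1) by (simp add: norm_minus_commute)
    qed
    then show "y \<in> {x + f (translate A x) | x. x \<in> A}" using x by (intro CollectI exI[of _ x]) simp
  next
    fix y assume "y \<in> {x + f (translate A x) | x. x \<in> A}"
    then obtain x where x: "x \<in> A" "y = x + f (translate A x)" by blast
    have "f (translate A x) \<in> s (translate A x)"
      using x(1) by (intro f(1) hull[OF A]) (simp add: mem_translate_iff)
    then show "y \<in> s A" using x(2) by (simp add: str[OF A] mem_translate_iff add.commute)
  qed
  show "continuous_map (hull_topology {A \<in> tiling_hull P. 0 \<in> A}) euclidean f"
  proof (rule continuous_map_hull_euclidean)
    fix A and c :: real assume "A \<in> {A \<in> tiling_hull P. 0 \<in> A}" and c: "c > 0"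
    then have A: "A \<in> tiling_hull P" "0 \<in> A" by simp_all
    \<comment> \<open>For patterns close to each other the values of \<open>f\<close> differ exactly
      by the translation between their images, so \<gamma> < c suffices; \<gamma> \<le> \<delta>
      keeps the shifted point in the range of uniqueness.\<close>
    define \<gamma> where "\<gamma> = min \<delta> (c / 2)"
    have \<gamma>: "\<gamma> > 0" "\<gamma> \<le> \<delta>" "\<gamma> < c" using \<delta>(1) c by (auto simp: \<gamma>_def)
    have "1 / \<gamma> \<ge> 1" using \<gamma>(1,2) \<delta>(1,3) by simp
    then have \<gamma>1: "2 * \<delta> \<le> 1 / \<gamma>" using \<delta>(1,3) by linarith
    obtain \<eta> where \<eta>: "\<eta> > 0" "\<forall>B\<in>tiling_hull P. tiling_close \<eta> A B \<longrightarrow> tiling_close \<gamma> (s A) (s B)"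
      using cont[unfolded continuous_map_hull_iff] A \<gamma>(1) by blast
    have "dist (f A) (f B) < c" if B: "B \<in> {A \<in> tiling_hull P. 0 \<in> A}" and close: "tiling_close \<eta> A B" for B
    proof -
      have "tiling_close \<gamma> (s A) (s B)" using \<eta>(2) B close by simp
      then obtain t where t: "norm t \<le> \<gamma>" "patch (1/\<gamma>) (s A) 0 = patch (1/\<gamma>) (s B) t"
        unfolding tiling_close_iff_patch by (elim exE conjE)
      have "norm (f A) \<le> 1/\<gamma>" using f(2)[OF A] \<gamma>1 by simp
      from patch_eqD[OF t(2) this] have "f A + t \<in> s B" using f(1)[OF A] by simp
      moreover have "norm (f A + t) \<le> 3 * \<delta>"
        using norm_triangle_ineq[of "f A" t] f(2)[OF A] t(1) \<gamma>(2) by simp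
      ultimately have "f B = f A + t" using B by (intro feq) simp_all
      then show ?thesis using t(1) \<gamma>(3) by (simp add: dist_norm)
    qed
    then show "\<exists>\<eta>>0. \<forall>B\<in>{A \<in> tiling_hull P. 0 \<in> A}. tiling_close \<eta> A B \<longrightarrow> dist (f A) (f B) < c"
      using \<eta>(1) by (intro exI[of _ \<eta>]) simp
  qed
qed

text \<open>By uniform continuity, points with equal large patches have nearly equal displacements.
  The approximating cochain takes the value at one representative of each patch.\<close>

lemma displacement_weakly_PE:
  fixes P Q :: "'a::euclidean_space set"
  assumes P: "delone P" "finite_local_complexity P"
    and s: "topological_conjugacy (tiling_hull P) (tiling_hull Q) s" "s P = Q"
    and k: "\<And>w. w \<in> P \<Longrightarrow> k w \<in> Q" "\<And>w. w \<in> P \<Longrightarrow> dist (k w) w \<le> \<delta>"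
    and e: "\<And>x y. x \<in> Q \<Longrightarrow> y \<in> Q \<Longrightarrow> dist x y < e \<Longrightarrow> x = y"
    and \<delta>: "0 < \<delta>" "5 * \<delta> < e" "4 * \<delta> \<le> 1"
    and T: "tiling_vertices T = P" and F: "\<And>w. w \<in> P \<Longrightarrow> F w = k w - w"
  shows "weakly_PE_0 T F"
  unfolding weakly_PE_0_def
proof (intro allI impI)
  fix \<gamma> :: real assume "\<gamma> > 0"
  \<comment> \<open>\<gamma> is the required accuracy; \<delta> ensures that the transferred point
    of \<open>Q\<close> near w' is k w'.\<close>
  then have "min \<gamma> \<delta> > 0" using \<delta>(1) by simp
  from hull_uniform_continuity[OF P s(1) this, of 1] obtain R where R: "R > 0"
    "\<forall>x y. patch R P x = patch R P y \<longrightarrow> (\<exists>t. norm t \<le> min \<gamma> \<delta> \<and> patch 1 Q x = patch 1 Q (y + t))"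
    unfolding s(2) by (elim exE conjE)
  have Feq: "norm (F w - F w') \<le> \<gamma>" if w: "w \<in> P" "w' \<in> P" "patch R P w = patch R P w'" for w w'
  proof -
    obtain t where t: "norm t \<le> min \<gamma> \<delta>" "patch 1 Q w = patch 1 Q (w' + t)"
      using R(2)[rule_format, OF w(3)] by (elim exE conjE)
    define z where "z = k w - w"
    have z: "norm z \<le> \<delta>" using k(2)[OF w(1)] by (simp add: z_def dist_norm)
    then have "norm z \<le> 1" using \<delta>(1,3) by simp
    from patch_eqD[OF t(2) this] have zQ: "z + (w' + t) \<in> Q" using k(1)[OF w(1)] by (simp add: z_def)
    have kw': "z + (w' + t) = k w'"
    proof (rule e[OF zQ k(1)[OF w(2)]])
      have "dist (z + (w' + t)) (k w') \<le> norm (z + t) + dist (k w') w'"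
        using norm_triangle_ineq4[of "z + t" "k w' - w'"] by (simp add: dist_norm algebra_simps)
      also have "\<dots> \<le> 3 * \<delta>" using norm_triangle_ineq[of z t] z t(1) k(2)[OF w(2)] by simp
      finally show "dist (z + (w' + t)) (k w') < e" using \<delta>(1,2) by simp
    qed
    have "F w' = z + t" unfolding F[OF w(2)] kw'[symmetric] by simp
    then have "F w - F w' = - t" using F[OF w(1)] by (simp add: z_def)
    then show ?thesis using t(1) by simp
  qed
  define rep where "rep p = (SOME w. w \<in> P \<and> patch R P w = p)" for p
  have rep: "rep (patch R P w) \<in> P \<and> patch R P (rep (patch R P w)) = patch R P w" if "w \<in> P" for w
    unfolding rep_def by (rule someI[of _ w]) (simp add: that)
  define G where "G w = F (rep (patch R P w))" for w
  have "G w = G w'"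
    if "translate_tiles (tiles_within R T {w}) w = translate_tiles (tiles_within R T {w'}) w'" for w w'
    using patch_from_tiles[OF that] by (simp add: G_def T)
  then have "strongly_PE_0 T G" unfolding strongly_PE_0_def by (intro exI[of _ R] ballI impI)
  moreover have "norm (F w - G w) \<le> \<gamma>" if "w \<in> tiling_vertices T" for w
    unfolding G_def using rep[of w] that by (intro Feq) (simp_all add: T)
  ultimately show "\<exists>G. strongly_PE_0 T G \<and> (\<forall>x\<in>tiling_vertices T. norm (F x - G x) \<le> \<gamma>)" by blast
qed

text \<open>Here \<open>P\<close> is \<Lambda>, \<open>Q\<close> is its image under
  \<open>\<phi>\<close> and \<open>X\<close> is the moved set. The shape conjugacy leads from
  \<open>X\<close> back to \<open>Q\<close>, so on the base point it moves by the inverse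
  \<open>k\<close> of \<open>h\<close>.\<close>

lemma conjugacy_decomposition:
  fixes P Q :: "'a::euclidean_space set"
  assumes P: "delone P" "finite_local_complexity P" and Q: "delone Q" "finite_local_complexity Q"
    and \<phi>: "topological_conjugacy (tiling_hull P) (tiling_hull Q) \<phi>" "\<phi> P = Q" and "\<epsilon> > 0"
  shows "\<exists>X \<psi> s f. delone X \<and> finite_local_complexity X \<and> mutual_local_derivation P X \<psi> \<and>
     shape_conjugacy_with_displacement (tiling_hull X) (tiling_hull Q) s f \<and>
     (\<forall>A\<in>tiling_hull P. \<phi> A = s (\<psi> A)) \<and>
     (\<forall>A\<in>tiling_hull X. \<forall>x\<in>A. norm (f (translate A x)) < \<epsilon>)"
proof -
  obtain g where g: "linear g" "inj g" "in_general_position g Q"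
    using in_general_position_exists[OF delone_countable[OF Q(1)]] by metis
  interpret G: generic_delone g Q by (intro generic_delone.intro g Q)
  obtain \<delta>0 where \<delta>0: "\<delta>0 > 0" and pert: "\<forall>h. (\<forall>x\<in>Q. dist (h x) x \<le> \<delta>0) \<longrightarrow>
     inj_on h Q \<and> delone (h ` Q) \<and> delaunay g (h ` Q) = (`) h ` delaunay g Q \<and>
     (\<forall>V\<in>delaunay g (h ` Q). \<not> affine_dependent V) \<and>
     (\<Union>V\<in>delaunay g (h ` Q). convex hull V) = UNIV"
    using G.delaunay_perturbation by (elim exE conjE)
  obtain D where D: "D > 0" "\<forall>V\<in>delaunay g Q. \<forall>x\<in>convex hull V. \<forall>y\<in>convex hull V. dist x y \<le> D"
    using delaunay_diameter[OF g(1,2) Q(1)] by (elim exE conjE)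
  obtain e' where e': "e' > 0" "\<forall>x\<in>Q. \<forall>y\<in>Q. \<forall>x'\<in>Q. \<forall>y'\<in>Q. dist x y \<le> D \<longrightarrow> dist x' y' \<le> D \<longrightarrow>
      dist (y - x) (y' - x') < e' \<longrightarrow> y - x = y' - x'"
    using flc_differences[OF Q D(1)] by (elim exE conjE)
  obtain e where e: "e > 0" "\<And>x y. x \<in> Q \<Longrightarrow> y \<in> Q \<Longrightarrow> dist x y < e \<Longrightarrow> x = y"
    using Q(1) by (rule delone_separation) blast
  \<comment> \<open>In turn: stability of the Delaunay triangulation, slack, uniqueness in
    \<open>displacement_function\<close> (5\<delta> < e), equality of edge vectors (4\<delta> < e'),
    and the bound 2\<delta> on the values of \<open>f\<close>.\<close>
  define \<delta> where "\<delta> = min (min \<delta>0 (1/4)) (min (min (e / 6) (e' / 5)) (\<epsilon> / 3))"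
  have \<delta>: "\<delta> > 0" "\<delta> \<le> \<delta>0" "4 * \<delta> \<le> 1" "5 * \<delta> < e" "4 * \<delta> < e'" "2 * \<delta> < \<epsilon>"
    using \<delta>0 e(1) e'(1) \<open>\<epsilon> > 0\<close> by (auto simp: \<delta>_def min_def)
  obtain h R R' where h: "\<forall>x\<in>Q. dist (h x) x \<le> \<delta>"
    and ld: "R > 0" "locally_derivable_within R P (h ` Q)" "R' > 0" "locally_derivable_within R' (h ` Q) P"
    using local_displacement[OF P Q \<phi> \<delta>(1)] by (elim exE conjE)
  define X where "X = h ` Q"
  have h0: "\<forall>x\<in>Q. dist (h x) x \<le> \<delta>0" using h \<delta>(2) by force
  note ph = pert[THEN spec[of _ h], THEN mp, OF h0]
  have hinj: "inj_on h Q" and X: "delone X" and delX: "delaunay g X = (`) h ` delaunay g Q"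
    using ph unfolding X_def by simp_all
  have flcX: "finite_local_complexity X"
    using flc_locally_derivable[OF P X[unfolded X_def] ld(1,2)] by (simp add: X_def)
  have indX: "\<not> affine_dependent V" if "V \<in> delaunay g X" for V
    using ph that unfolding X_def by (elim conjE) (rule bspec)
  have covX: "(\<Union>V\<in>delaunay g X. convex hull V) = UNIV"
    using ph unfolding X_def by (elim conjE)
  interpret TX: delaunay_triangulation g X
    by (intro delaunay_triangulation.intro g(1,2) X flcX indX covX)
  \<comment> \<open>The identity is an admissible perturbation, so the theorem also gives the
    covering by the cells of \<open>Q\<close>.\<close>
  interpret TQ: delaunay_triangulation g Q
    using pert[THEN spec[of _ "\<lambda>x. x"]] \<delta>0
    by (intro delaunay_triangulation.intro g(1,2) Q G.delaunay_independent) simp_all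
  define k where "k = inv_into Q h"
  have kh: "k (h x) = x" if "x \<in> Q" for x using hinj that by (simp add: k_def)
  have kX: "k w \<in> Q" "h (k w) = w" if "w \<in> X" for w
    using that kh by (auto simp: X_def)
  have kd: "dist (k w) w \<le> \<delta>" if "w \<in> X" for w
    using bspec[OF h kX(1)[OF that]] kX(2)[OF that] by (simp add: dist_commute)
  have kinj: "inj_on k X" by (rule inj_onI) (metis kX(2))
  have khV: "k ` h ` V = V" if "V \<in> delaunay g Q" for V
    using kh delaunay_cell(4)[OF that] by (auto simp: image_image subset_iff)
  have delQ: "delaunay g Q = (`) k ` delaunay g X"
    unfolding delX image_image using khV by (simp add: image_image)
  define \<Phi> where "\<Phi> c = convex hull (k ` {x. x extreme_point_of c})" for c
  note comb = delaunay_combinatorial_isomorphism[OF TX.delaunay_triangulation_axioms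
      TQ.delaunay_triangulation_axioms kinj delQ, folded \<Phi>_def]
  let ?T = "delaunay_tiling g X" and ?T' = "delaunay_tiling g Q"
  obtain \<psi> where \<psi>: "mutual_local_derivation P X \<psi>"
    "topological_conjugacy (tiling_hull P) (tiling_hull X) \<psi>" "\<And>x. \<psi> (translate P x) = translate X x"
    using mutual_local_derivation_exists[OF ld[folded X_def]] by metis
  obtain R1 R2 where R12: "R1 > 0" "locally_derivable_within R1 X (tiling_boundary ?T)"
    "R2 > 0" "locally_derivable_within R2 (tiling_boundary ?T) X" using TX.mutually_derivable_boundary by (elim exE conjE)
  obtain m where m: "mutual_local_derivation X (tiling_boundary ?T) m"
    "topological_conjugacy (tiling_hull X) (tiling_hull (tiling_boundary ?T)) m"
    "\<And>x. m (translate X x) = translate (tiling_boundary ?T) x"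
    using mutual_local_derivation_exists[OF R12] by metis
  obtain R3 R4 where R34: "R3 > 0" "locally_derivable_within R3 Q (tiling_boundary ?T')"
    "R4 > 0" "locally_derivable_within R4 (tiling_boundary ?T') Q" using TQ.mutually_derivable_boundary by (elim exE conjE)
  obtain m' where m': "mutual_local_derivation Q (tiling_boundary ?T') m'"
    "topological_conjugacy (tiling_hull Q) (tiling_hull (tiling_boundary ?T')) m'"
    "\<And>x. m' (translate Q x) = translate (tiling_boundary ?T') x"
    using mutual_local_derivation_exists[OF R34] by metis
  note \<psi>b = topological_conjugacy_inv(2)[OF \<psi>(2)] and mb = topological_conjugacy_inv(2)[OF m(2)]
  \<comment> \<open>What remains of \<open>\<phi>\<close> after the local derivation is split off;
    \<open>S\<close> is the same map read on the boundary sets of the two tilings.\<close>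
  define s where "s A = \<phi> (inv_into (tiling_hull P) \<psi> A)" for A
  define S where "S B = m' (s (inv_into (tiling_hull X) m B))" for B
  have s\<psi>: "s (\<psi> A) = \<phi> A" if "A \<in> tiling_hull P" for A
    unfolding s_def using bij_betw_inv_into_left[OF \<psi>b that] by simp
  have sconj: "topological_conjugacy (tiling_hull X) (tiling_hull Q) s"
    unfolding s_def by (rule topological_conjugacy_compose[OF topological_conjugacy_inv(1)[OF \<psi>(2)] \<phi>(1)])
  have Sconj: "topological_conjugacy (tiling_hull (tiling_boundary ?T)) (tiling_hull (tiling_boundary ?T')) S"
    unfolding S_def
    by (rule topological_conjugacy_compose[OF topological_conjugacy_compose[OF topological_conjugacy_inv(1)[OF m(2)] sconj] m'(2)])
  have trP: "translate P x \<in> tiling_hull P" for x and P :: "'a set"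
    by (rule translate_in_tiling_hull[OF self_in_tiling_hull])
  have sX: "s (translate X x) = translate Q x" for x
    using s\<psi>[OF trP[of P x]] \<psi>(3)[of x] \<phi> self_in_tiling_hull[of P] by (simp add: topological_conjugacy_def)
  have sX0: "s X = Q" using sX[of 0] by simp
  have Sm: "S (m A) = m' (s A)" if "A \<in> tiling_hull X" for A
    unfolding S_def using bij_betw_inv_into_left[OF mb that] by simp
  have ST: "S (translate (tiling_boundary ?T) x) = translate (tiling_boundary ?T') x" for x
    using Sm[OF trP[of X x]] by (simp add: m(3) sX m'(3))
  have sep: "\<forall>x\<in>Q. \<forall>y\<in>Q. dist x y < e \<longrightarrow> x = y" using e(2) by simp
  define f where "f A = (SOME z. z \<in> s A \<and> norm z \<le> 2 * \<delta>)" for A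
  note f = displacement_function[OF sconj sX0 h X_def sep \<delta>(1,4,3), folded f_def]
  have cv: "corresponding_vertex \<Phi> w = k w" if "w \<in> X" for w using comb(2) that by simp
  have F: "vertex_displacement \<Phi> w = k w - w" if "w \<in> X" for w
    unfolding vertex_displacement_def cv[OF that] ..
  have weak: "weakly_PE_0 ?T (vertex_displacement \<Phi>)"
    by (rule displacement_weakly_PE[OF X flcX sconj sX0 kX(1) kd e(2) \<delta>(1,4,3) TX.vertices F])
  have edge: "x \<in> X \<and> y \<in> X \<and> dist (k x) (k y) \<le> D" if xy: "(x, y) \<in> oriented_edges ?T" for x y
  proof -
    obtain V where V: "V \<in> delaunay g X" "x \<in> V" "y \<in> V" using TX.oriented_edge_cell[OF xy] by (elim bexE conjE)
    have kV: "k ` V \<in> delaunay g Q" using V(1) delQ by simp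
    have "k x \<in> convex hull (k ` V)" "k y \<in> convex hull (k ` V)" using V(2,3) by (simp_all add: hull_inc)
    then have "dist (k x) (k y) \<le> D" using D(2) kV by simp
    then show ?thesis using V delaunay_cell(4)[OF V(1)] by (simp add: subset_iff)
  qed
  have strong: "strongly_PE_1 ?T (\<lambda>(x, y). corresponding_vertex \<Phi> y - corresponding_vertex \<Phi> x)"
  proof -
    \<comment> \<open>Edges of the deformed tiling are differences of \<open>Q\<close> of length at
      most \<open>D\<close>. If two edges of the original tiling are parallel translates, the
      deformed ones differ by at most 4\<delta> < e', hence not at all.\<close>
    have *: "corresponding_vertex \<Phi> y - corresponding_vertex \<Phi> x =
        corresponding_vertex \<Phi> v - corresponding_vertex \<Phi> u"
      if xy: "(x, y) \<in> oriented_edges ?T" and uv: "(u, v) \<in> oriented_edges ?T" and eq: "y - x = v - u" for x y u v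
    proof -
      have a: "x \<in> X" "y \<in> X" "dist (k x) (k y) \<le> D" and b: "u \<in> X" "v \<in> X" "dist (k u) (k v) \<le> D"
        using edge[OF xy] edge[OF uv] by simp_all
      have "(k y - k x) - (k v - k u) = ((k y - y) - (k x - x)) - ((k v - v) - (k u - u))"
        using eq by (simp add: algebra_simps)
      then have "norm ((k y - k x) - (k v - k u)) \<le> norm ((k y - y) - (k x - x)) + norm ((k v - v) - (k u - u))"
        by (simp only: norm_triangle_ineq4)
      also have "\<dots> \<le> 4 * \<delta>"
        using norm_triangle_ineq4[of "k y - y" "k x - x"] norm_triangle_ineq4[of "k v - v" "k u - u"]
          kd[OF a(1)] kd[OF a(2)] kd[OF b(1)] kd[OF b(2)] by (simp add: dist_norm)
      finally have "dist (k y - k x) (k v - k u) < e'" using \<delta>(5) by (simp add: dist_norm)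
      then have "k y - k x = k v - k u"
        by (rule e'(2)[rule_format, OF kX(1)[OF a(1)] kX(1)[OF a(2)] kX(1)[OF b(1)] kX(1)[OF b(2)] a(3) b(3)])
      then show ?thesis unfolding cv[OF a(1)] cv[OF a(2)] cv[OF b(1)] cv[OF b(2)] .
    qed
    \<comment> \<open>The edge vector determines the value of the cochain, so radius 0
      suffices.\<close>
    show ?thesis
      unfolding strongly_PE_1_def by (rule exI[of _ 0]) (clarify; rule *; assumption)
  qed
  have deform: "shape_deformation ?T ?T' \<Phi>"
    unfolding shape_deformation_def
    using TX.polyhedral TX.flc_tiling TQ.polyhedral TQ.flc_tiling comb(1) strong by simp
  have "continuous_map (hull_topology (tiling_hull (tiling_boundary ?T))) (hull_topology (tiling_hull (tiling_boundary ?T'))) S"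
    using Sconj homeomorphic_imp_continuous_map by (auto simp: topological_conjugacy_def)
  then have TT: "tiling_shape_conjugacy ?T ?T' \<Phi> S"
    unfolding tiling_shape_conjugacy_def tiling_shape_semi_conjugacy_def
    using deform weak ST Sconj by simp
  have sb: "s A \<in> tiling_hull Q" if "A \<in> tiling_hull X" for A
    using bij_betwE[OF topological_conjugacy_inv(2)[OF sconj]] that by simp
  have "shape_conjugacy_with_displacement (tiling_hull X) (tiling_hull Q) s f"
    unfolding shape_conjugacy_with_displacement_def
  proof (rule exI[of _ X], rule exI[of _ Q], rule exI[of _ ?T], rule exI[of _ ?T'], rule exI[of _ \<Phi>],
      rule exI[of _ S], rule exI[of _ m], rule exI[of _ m'], intro conjI)
    show "\<forall>A\<in>tiling_hull X. s A \<in> tiling_hull Q \<and> m' (s A) = S (m A)" using sb Sm by simp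
    show "\<forall>w\<in>X. f (translate X w) = vertex_displacement \<Phi> w"
    proof
      fix w assume w: "w \<in> X"
      show "f (translate X w) = vertex_displacement \<Phi> w"
        using f(2)[OF kX(1)[OF w]] kX(2)[OF w] F[OF w] by simp
    qed
    show "\<forall>A\<in>tiling_hull X. s A = {x + f (translate A x) | x. x \<in> A}" using f(3) by simp
  qed (fact X flcX Q TT TX.vertices TQ.vertices m(1) m'(1) f(4) refl)+
  moreover have "norm (f (translate A x)) < \<epsilon>" if "A \<in> tiling_hull X" "x \<in> A" for A x
  proof -
    have "norm (f (translate A x)) \<le> 2 * \<delta>"
      by (rule f(1)) (use that in \<open>simp_all add: translate_in_tiling_hull mem_translate_iff\<close>)
    then show ?thesis using \<delta>(6) by simp
  qed
  ultimately show ?thesis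
    using X flcX \<psi>(1) s\<psi> by (intro exI[of _ X] exI[of _ \<psi>] exI[of _ s] exI[of _ f]) simp
qed

theorem theorem1p4:
  fixes \<Lambda> \<Lambda>' :: "'a::euclidean_space set" and \<phi> :: "'a set \<Rightarrow> 'a set"
  assumes "delone \<Lambda>" "finite_local_complexity \<Lambda>"
    and "delone \<Lambda>'" "finite_local_complexity \<Lambda>'"
    and "topological_conjugacy (tiling_hull \<Lambda>) (tiling_hull \<Lambda>') \<phi>"
  shows "(\<exists>\<Lambda>\<^sub>1 \<psi> s.
            delone \<Lambda>\<^sub>1 \<and> finite_local_complexity \<Lambda>\<^sub>1 \<and>
            mutual_local_derivation \<Lambda> \<Lambda>\<^sub>1 \<psi> \<and>
            shape_conjugacy (tiling_hull \<Lambda>\<^sub>1) (tiling_hull \<Lambda>') s \<and>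
            (\<forall>P\<in>tiling_hull \<Lambda>. \<phi> P = s (\<psi> P))) \<and>
         (\<forall>\<epsilon>>0. \<exists>\<Lambda>\<^sub>1 \<psi> s f.
            delone \<Lambda>\<^sub>1 \<and> finite_local_complexity \<Lambda>\<^sub>1 \<and>
            mutual_local_derivation \<Lambda> \<Lambda>\<^sub>1 \<psi> \<and>
            shape_conjugacy_with_displacement (tiling_hull \<Lambda>\<^sub>1) (tiling_hull \<Lambda>') s f \<and>
            (\<forall>P\<in>tiling_hull \<Lambda>. \<phi> P = s (\<psi> P)) \<and>
            (\<forall>P\<in>tiling_hull \<Lambda>\<^sub>1. \<forall>x\<in>P. norm (f (translate P x)) < \<epsilon>))"
proof -
  have hull: "tiling_hull (\<phi> \<Lambda>) = tiling_hull \<Lambda>'" by (rule tiling_hull_image[OF assms(5)])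
  have mem: "\<phi> \<Lambda> \<in> tiling_hull \<Lambda>'" using self_in_tiling_hull hull by metis
  have conj: "topological_conjugacy (tiling_hull \<Lambda>) (tiling_hull (\<phi> \<Lambda>)) \<phi>" using assms(5) hull by simp
  note main = conjugacy_decomposition[OF assms(1,2) delone_tiling_hull[OF assms(3) mem]
    flc_tiling_hull[OF assms(4) mem] conj refl, unfolded hull]
  \<comment> \<open>The decomposition without a bound is the case \<epsilon> = 1, with the
    displacement function forgotten.\<close>
  obtain \<Lambda>\<^sub>1 \<psi> s f where *: "delone \<Lambda>\<^sub>1" "finite_local_complexity \<Lambda>\<^sub>1"
      "mutual_local_derivation \<Lambda> \<Lambda>\<^sub>1 \<psi>"
      "shape_conjugacy_with_displacement (tiling_hull \<Lambda>\<^sub>1) (tiling_hull \<Lambda>') s f"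
      "\<forall>P\<in>tiling_hull \<Lambda>. \<phi> P = s (\<psi> P)"
    using main[OF zero_less_one] by (elim exE conjE)
  have s: "shape_conjugacy (tiling_hull \<Lambda>\<^sub>1) (tiling_hull \<Lambda>') s"
    unfolding shape_conjugacy_def using *(4) by (rule exI[of _ f])
  show ?thesis
  proof (rule conjI, goal_cases)
    case 1
    show ?case using *(1-3) s *(5) by (intro exI conjI)
  next
    case 2
    show ?case by (intro allI impI main)
  qed
qed

end
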